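(* For every integer $N\geq 1$, $$\varepsilon_1(N,2)=4^{N-4}\,\frac{N(N-1)(N-2)(13N+3)}{3}.$$
   Context: Let $N\ge 1$. A gluing datum with $N$ edges and $2$ faces consists of a composition $(m_1,m_2)$ of $2N$ into positive integers and a fixed-point-free involution $\iota$ of $\{1,\dots,2N\}$. Let $\tau$ have cycles $(1,\dots,m_1)$ and $(m_1+1,\dots,2N)$. The datum is connected if $\langle\iota,\tau\rangle$ acts transitively and has genus $1$ if $\tau\iota$ has exactly $N-2$ cycles. (Geometrically: gluings of two numbered polygons with distinguished edges, $2N$ edges in total, into a torus, gluing paired edges with opposite orientations.) $\varepsilon_1(N,2)$ is the number of connected genus-$1$ such data. *)

theory Defs
  imports Complex_Main "HOL-Combinatorics.Orbits" "HOL-Algebra.Sym_Groups"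
begin

text \<open>
  A gluing datum is a triple \<open>(m1, m2, \<iota>)\<close>. As usual for \<open>permutes\<close>, permutations of
  \<open>{1..2 * N}\<close> are functions on \<open>nat\<close> that are the identity outside that set; this makes the
  representation of \<open>\<iota>\<close> unique, so that counting triples counts data.
\<close>

definition two_face_gluing_data :: "nat \<Rightarrow> (nat \<times> nat \<times> (nat \<Rightarrow> nat)) set" where
  "two_face_gluing_data N =
     {(m1, m2, \<iota>). 1 \<le> m1 \<and> 1 \<le> m2 \<and> m1 + m2 = 2 * N \<and>
        \<iota> permutes {1..2 * N} \<and> (\<forall>x\<in>{1..2 * N}. \<iota> (\<iota> x) = x \<and> \<iota> x \<noteq> x)}"

definition face_perm :: "nat \<Rightarrow> nat \<Rightarrow> nat \<Rightarrow> nat" where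
  "face_perm m1 m2 = cycle_of_list [1..<m1 + 1] \<circ> cycle_of_list [m1 + 1..<m1 + m2 + 1]"

definition gluing_connected :: "nat \<times> nat \<times> (nat \<Rightarrow> nat) \<Rightarrow> bool" where
  "gluing_connected = (\<lambda>(m1, m2, \<iota>).
     \<forall>x\<in>{1..m1 + m2}. \<forall>y\<in>{1..m1 + m2}.
       \<exists>g\<in>generate (sym_group (m1 + m2)) {\<iota>, face_perm m1 m2}. g x = y)"

text \<open>Fixed points count as cycles: \<open>orbit p x = {x}\<close> if \<open>p x = x\<close>.\<close>

definition num_cycles :: "'a set \<Rightarrow> ('a \<Rightarrow> 'a) \<Rightarrow> nat" where
  "num_cycles S p = card (orbit p ` S)"

text \<open>
  Having exactly \<open>N - 2\<close> cycles is meant over the integers: for \<open>N = 1\<close> no datum has genus 1.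
\<close>

definition gluing_genus_one :: "nat \<times> nat \<times> (nat \<Rightarrow> nat) \<Rightarrow> nat \<Rightarrow> bool" where
  "gluing_genus_one = (\<lambda>(m1, m2, \<iota>) N.
     int (num_cycles {1..2 * N} (face_perm m1 m2 \<circ> \<iota>)) = int N - 2)"

definition eps1_two :: "nat \<Rightarrow> nat" where
  "eps1_two N =
     card {d \<in> two_face_gluing_data N. gluing_connected d \<and> gluing_genus_one d N}"

end

theory Submission
  imports Defs "HOL-Computational_Algebra.Polynomial" "HOL-Computational_Algebra.Formal_Power_Series"
begin

text \<open>
  Let \<open>Q_n(k)\<close> be the sum of \<open>k\<close> to the number of vertices over all one-face gluings with \<open>n\<close> edges,
  with the convention \<open>Q_0 = k\<close>. Deleting the edge at the root of a one-face gluing with \<open>N + 1\<close> edges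
  leaves two faces of total length \<open>2 N\<close> (one of them possibly empty), and every two-face gluing
  arises exactly once. Removing the disconnected pairs, the generating polynomial of connected
  two-face gluings is \<open>Q_(N+1) - (\<Sum>i\<le>N. Q_i Q_(N-i))\<close>, whose coefficient at \<open>k ^ (N - 2)\<close> counts the
  tori. So only the one-face numbers of genus 0, 1, 2 are needed, and these follow from the
  Harer-Zagier recurrence.

  For the latter, average over all full cycles \<open>c\<close> with a fixed involution \<open>\<iota>\<close>. For a point \<open>a\<close>, the
  indicator of \<open>c\<close> being a full cycle is the sum of \<open>(-1) ^ card T * sign (c restricted to T)\<close> over
  the \<open>c\<close>-invariant sets \<open>T\<close> avoiding \<open>a\<close>. Writing \<open>k\<close> to the number of cycles as a number of
  colourings and exchanging the sums, all \<open>T\<close> that contain more than one point without its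
  \<open>\<iota>\<close>-partner cancel, which leaves a single hypergeometric sum; Zeilberger's algorithm turns it into
  the recurrence.
\<close>

section \<open>Fixed-point-free involutions\<close>

text \<open>In the table of pairs (full cycle, involution), conjugation makes every column sum the
  one-face sum, while every row sum turns out to depend on the size only; so the involution may be
  fixed and the cycle varied. The obstacle is then the full-cycle condition, which is global. The
  signed indicator replaces it by invariance conditions: each cycle of length \<open>l\<close> that
  avoids \<open>a\<close> contributes the factor \<open>1 + (-1)^l * (-1)^(l-1) = 0\<close>. For a
  fixed colouring \<open>f\<close> and a fixed \<open>T\<close>, the sum over \<open>c\<close>
  splits into a determinant on \<open>T\<close> and a permanent on \<open>S - T\<close>, both of 0/1
  matrices comparing colours. The determinant forces \<open>f\<close> to be injective on
  \<open>T\<close>, which produces falling factorials; the permanents, summed over colourings,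
  produce rising factorials. Coefficients are hard to read off this alternating sum. The recurrence
  gives them: multiplication by \<open>k\<close> preserves the genus and the other term raises it by
  one. Its telescoping proof divides by \<open>(k - 1) * k\<close>, so polynomial identities are
  tested at the integers from 2 on.\<close>

definition fpf_involutions :: "'a set \<Rightarrow> ('a \<Rightarrow> 'a) set" where
  "fpf_involutions S = {\<iota>. \<iota> permutes S \<and> (\<forall>x\<in>S. \<iota> (\<iota> x) = x \<and> \<iota> x \<noteq> x)}"

lemma fpf_involutionsD:
  assumes "\<iota> \<in> fpf_involutions S"
  shows "\<iota> permutes S" "\<iota> (\<iota> x) = x" "x \<in> S \<Longrightarrow> \<iota> x \<noteq> x" "\<iota> x \<in> S \<longleftrightarrow> x \<in> S"
proof -
  show p: "\<iota> permutes S" using assms by (simp add: fpf_involutions_def)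
  show inv: "\<iota> (\<iota> x) = x" for x
    using assms p by (cases "x \<in> S") (auto simp: fpf_involutions_def permutes_not_in)
  show "x \<in> S \<Longrightarrow> \<iota> x \<noteq> x" using assms by (simp add: fpf_involutions_def)
  show "\<iota> x \<in> S \<longleftrightarrow> x \<in> S" using p by (rule permutes_in_image)
qed

lemma finite_fpf_involutions: "finite S \<Longrightarrow> finite (fpf_involutions S)"
  by (rule finite_subset[OF _ finite_permutations]) (auto simp: fpf_involutions_def)

lemma fpf_involutions_empty: "fpf_involutions {} = {id}"
  by (auto simp: fpf_involutions_def)

text \<open>Composing with the transposition of a partner pair dissolves the pair into two fixed
  points, and a second composition restores it. This is the recursion behind counting, induction and
  root edge deletion.\<close>

lemma bij_betw_fpf_involutions:
  assumes ab: "a \<in> S" "b \<in> S" "a \<noteq> b"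
  shows "bij_betw (\<lambda>\<iota>. transpose a b \<circ> \<iota>) (fpf_involutions (S - {a, b})) {\<iota> \<in> fpf_involutions S. \<iota> a = b}"
proof (rule bij_betwI[where g = "\<lambda>\<iota>. transpose a b \<circ> \<iota>"])
  show "(\<lambda>\<iota>. transpose a b \<circ> \<iota>) \<in> fpf_involutions (S - {a, b}) \<rightarrow> {\<iota> \<in> fpf_involutions S. \<iota> a = b}"
  proof
    fix \<iota> assume \<iota>: "\<iota> \<in> fpf_involutions (S - {a, b})"
    note D = fpf_involutionsD[OF \<iota>]
    have "\<iota> permutes S" using D(1) by (rule permutes_subset) auto
    then have "transpose a b \<circ> \<iota> permutes S"
      by (rule permutes_compose[OF _ permutes_swap_id]) (use ab in auto)
    moreover have ia: "\<iota> a = a" "\<iota> b = b" using D(1) by (auto intro: permutes_not_in)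
    moreover have "(transpose a b \<circ> \<iota>) ((transpose a b \<circ> \<iota>) x) = x" "(transpose a b \<circ> \<iota>) x \<noteq> x" if xS: "x \<in> S" for x
    proof -
      consider "x = a" | "x = b" | "x \<in> S - {a, b}" using xS by blast
      then have "(transpose a b \<circ> \<iota>) ((transpose a b \<circ> \<iota>) x) = x \<and> (transpose a b \<circ> \<iota>) x \<noteq> x"
      proof cases
        case 3
        then have "\<iota> x \<in> S - {a, b}" using D(4) by blast
        then have "transpose a b (\<iota> x) = \<iota> x" by auto
        then show ?thesis using D(2) D(3)[OF 3] 3 by auto
      qed (use ia ab in auto)
      then show "(transpose a b \<circ> \<iota>) ((transpose a b \<circ> \<iota>) x) = x" "(transpose a b \<circ> \<iota>) x \<noteq> x" by auto
    qed
    ultimately show "transpose a b \<circ> \<iota> \<in> {\<iota> \<in> fpf_involutions S. \<iota> a = b}"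
      unfolding fpf_involutions_def by simp
  qed
  show "(\<lambda>\<iota>. transpose a b \<circ> \<iota>) \<in> {\<iota> \<in> fpf_involutions S. \<iota> a = b} \<rightarrow> fpf_involutions (S - {a, b})"
  proof
    fix \<iota> assume "\<iota> \<in> {\<iota> \<in> fpf_involutions S. \<iota> a = b}"
    then have \<iota>: "\<iota> \<in> fpf_involutions S" and ia: "\<iota> a = b" by auto
    note D = fpf_involutionsD[OF \<iota>]
    have ib: "\<iota> b = a" using D(2)[of a] ia by simp
    have "transpose a b \<circ> \<iota> permutes S"
      by (rule permutes_compose[OF D(1) permutes_swap_id]) (use ab in auto)
    then have "transpose a b \<circ> \<iota> permutes S - {a, b}"
      by (rule permutes_superset) (use ia ib in auto)
    moreover have "(transpose a b \<circ> \<iota>) ((transpose a b \<circ> \<iota>) x) = x" "(transpose a b \<circ> \<iota>) x \<noteq> x"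
      if x: "x \<in> S - {a, b}" for x
    proof -
      have "\<iota> x \<noteq> a" "\<iota> x \<noteq> b" using D(2)[of x] ia ib x by auto
      then have "(transpose a b \<circ> \<iota>) x = \<iota> x" by simp
      moreover have "(transpose a b \<circ> \<iota>) (\<iota> x) = x" using D(2)[of x] x by auto
      ultimately show "(transpose a b \<circ> \<iota>) ((transpose a b \<circ> \<iota>) x) = x" "(transpose a b \<circ> \<iota>) x \<noteq> x"
        using D(3)[of x] x by auto
    qed
    ultimately show "transpose a b \<circ> \<iota> \<in> fpf_involutions (S - {a, b})"
      unfolding fpf_involutions_def by blast
  qed
qed (simp_all add: o_assoc)

lemma sum_fpf_involutions:
  assumes "finite S" "a \<in> S"
  shows "(\<Sum>\<iota>\<in>fpf_involutions S. h \<iota>) =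
    (\<Sum>b\<in>S - {a}. \<Sum>\<iota>\<in>fpf_involutions (S - {a, b}). h (transpose a b \<circ> \<iota>))"
proof -
  have "(\<Sum>\<iota>\<in>fpf_involutions S. h \<iota>) = (\<Sum>b\<in>S - {a}. \<Sum>\<iota> | \<iota> \<in> fpf_involutions S \<and> \<iota> a = b. h \<iota>)"
    by (rule sum.group[symmetric])
      (use assms in \<open>auto simp: finite_fpf_involutions fpf_involutionsD\<close>)
  also have "\<dots> = (\<Sum>b\<in>S - {a}. \<Sum>\<iota>\<in>fpf_involutions (S - {a, b}). h (transpose a b \<circ> \<iota>))"
    by (intro sum.cong refl sum.reindex_bij_betw[symmetric] bij_betw_fpf_involutions) (use assms in auto)
  finally show ?thesis .
qed

text \<open>Partner pairs are added one at a time, which suits facts that depend only on the number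
  of pairs.\<close>

lemma fpf_involutions_induct [consumes 2, case_names empty pair]:
  assumes "finite S" "\<iota> \<in> fpf_involutions S"
  assumes empty: "P {} id"
  assumes pair: "\<And>S x y \<iota>. finite S \<Longrightarrow> x \<notin> S \<Longrightarrow> y \<notin> S \<Longrightarrow> x \<noteq> y \<Longrightarrow> \<iota> \<in> fpf_involutions S \<Longrightarrow>
    P S \<iota> \<Longrightarrow> P (insert x (insert y S)) (transpose x y \<circ> \<iota>)"
  shows "P S \<iota>"
  using assms(1,2)
proof (induction S arbitrary: \<iota> rule: finite_psubset_induct)
  case (psubset S)
  show ?case
  proof (cases "S = {}")
    case True
    then have "\<iota> = id" using psubset.prems by (simp add: fpf_involutions_empty)
    then show ?thesis using empty True by (simp only:)
  next
    case False
    then obtain x where x: "x \<in> S" by blast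
    note D = fpf_involutionsD[OF psubset.prems]
    have y: "\<iota> x \<in> S" "x \<noteq> \<iota> x" using x D(3)[of x] D(4)[of x] by auto
    obtain \<iota>' where \<iota>': "\<iota>' \<in> fpf_involutions (S - {x, \<iota> x})" "\<iota> = transpose x (\<iota> x) \<circ> \<iota>'"
      using bij_betw_fpf_involutions[OF x y] psubset.prems unfolding bij_betw_def by blast
    have "P (insert x (insert (\<iota> x) (S - {x, \<iota> x}))) (transpose x (\<iota> x) \<circ> \<iota>')"
      by (rule pair) (use psubset.hyps \<iota>'(1) y psubset.IH[OF _ \<iota>'(1)] x in auto)
    moreover have "insert x (insert (\<iota> x) (S - {x, \<iota> x})) = S" using x y by auto
    ultimately show ?thesis using \<iota>'(2) by simp
  qed
qed

lemma sign_fpf_involution: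
  assumes "finite S" "\<iota> \<in> fpf_involutions S"
  shows "even (card S) \<and> sign \<iota> = (-1) ^ (card S div 2)"
  using assms
proof (induction rule: fpf_involutions_induct)
  case (pair S x y \<iota>)
  have "sign (transpose x y \<circ> \<iota>) = - sign \<iota>"
    using pair fpf_involutionsD(1)[OF pair(5)]
    by (subst sign_compose) (auto simp: permutation_swap_id sign_swap_id permutes_imp_permutation)
  then have "sign (transpose x y \<circ> \<iota>) = (-1) ^ Suc (card S div 2)" using pair by simp
  moreover have "card (insert x (insert y S)) = Suc (Suc (card S))" using pair by simp
  ultimately show ?case using pair.IH by (simp only:) simp
qed simp

text \<open>An invariant set is a union of partner pairs, and there are \<open>card S div 2\<close>
  pairs to choose from. In the induction a new pair lies wholly inside or wholly outside, which is
  Pascal's rule.\<close>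

lemma sum_invariant_subsets:
  fixes h :: "nat \<Rightarrow> real"
  assumes "finite S" "\<iota> \<in> fpf_involutions S"
  shows "(\<Sum>T | T \<subseteq> S \<and> \<iota> ` T = T. h (card T)) = (\<Sum>p\<le>card S div 2. real (card S div 2 choose p) * h (2 * p))"
  using assms
proof (induction arbitrary: h rule: fpf_involutions_induct)
  case empty
  have "{T::'a set. T = {}} = {{}}" by auto
  then show ?case by simp
next
  case (pair S x y \<iota>)
  note D = fpf_involutionsD[OF pair(5)]
  let ?\<iota> = "transpose x y \<circ> \<iota>"
  let ?I = "{T. T \<subseteq> S \<and> \<iota> ` T = T}"
  have fI: "finite ?I" using pair(1) by simp
  have eqS: "?\<iota> z = \<iota> z" if "z \<in> S" for z
  proof -
    have "\<iota> z \<in> S" using D(4) that by blast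
    then have "\<iota> z \<noteq> x" "\<iota> z \<noteq> y" using pair(2,3) by auto
    then show ?thesis by simp
  qed
  have xy: "?\<iota> x = y" "?\<iota> y = x"
    using D(1) pair(2,3) by (auto simp: permutes_not_in)
  have imS: "?\<iota> ` T = \<iota> ` T" if "T \<subseteq> S" for T
    by (rule image_cong) (use that eqS in auto)
  have "{T. T \<subseteq> insert x (insert y S) \<and> ?\<iota> ` T = T} = ?I \<union> (\<lambda>T. insert x (insert y T)) ` ?I"
  proof (intro equalityI subsetI)
    fix T assume "T \<in> {T. T \<subseteq> insert x (insert y S) \<and> ?\<iota> ` T = T}"
    then have T: "T \<subseteq> insert x (insert y S)" "?\<iota> ` T = T" by auto
    have iff: "x \<in> T \<longleftrightarrow> y \<in> T"
      using xy T(2) by (metis image_eqI)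
    define T' where "T' = T - {x, y}"
    have sub: "T' \<subseteq> S" using T(1) by (auto simp: T'_def)
    have "\<iota> z \<in> T'" if "z \<in> T'" for z
    proof -
      have "z \<in> S" using that sub by auto
      then have "?\<iota> z = \<iota> z" "\<iota> z \<in> S" using eqS D(4) by auto
      moreover have "?\<iota> z \<in> T" using that T(2) unfolding T'_def by (metis DiffE image_eqI)
      ultimately show ?thesis using pair(2,3) by (auto simp: T'_def)
    qed
    then have "\<iota> ` T' = T'" by (auto simp: image_iff intro!: bexI[of _ "\<iota> _"] D(2)[symmetric])
    then have T'I: "T' \<in> ?I" using sub by auto
    show "T \<in> ?I \<union> (\<lambda>T. insert x (insert y T)) ` ?I"
    proof (cases "x \<in> T")
      case True
      then have "T = insert x (insert y T')" using iff by (auto simp: T'_def)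
      then show ?thesis using T'I by blast
    next
      case False
      then have "T = T'" using iff by (auto simp: T'_def)
      then show ?thesis using T'I by blast
    qed
  next
    fix T assume "T \<in> ?I \<union> (\<lambda>T. insert x (insert y T)) ` ?I"
    then show "T \<in> {T. T \<subseteq> insert x (insert y S) \<and> ?\<iota> ` T = T}"
    proof
      assume "T \<in> ?I"
      then show ?thesis using imS by auto
    next
      assume "T \<in> (\<lambda>T. insert x (insert y T)) ` ?I"
      then obtain T' where T': "T' \<in> ?I" "T = insert x (insert y T')" by blast
      have "?\<iota> ` T = insert y (insert x (?\<iota> ` T'))" using T'(2) xy by (simp only: image_insert)
      also have "\<dots> = T" using imS[of T'] T' by auto
      finally show ?thesis using T' by auto
    qed
  qed
  then have "(\<Sum>T | T \<subseteq> insert x (insert y S) \<and> ?\<iota> ` T = T. h (card T))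
     = (\<Sum>T\<in>?I. h (card T)) + (\<Sum>T\<in>(\<lambda>T. insert x (insert y T)) ` ?I. h (card T))"
    using fI pair(2) by (simp only:, intro sum.union_disjoint) auto
  also have "(\<Sum>T\<in>(\<lambda>T. insert x (insert y T)) ` ?I. h (card T)) = (\<Sum>T\<in>?I. h (card T + 2))"
  proof (subst sum.reindex)
    show "inj_on (\<lambda>T. insert x (insert y T)) ?I"
    proof (rule inj_onI)
      fix T T' assume "T \<in> ?I" "T' \<in> ?I" "insert x (insert y T) = insert x (insert y T')"
      moreover have "T = insert x (insert y T) - {x, y}" "T' = insert x (insert y T') - {x, y}"
        using calculation pair(2,3) by auto
      ultimately show "T = T'" by metis
    qed
    have "card (insert x (insert y T)) = card T + 2" if "T \<in> ?I" for T
    proof -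
      have "finite T" "x \<notin> T" "y \<notin> T" using that pair(1,2,3) finite_subset by auto
      then show ?thesis using pair(4) by simp
    qed
    then show "sum ((\<lambda>T. h (card T)) \<circ> (\<lambda>T. insert x (insert y T))) ?I = (\<Sum>T\<in>?I. h (card T + 2))"
      by (intro sum.cong) auto
  qed
  also have "(\<Sum>T\<in>?I. h (card T)) + (\<Sum>T\<in>?I. h (card T + 2)) =
     (\<Sum>p\<le>card S div 2. real (card S div 2 choose p) * h (2 * p))
     + (\<Sum>p\<le>card S div 2. real (card S div 2 choose p) * h (2 * p + 2))"
    by (simp only: pair.IH pair.IH[of "\<lambda>m. h (m + 2)"])
  also have "\<dots> = (\<Sum>p\<le>Suc (card S div 2). real (Suc (card S div 2) choose p) * h (2 * p))"
  proof -
    define n where "n = card S div 2"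
    have "(\<Sum>p\<le>Suc n. real (Suc n choose p) * h (2 * p))
      = h 0 + (\<Sum>p\<le>n. real (Suc n choose Suc p) * h (2 * Suc p))"
      by (subst sum.atMost_Suc_shift) simp
    also have "\<dots> = (h 0 + (\<Sum>p\<le>n. real (n choose Suc p) * h (2 * Suc p))) + (\<Sum>p\<le>n. real (n choose p) * h (2 * p + 2))"
      by (simp add: algebra_simps sum.distrib)
    also have "h 0 + (\<Sum>p\<le>n. real (n choose Suc p) * h (2 * Suc p)) = (\<Sum>p\<le>Suc n. real (n choose p) * h (2 * p))"
      by (subst sum.atMost_Suc_shift) simp
    also have "\<dots> = (\<Sum>p\<le>n. real (n choose p) * h (2 * p))" by simp
    finally show ?thesis unfolding n_def by simp
  qed
  also have "Suc (card S div 2) = card (insert x (insert y S)) div 2"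
    using pair by simp
  finally show ?case .
qed

section \<open>Detecting full cycles by signed invariant sets\<close>

text \<open>Sign-reversing involution. Fixed points of \<open>h\<close> are harmless: their weight
  equals its own negative.\<close>

lemma signed_sum_zero:
  fixes w :: "'b \<Rightarrow> int"
  assumes "\<And>x. x \<in> I \<Longrightarrow> h x \<in> I" "\<And>x. x \<in> I \<Longrightarrow> h (h x) = x" "\<And>x. x \<in> I \<Longrightarrow> w (h x) = - w x"
  shows "sum w I = 0"
proof -
  have "sum w I = (\<Sum>x\<in>I. w (h x))"
    by (rule sum.reindex_bij_witness[of _ h h]) (use assms in auto)
  also have "\<dots> = - sum w I" using assms(3) by (simp add: sum_negf)
  finally show ?thesis by simp
qed

text \<open>Invariant sets are unions of cycles, so the sum is a product over the cycles; a cycle of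
  length \<open>l\<close> contributes \<open>1 + (-1)^l * (-1)^(l-1) = 0\<close>. The induction
  avoids the cycle decomposition by contracting one point of a cycle at a time until a fixed point
  appears.\<close>

lemma sum_invariant_sign:
  assumes "finite U" "c permutes U"
  shows "(\<Sum>T | T \<subseteq> U \<and> c ` T = T. (-1) ^ card T * sign_on T c) = (if U = {} then 1 else 0)"
  using assms
proof (induction "card U" arbitrary: U c rule: less_induct)
  case less
  note fin = less.prems(1) and perm = less.prems(2)
  show ?case
  proof (cases "U = {}")
    case True
    have "{T::'a set. T \<subseteq> {} \<and> c ` T = T} = {{}}" by auto
    then show ?thesis using True by (simp add: sign_on_def restrict_id_def)
  next
    case False
    then obtain b where b: "b \<in> U" by blast
    have inj: "c u = c v \<longleftrightarrow> u = v" for u v using permutes_inj[OF perm] by (auto dest: injD)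
    let ?I = "{T. T \<subseteq> U \<and> c ` T = T}"
    let ?w = "\<lambda>T. (-1) ^ card T * sign_on T c"
    show ?thesis
    proof (cases "c b = b")
      case True
      \<comment> \<open>Toggling a fixed point changes the parity of \<open>card T\<close> but not
        the restricted permutation.\<close>
      define h where "h T = (if b \<in> T then T - {b} else insert b T)" for T
      have "sum ?w ?I = 0"
      proof (rule signed_sum_zero[of _ h])
        fix T assume T: "T \<in> ?I"
        have "c ` h T = h T"
        proof (cases "b \<in> T")
          case True
          have "c ` (T - {b}) = c ` T - {c b}" using permutes_inj[OF perm] by (auto simp: inj_def)
          then show ?thesis using T True \<open>c b = b\<close> by (auto simp: h_def)
        qed (use T \<open>c b = b\<close> in \<open>auto simp: h_def\<close>)
        then show "h T \<in> ?I" using T b by (auto simp: h_def)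
        show "h (h T) = T" by (auto simp: h_def)
        have "restrict_id c (h T) = restrict_id c T"
          using \<open>c b = b\<close> by (auto simp: restrict_id_def h_def fun_eq_iff)
        then have "sign_on (h T) c = sign_on T c" by (simp add: sign_on_def)
        moreover have "finite T" using T fin finite_subset by blast
        then have "(-1 :: int) ^ card (h T) = - ((-1) ^ card T)"
        proof (cases "b \<in> T")
          case True
          then show ?thesis using \<open>finite T\<close> by (cases "card T") (auto simp: h_def)
        qed (simp add: h_def)
        ultimately show "?w (h T) = - ?w T" by simp
      qed
      then show ?thesis using False by simp
    next
      case ne: False
      define x where "x = c b"
      have x: "x \<in> U" "x \<noteq> b" using b ne permutes_in_image[OF perm] by (auto simp: x_def)
      \<comment> \<open>\<open>c'\<close> cuts \<open>x\<close> out of its cycle: it fixes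
        \<open>x\<close> and sends \<open>b\<close> directly to \<open>c x\<close>.\<close>
      define c' where "c' = c \<circ> transpose b x"
      have c'x: "c' x = x" "c' b = c x" by (auto simp: c'_def x_def)
      have c'o: "c' z = c z" if "z \<noteq> b" "z \<noteq> x" for z using that by (simp add: c'_def)
      have "c' permutes U" unfolding c'_def
        by (rule permutes_compose[OF permutes_swap_id perm]) (use b x in auto)
      then have perm': "c' permutes U - {x}" by (rule permutes_superset) (use c'x in auto)
      have inj': "c' u = c' v \<longleftrightarrow> u = v" for u v using permutes_inj[OF perm'] by (auto dest: injD)
      have IH: "(\<Sum>T | T \<subseteq> U - {x} \<and> c' ` T = T. (-1) ^ card T * sign_on T c') = 0"
        using less.hyps[OF card_Diff1_less[OF fin x(1)] _ perm'] fin b x by auto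
      have bx: "b \<in> T \<longleftrightarrow> x \<in> T" if "c ` T = T" for T
      proof
        show "b \<in> T \<Longrightarrow> x \<in> T" using that by (auto simp: x_def)
        assume "x \<in> T"
        then have "c b \<in> c ` T" using that by (simp add: x_def)
        then show "b \<in> T" using inj_image_mem_iff[OF permutes_inj[OF perm]] by blast
      qed
      let ?I' = "{T. T \<subseteq> U - {x} \<and> c' ` T = T}"
      let ?f = "\<lambda>T. T - {x}" and ?g = "\<lambda>T. if b \<in> T then insert x T else T"
      have img_subset: "d ` T = T" if "finite T" "d ` T \<subseteq> T" "inj_on d T" for d and T :: "'a set"
        using that endo_inj_surj by blast
      \<comment> \<open>Dropping \<open>x\<close> from \<open>T\<close> loses one point and one
        transposition, so the two sign changes cancel; sets without \<open>b\<close> stay as they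
        are.\<close>
      have "sum ?w ?I = (\<Sum>T\<in>?I'. (-1) ^ card T * sign_on T c')"
      proof (rule sum.reindex_bij_witness[of _ ?g ?f])
        fix T assume T: "T \<in> ?I"
        then have fT: "finite T" using fin finite_subset by blast
        have mem: "c z \<in> T" if "z \<in> T" for z using T that by blast
        show "?g (?f T) = T" using bx[of T] T x by auto
        show "?f T \<in> ?I'"
        proof -
          have "c' z \<in> T - {x}" if "z \<in> T - {x}" for z
          proof (cases "z = b")
            case True
            then have "x \<in> T" using bx[of T] T that by auto
            moreover have "c x \<noteq> x" using inj[of x b] x by (simp add: x_def)
            ultimately show ?thesis using c'x True mem by auto
          next
            case zb: False
            then have "c' z = c z" "c z \<noteq> x" using c'o that inj[of z b] by (auto simp: x_def)
            then show ?thesis using mem that by auto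
          qed
          then have "c' ` (T - {x}) = T - {x}"
            by (intro img_subset) (use fT inj' in \<open>auto intro: inj_onI\<close>)
          then show ?thesis using T by auto
        qed
        show "(-1) ^ card (?f T) * sign_on (?f T) c' = ?w T"
        proof (cases "b \<in> T")
          case False
          then have "x \<notin> T" using bx T by auto
          moreover have "sign_on T c' = sign_on T c"
            using False \<open>x \<notin> T\<close> by (intro sign_on_cong refl c'o) auto
          ultimately show ?thesis by simp
        next
          case True
          then have xT: "x \<in> T" using bx T by auto
          have cardT: "card T = Suc (card (T - {x}))" using fT xT by (rule card.remove)
          have bij: "bij_betw c T T" using T inj by (auto simp: bij_betw_def intro: inj_onI)
          have "restrict_id c' (T - {x}) = restrict_id c T \<circ> transpose b x"
          proof
            fix z
            consider "z = b" | "z = x" | "z \<noteq> b" "z \<noteq> x" by blast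
            then show "restrict_id c' (T - {x}) z = (restrict_id c T \<circ> transpose b x) z"
            proof cases
              case 1
              then show ?thesis using xT True x(2) c'x(2) by simp
            next
              case 2
              then show ?thesis using True x_def by simp
            next
              case 3
              then show ?thesis using c'o[of z] by (simp add: restrict_id_def)
            qed
          qed
          then have "sign_on (T - {x}) c' = sign (restrict_id c T \<circ> transpose b x)"
            by (simp add: sign_on_def)
          also have "\<dots> = - sign_on T c"
            using permutes_restrict_id[OF bij] fT x
            by (subst sign_compose) (auto simp: permutation_swap_id sign_swap_id permutes_imp_permutation sign_on_def)
          finally show ?thesis using cardT by simp
        qed
      next
        fix T assume T: "T \<in> ?I'"
        then have fT: "finite T" using fin finite_subset by blast
        have mem: "c' z \<in> T" if "z \<in> T" for z using T that by blast
        show "?f (?g T) = T" using T by auto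
        have "c z \<in> ?g T" if z: "z \<in> ?g T" for z
        proof (cases "z = b \<or> z = x")
          case False
          then show ?thesis using c'o[of z] mem[of z] z by (auto split: if_splits)
        next
          case True
          then have "b \<in> T" using z T x by (auto split: if_splits)
          moreover from this have "c' b \<in> T" by (rule mem)
          ultimately show ?thesis using True c'x by (auto simp: x_def)
        qed
        then have "c ` ?g T \<subseteq> ?g T" by (intro image_subsetI)
        moreover have "finite (?g T)" "inj_on c (?g T)" using fT permutes_inj_on[OF perm] by auto
        ultimately have "c ` ?g T = ?g T" by (intro img_subset)
        moreover have "?g T \<subseteq> U" using T x by auto
        ultimately show "?g T \<in> ?I" by blast
      qed
      then show ?thesis using IH False by simp
    qed
  qed
qed

text \<open>An invariant set that avoids \<open>a\<close> avoids the whole cycle of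
  \<open>a\<close>, so the sum is that of the previous lemma on the complement of this cycle. It is
  1 exactly when the complement is empty.\<close>

lemma sum_invariant_sign_cyclic:
  assumes "finite S" "c permutes S" "a \<in> S"
  shows "(\<Sum>T | T \<subseteq> S - {a} \<and> c ` T = T. (-1) ^ card T * sign_on T c) = (if cyclic_on c S then 1 else 0)"
proof -
  let ?O = "orbit c a" and ?U = "S - orbit c a"
  have perm: "permutation c" using assms permutes_imp_permutation by blast
  have aO: "a \<in> ?O" using perm by (rule permutation_self_in_orbit)
  have cyc: "cyclic_on c ?O" using perm by (rule cyclic_on_orbit')
  have sub: "?O \<subseteq> S" using assms by (intro permutes_orbit_subset)
  let ?c = "restrict_id c ?U"
  have "perm_restrict c ?U permutes ?U" using assms(2) cyc by (rule perm_restrict_diff_cyclic)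
  moreover have "perm_restrict c ?U = ?c" by (auto simp: perm_restrict_def restrict_id_def)
  ultimately have p: "?c permutes ?U" by simp
  have "{T. T \<subseteq> S - {a} \<and> c ` T = T} = {T. T \<subseteq> ?U \<and> ?c ` T = T}" (is "?L = ?R")
  proof (intro equalityI subsetI)
    fix T assume T: "T \<in> ?L"
    have "z \<notin> T" if "z \<in> ?O" for z
    proof
      assume z: "z \<in> T"
      have "a \<in> orbit c z" using that aO by (rule orbit_swap[rotated])
      then have "a \<in> T"
      proof (induction rule: orbit.induct)
        case base
        show ?case using T z by blast
      next
        case (step y)
        then show ?case using T by blast
      qed
      then show False using T by blast
    qed
    then have sT: "T \<subseteq> ?U" using T by blast
    then have "?c ` T = c ` T" by (intro image_cong) auto
    then show "T \<in> ?R" using T sT by auto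
  next
    fix T assume T: "T \<in> ?R"
    then have "?c ` T = c ` T" by (intro image_cong) auto
    then show "T \<in> ?L" using T aO by auto
  qed
  then have "(\<Sum>T | T \<subseteq> S - {a} \<and> c ` T = T. (-1) ^ card T * sign_on T c) =
     (\<Sum>T | T \<subseteq> ?U \<and> ?c ` T = T. (-1) ^ card T * sign_on T ?c)"
    by (intro sum.cong) (auto intro!: arg_cong2[where f = "(*)"] sign_on_cong)
  also have "\<dots> = (if ?U = {} then 1 else 0)"
    by (rule sum_invariant_sign) (use assms p in auto)
  also have "?U = {} \<longleftrightarrow> cyclic_on c S"
  proof
    assume "?U = {}"
    then have "?O = S" using sub by blast
    then show "cyclic_on c S" using cyc by simp
  next
    assume "cyclic_on c S"
    then show "?U = {}" using orbit_cyclic_eq3[of c S a] assms(3) by simp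
  qed
  finally show ?thesis .
qed

section \<open>The hypergeometric sum\<close>

definition ffall :: "real \<Rightarrow> nat \<Rightarrow> real" where
  "ffall k m = (\<Prod>i<m. k - real i)"

text \<open>
  \<open>hz_sum q k\<close> belongs to gluings with \<open>q + 1\<close> edges. The last factor of \<open>hz_term\<close> combines the
  contributions of the invariant sets \<open>T\<close> with \<open>2 p\<close> points and of those with one additional
  unpaired point.
\<close>

definition hz_term :: "nat \<Rightarrow> real \<Rightarrow> nat \<Rightarrow> real" where
  "hz_term q k p = (-1) ^ p * real (q choose p) * ffall k (2 * p) * pochhammer (k + 1) (2 * (q - p))
     * (k\<^sup>2 + 2 * real p * (2 * (real q - real p) + 1))"

definition hz_sum :: "nat \<Rightarrow> real \<Rightarrow> real" where
  "hz_sum q k = (\<Sum>p\<le>q. hz_term q k p)"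

text \<open>The polynomial part of the certificate given by Zeilberger's algorithm.\<close>

definition hz_cert :: "real \<Rightarrow> real \<Rightarrow> real \<Rightarrow> real" where
  "hz_cert q k p =
    - 6*k - 24*q - 68*q*k - 12*q*k^2 - 5*q*k^3 - 3*q*k^4 - 112*q^2 - 170*q^2*k - 16*q^2*k^2
    - 7*q^2*k^3 - q^2*k^4 - 184*q^3 - 156*q^3*k + 4*q^3*k^2 - 128*q^4 - 48*q^4*k + 8*q^4*k^2 - 32*q^5
    + p * (6*k + 104*q + 104*q*k + 6*q*k^2 + 8*q*k^3 + 360*q^2 + 182*q^2*k - 6*q^2*k^2 + 432*q^3
           + 84*q^3*k - 16*q^3*k^2 + 208*q^4 + 32*q^5)
    + p^2 * (- 152*q - 36*q*k - 384*q^2 - 36*q^2*k + 8*q^2*k^2 - 312*q^3 - 80*q^4)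
    + p^3 * (88*q + 152*q^2 + 64*q^3)
    - p^4 * (16*q + 16*q^2)"

text \<open>The telescoping relation for a single index \<open>p\<close>, divided by the
  hypergeometric factor common to all terms. The left side comes from the summands for
  \<open>q + 1\<close>, \<open>q\<close> and \<open>q - 1\<close>, the right side from the
  difference of certificate terms at \<open>p + 1\<close> and \<open>p\<close>; what remains is a
  polynomial identity.\<close>

lemma hz_cert_identity:
  fixes q k p :: real
  shows "(q+3) * ((q+1)*q*((k+2*(q-p)-1)*(k+2*(q-p))*(k+2*(q-p)+1)*(k+2*(q-p)+2))
             * (k^2 + 2*p*(2*(q+1-p)+1)))
       - (2*k*(2*q+3)*(2*q+2)) * (q*(q+1-p)*((k+2*(q-p)-1)*(k+2*(q-p))) * (k^2 + 2*p*(2*(q-p)+1)))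
       - ((q+1)*(2*q+3)*(2*q+2)*(2*q+1)*(2*q)) * ((q+1-p)*(q-p)*(k^2 + 2*p*(2*(q-1-p)+1)))
     = - (q+1-p)*(k-2*p)*(k-2*p-1) * hz_cert q k (p+1)
       - p*((k+2*(q-p)-1)*(k+2*(q-p))) * hz_cert q k p"
  unfolding hz_cert_def by algebra

lemma ffall_add_2: "ffall k (2 * Suc p) = ffall k (2 * p) * (k - 2 * real p) * (k - 2 * real p - 1)"
  by (simp add: ffall_def algebra_simps)

lemma pochhammer_add_2:
  "pochhammer (x::real) (Suc (Suc m)) = pochhammer x m * (x + real m) * (x + real m + 1)"
  by (simp add: pochhammer_Suc algebra_simps)

lemma pochhammer_shift_2:
  "pochhammer (k - 1) (Suc (Suc m)) = (k - 1) * k * pochhammer (k + 1 :: real) m"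
  by (simp add: pochhammer_rec algebra_simps)

lemma hz_term_zero: "q < p \<Longrightarrow> hz_term q k p = 0"
  by (simp add: hz_term_def binomial_eq_0)

lemma hz_sum_upto: "q \<le> m \<Longrightarrow> hz_sum q k = (\<Sum>p\<le>m. hz_term q k p)"
  unfolding hz_sum_def by (rule sum.mono_neutral_left) (auto simp: hz_term_zero)

text \<open>The Harer-Zagier recurrence in another normalisation: \<open>hz_sum q\<close> is
  \<open>(2 * q + 1)!\<close> divided by the number of involutions, times the one-face polynomial.
  Up to the factor \<open>(k - 1) * k\<close> the combined summand is a difference of values of
  \<open>G\<close>, and \<open>G 0 = 0\<close> because of the factor \<open>real p\<close>.\<close>

lemma hz_sum_recurrence:
  fixes k :: real
  assumes q: "q \<ge> 1" and k: "k \<noteq> 0" "k \<noteq> 1"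
  shows "(real q + 3) * hz_sum (q + 1) k =
     2 * k * (2 * real q + 3) * (2 * real q + 2) * hz_sum q k
     + (real q + 1) * (2 * real q + 3) * (2 * real q + 2) * (2 * real q + 1) * (2 * real q)
       * hz_sum (q - 1) k"
proof -
  \<comment> \<open>Everything is multiplied by \<open>(k - 1) * k\<close>, so that the telescoping term can use
    \<open>pochhammer (k - 1)\<close> and its index stays nonnegative up to \<open>p = q + 1\<close>.\<close>
  define b where "b p = fact (q - 1) / (fact p * fact (q + 1 - p) :: real)" for p
  define G where "G p = (-1) ^ p * real p * b p * ffall k (2 * p)
     * pochhammer (k - 1) (2 * (q + 1 - p)) * hz_cert (real q) k (real p)" for p
  define c1 where "c1 = 2 * k * (2 * real q + 3) * (2 * real q + 2)"
  define c2 where "c2 = (real q + 1) * (2 * real q + 3) * (2 * real q + 2) * (2 * real q + 1) * (2 * real q)"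
  define L where "L p = (real q + 3) * hz_term (q + 1) k p - c1 * hz_term q k p
     - c2 * hz_term (q - 1) k p" for p
  have fq: "fact (q + 1) = (real q + 1) * real q * fact (q - 1)" "fact q = real q * (fact (q - 1) :: real)"
    using q by (cases q; simp add: algebra_simps)+
  have step: "(k - 1) * k * L p = G (Suc p) - G p" if p: "p \<le> q" for p
  proof -
    define j where "j = q - p"
    have qj: "q = p + j" using p by (simp add: j_def)
    define D where "D = pochhammer (k - 1) (2 * j)"
    have D1: "(k - 1) * k * pochhammer (k + 1) (2 * j) = D * (k + 2 * real j - 1) * (k + 2 * real j)"
      using pochhammer_shift_2[of k "2 * j"] pochhammer_add_2[of "k - 1" "2 * j"]
      by (simp add: D_def algebra_simps)
    have D2: "(k - 1) * k * pochhammer (k + 1) (2 * (j + 1)) =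
       D * (k + 2 * real j - 1) * (k + 2 * real j) * (k + 2 * real j + 1) * (k + 2 * real j + 2)"
    proof -
      have "(k - 1) * k * pochhammer (k + 1) (2 * (j + 1)) =
          ((k - 1) * k * pochhammer (k + 1) (2 * j)) * (k + 2 * real j + 1) * (k + 2 * real j + 2)"
        using pochhammer_add_2[of "k + 1" "2 * j"] by (simp add: algebra_simps)
      then show ?thesis unfolding D1 .
    qed
    \<comment> \<open>\<open>b p\<close> is chosen so that the three binomial coefficients are
      polynomial multiples of it.\<close>
    have ch1: "real ((q + 1) choose p) = (real q + 1) * real q * b p"
      using binomial_fact[of p "q + 1", where 'a = real] p fq by (simp add: b_def)
    have ch2: "real (q choose p) = real q * (real q + 1 - real p) * b p"
    proof -
      have "fact (q + 1 - p) = (real q + 1 - real p) * (fact (q - p) :: real)"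
        using qj by (simp add: algebra_simps)
      moreover have "real q + 1 - real p \<noteq> 0" using qj by simp
      ultimately show ?thesis
        using binomial_fact[of p q, where 'a = real] p fq by (simp add: b_def)
    qed
    have t1: "(k - 1) * k * hz_term (q + 1) k p = (-1) ^ p * b p * ffall k (2 * p) * D *
        ((real q + 1) * real q * ((k + 2 * real j - 1) * (k + 2 * real j) * (k + 2 * real j + 1) * (k + 2 * real j + 2))
           * (k\<^sup>2 + 2 * real p * (2 * (real q + 1 - real p) + 1)))"
    proof -
      have "q + 1 - p = j + 1" using p by (simp add: j_def)
      then have "(k - 1) * k * hz_term (q + 1) k p = (-1) ^ p * ((real q + 1) * real q * b p) * ffall k (2 * p) *
          ((k - 1) * k * pochhammer (k + 1) (2 * (j + 1))) * (k\<^sup>2 + 2 * real p * (2 * (real q + 1 - real p) + 1))"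
        by (simp add: hz_term_def flip: ch1)
      then show ?thesis unfolding D2 by (simp only: mult_ac)
    qed
    have t2: "(k - 1) * k * hz_term q k p = (-1) ^ p * b p * ffall k (2 * p) * D *
        (real q * (real q + 1 - real p) * ((k + 2 * real j - 1) * (k + 2 * real j))
           * (k\<^sup>2 + 2 * real p * (2 * (real q - real p) + 1)))"
    proof -
      have "(k - 1) * k * hz_term q k p = (-1) ^ p * (real q * (real q + 1 - real p) * b p) * ffall k (2 * p) *
          ((k - 1) * k * pochhammer (k + 1) (2 * j)) * (k\<^sup>2 + 2 * real p * (2 * (real q - real p) + 1))"
        by (simp add: hz_term_def flip: ch2 j_def)
      then show ?thesis unfolding D1 by (simp only: mult_ac)
    qed
    have t3: "(k - 1) * k * hz_term (q - 1) k p = (-1) ^ p * b p * ffall k (2 * p) * D *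
        ((real q + 1 - real p) * (real q - real p)
           * (k\<^sup>2 + 2 * real p * (2 * (real q - 1 - real p) + 1)))"
    \<comment> \<open>At \<open>p = q\<close> both sides vanish, the right one through the factor
      \<open>real q - real p\<close>. Otherwise \<open>j\<close> is positive, so that
      \<open>D\<close> can be split from below.\<close>
    proof (cases "p = q")
      case True
      then show ?thesis using q by (simp add: hz_term_zero)
    next
      case False
      then obtain i where i: "j = Suc i" using p by (cases j) (auto simp: j_def)
      have ch3: "real ((q - 1) choose p) = (real q + 1 - real p) * (real q - real p) * b p"
      proof -
        have "real ((q - 1) choose p) = fact (q - 1) / (fact p * fact (q - 1 - p))"
          using False p by (intro binomial_fact) auto
        moreover have "fact (q + 1 - p) = (real q + 1 - real p) * (real q - real p) * fact (q - 1 - p)"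
          using qj i by (simp add: algebra_simps)
        ultimately show ?thesis using qj i by (simp add: b_def)
      qed
      have "q - 1 - p = i" using qj i by simp
      then have "(k - 1) * k * hz_term (q - 1) k p =
          (-1) ^ p * ((real q + 1 - real p) * (real q - real p) * b p) * ffall k (2 * p) *
          ((k - 1) * k * pochhammer (k + 1) (2 * i)) * (k\<^sup>2 + 2 * real p * (2 * (real q - 1 - real p) + 1))"
        using q by (simp add: hz_term_def of_nat_diff flip: ch3)
      moreover have Di: "(k - 1) * k * pochhammer (k + 1) (2 * i) = D"
        by (simp add: D_def i flip: pochhammer_shift_2)
      ultimately show ?thesis unfolding Di by (simp only: mult_ac)
    qed
    have g1: "G p = (-1) ^ p * b p * ffall k (2 * p) * D *
        (real p * ((k + 2 * real j - 1) * (k + 2 * real j)) * hz_cert (real q) k (real p))"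
    proof -
      have "q + 1 - p = j + 1" using p by (simp add: j_def)
      then have "pochhammer (k - 1) (2 * (q + 1 - p)) = D * (k + 2 * real j - 1) * (k + 2 * real j)"
        by (simp add: D_def pochhammer_add_2 algebra_simps)
      then show ?thesis unfolding G_def by (simp only: mult_ac)
    qed
    have g2: "G (Suc p) = (-1) ^ p * b p * ffall k (2 * p) * D *
        (- (real q + 1 - real p) * (k - 2 * real p) * (k - 2 * real p - 1) * hz_cert (real q) k (real p + 1))"
    proof -
      have "real (Suc p) * b (Suc p) = (real q + 1 - real p) * b p"
      proof -
        have "real (Suc p) * b (Suc p) = fact (q - 1) / (fact p * fact j)"
          using qj by (simp add: b_def del: of_nat_Suc)
        moreover have "(real q + 1 - real p) * b p = fact (q - 1) / (fact p * fact j)"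
          using qj by (simp add: b_def add.commute)
        ultimately show ?thesis by simp
      qed
      note e = this
      have "G (Suc p) = (-1) ^ Suc p * (real (Suc p) * b (Suc p)) * ffall k (2 * Suc p) * D
          * hz_cert (real q) k (real p + 1)"
        unfolding G_def D_def by (simp add: j_def add_ac)
      then show ?thesis unfolding e ffall_add_2
        by (simp only: power_Suc mult_minus_left mult_minus_right mult_1_left mult_ac)
    qed
    have rj: "real j = real q - real p" using qj by simp
    show ?thesis
    proof -
      have "(k - 1) * k * L p = (real q + 3) * ((k - 1) * k * hz_term (q + 1) k p)
         - c1 * ((k - 1) * k * hz_term q k p) - c2 * ((k - 1) * k * hz_term (q - 1) k p)"
        by (simp add: L_def algebra_simps)
      also have "\<dots> = (-1) ^ p * b p * ffall k (2 * p) * D * (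
          (real q+3) * ((real q+1)*real q*((k+2*(real q-real p)-1)*(k+2*(real q-real p))*(k+2*(real q-real p)+1)*(k+2*(real q-real p)+2))
             * (k^2 + 2*real p*(2*(real q+1-real p)+1)))
       - c1 * (real q*(real q+1-real p)*((k+2*(real q-real p)-1)*(k+2*(real q-real p))) * (k^2 + 2*real p*(2*(real q-real p)+1)))
       - c2 * ((real q+1-real p)*(real q-real p)*(k^2 + 2*real p*(2*(real q-1-real p)+1))))"
        unfolding t1 t2 t3 rj by (simp only: right_diff_distrib mult_ac)
      also have "\<dots> = G (Suc p) - G p"
        unfolding c1_def c2_def hz_cert_identity g1 g2 rj by (simp only: right_diff_distrib)
      finally show ?thesis .
    qed
  qed
  \<comment> \<open>The index \<open>q + 1\<close> is outside \<open>step\<close>: truncated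
    subtraction would make \<open>b (q + 2)\<close> nonzero. Only the summand of
    \<open>hz_sum (q + 1)\<close> survives there, and it cancels the end of the telescoping
    sum.\<close>
  have last: "(k - 1) * k * L (Suc q) = - G (Suc q)"
  proof -
    have "(k - 1) * k * L (Suc q) = (k - 1) * k * ((real q + 3) * hz_term (q + 1) k (Suc q))"
      using q by (simp add: L_def hz_term_zero)
    also have "\<dots> = - G (Suc q)"
    proof -
      have b: "b (Suc q) * (real q + 1) * real q = 1"
        using q fq by (simp add: b_def)
      have c: "hz_cert (real q) k (real q + 1) = - (k - 1) * k * (real q + 3) * (k\<^sup>2 + 2 * (real q + 1)) * real q"
        unfolding hz_cert_def by algebra
      have "G (Suc q) = (-1) ^ Suc q * (b (Suc q) * (real q + 1) * real q) * ffall k (2 * Suc q)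
         * (- (k - 1) * k * (real q + 3) * (k\<^sup>2 + 2 * (real q + 1)))"
        unfolding G_def using c by (simp add: add_ac)
      then show ?thesis unfolding b by (simp add: hz_term_def algebra_simps)
    qed
    finally show ?thesis .
  qed
  have "(k - 1) * k * (\<Sum>p\<le>Suc q. L p) = (\<Sum>p\<le>q. (k - 1) * k * L p) + (k - 1) * k * L (Suc q)"
    by (simp add: sum_distrib_left distrib_left)
  also have "\<dots> = (\<Sum>p\<le>q. G (Suc p) - G p) - G (Suc q)"
    unfolding last by (simp add: step)
  also have "(\<Sum>p\<le>q. G (Suc p) - G p) = G (Suc q) - G 0"
    using sum_lessThan_telescope[of G "Suc q"] by (simp flip: lessThan_Suc_atMost)
  finally have "(\<Sum>p\<le>Suc q. L p) = 0" using k by (simp add: G_def)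
  moreover have "(\<Sum>p\<le>Suc q. L p) = (real q + 3) * hz_sum (q + 1) k - c1 * hz_sum q k - c2 * hz_sum (q - 1) k"
  proof -
    have "hz_sum q k = (\<Sum>p\<le>Suc q. hz_term q k p)" "hz_sum (q + 1) k = (\<Sum>p\<le>Suc q. hz_term (q + 1) k p)"
      "hz_sum (q - 1) k = (\<Sum>p\<le>Suc q. hz_term (q - 1) k p)"
      by (rule hz_sum_upto; simp)+
    then show ?thesis unfolding L_def by (simp only: sum_distrib_left sum_subtractf)
  qed
  ultimately show ?thesis unfolding c1_def c2_def by simp
qed

lemma hz_sum_0: "hz_sum 0 k = k\<^sup>2"
  by (simp add: hz_sum_def hz_term_def ffall_def)

lemma hz_sum_1: "hz_sum 1 k = 4 * k ^ 3 + 2 * k"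
  by (simp add: hz_sum_def hz_term_def ffall_def numeral_2_eq_2 pochhammer_Suc lessThan_Suc)
     (simp add: algebra_simps power2_eq_square power3_eq_cube)

section \<open>Counting full cycles by signed lifts of colourings\<close>

text \<open>For an involution \<open>\<iota>\<close> of \<open>S\<close>, putting
  \<open>\<iota> x\<close> for \<open>x\<close> shows that \<open>f\<close> is constant on the
  cycles of \<open>c \<circ> \<iota>\<close>, that is, a colouring of the vertices. In this form
  \<open>c\<close> and \<open>\<iota>\<close> stand on different sides, so for fixed
  \<open>f\<close> it is a condition on \<open>c\<close> alone.\<close>

definition colourings :: "'a set \<Rightarrow> ('a \<Rightarrow> 'a) \<Rightarrow> ('a \<Rightarrow> 'a) \<Rightarrow> nat \<Rightarrow> ('a \<Rightarrow> nat) set" where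
  "colourings S c \<iota> k = {f \<in> S \<rightarrow>\<^sub>E {..<k}. \<forall>x\<in>S. f (c x) = f (\<iota> x)}"

text \<open>The number of lifts is the permanent of the 0/1 matrix with entry 1 where
  \<open>f y = g x\<close>.\<close>

definition lifts :: "'a set \<Rightarrow> ('a \<Rightarrow> nat) \<Rightarrow> ('a \<Rightarrow> nat) \<Rightarrow> ('a \<Rightarrow> 'a) set" where
  "lifts T f g = {c. c permutes T \<and> (\<forall>x\<in>T. f (c x) = g x)}"

text \<open>The determinant of the same matrix.\<close>

definition signed_lifts :: "'a set \<Rightarrow> ('a \<Rightarrow> nat) \<Rightarrow> ('a \<Rightarrow> nat) \<Rightarrow> int" where
  "signed_lifts T f g = (\<Sum>c\<in>lifts T f g. sign c)"

lemma lifts_cong: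
  assumes "\<And>x. x \<in> T \<Longrightarrow> f x = f' x" "\<And>x. x \<in> T \<Longrightarrow> g x = g' x"
  shows "lifts T f g = lifts T f' g'"
  using assms by (auto simp: lifts_def permutes_in_image)

text \<open>A permutation that preserves \<open>T\<close> is a pair of permutations of
  \<open>T\<close> and \<open>S - T\<close>, the lifting condition splits accordingly, and
  \<open>sign_on T\<close> sees only the first component.\<close>

lemma sum_lifts_product:
  assumes "finite S" "T \<subseteq> S"
  shows "(\<Sum>c | c \<in> lifts S f g \<and> c ` T = T. sign_on T c) = signed_lifts T f g * int (card (lifts (S - T) f g))"
proof -
  have fin: "finite T" "finite (S - T)" using assms finite_subset by auto
  have "signed_lifts T f g * int (card (lifts (S - T) f g))
      = (\<Sum>(c1, c2)\<in>lifts T f g \<times> lifts (S - T) f g. sign c1)"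
    by (simp add: signed_lifts_def sum.cartesian_product[symmetric] sum_distrib_right mult.commute)
  also have "\<dots> = (\<Sum>c | c \<in> lifts S f g \<and> c ` T = T. sign_on T c)"
  proof (rule sum.reindex_bij_witness[of _ "\<lambda>c. (restrict_id c T, restrict_id c (S - T))" "\<lambda>(c1, c2). c1 \<circ> c2"])
    fix p assume "p \<in> lifts T f g \<times> lifts (S - T) f g"
    then obtain c1 c2 where p: "p = (c1, c2)" and c1: "c1 \<in> lifts T f g" and c2: "c2 \<in> lifts (S - T) f g" by auto
    have p1: "c1 permutes T" and p2: "c2 permutes S - T" using c1 c2 by (auto simp: lifts_def)
    have onT: "(c1 \<circ> c2) x = c1 x" if "x \<in> T" for x using that p2 by (simp add: permutes_not_in)
    have onW: "(c1 \<circ> c2) x = c2 x" if "x \<in> S - T" for x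
    proof -
      have "c2 x \<in> S - T" using that permutes_in_image[OF p2] by blast
      then show ?thesis using p1 by (simp add: permutes_not_in)
    qed
    have r1: "restrict_id (c1 \<circ> c2) T = c1"
      using onT p1 by (auto simp: restrict_id_def fun_eq_iff permutes_not_in)
    have r2: "restrict_id (c1 \<circ> c2) (S - T) = c2"
      using onW p2 by (auto simp: restrict_id_def fun_eq_iff permutes_not_in)
    show "(case case p of (c1, c2) \<Rightarrow> c1 \<circ> c2 of c \<Rightarrow> (restrict_id c T, restrict_id c (S - T))) = p"
      using r1 r2 p by simp
    have "c1 \<circ> c2 permutes S"
      by (rule permutes_compose) (use p1 p2 assms permutes_subset in blast)+
    moreover have "f ((c1 \<circ> c2) x) = g x" if "x \<in> S" for x
      using that onT[of x] onW[of x] c1 c2 by (cases "x \<in> T") (auto simp: lifts_def)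
    moreover have "(c1 \<circ> c2) ` T = T"
      using onT permutes_image[OF p1] by (metis image_cong)
    ultimately show "(case p of (c1, c2) \<Rightarrow> c1 \<circ> c2) \<in> {c. c \<in> lifts S f g \<and> c ` T = T}"
      unfolding p lifts_def by simp
    show "sign_on T (case p of (c1, c2) \<Rightarrow> c1 \<circ> c2) = (case p of (c1, c2) \<Rightarrow> sign c1)"
      using r1 p by (simp add: sign_on_def)
  next
    fix c assume "c \<in> {c. c \<in> lifts S f g \<and> c ` T = T}"
    then have c: "c permutes S" "\<And>x. x \<in> S \<Longrightarrow> f (c x) = g x" and cT: "c ` T = T"
      by (auto simp: lifts_def)
    have inj: "inj c" using c(1) by (rule permutes_inj)
    have b1: "bij_betw c T T" using cT inj by (auto simp: bij_betw_def intro: inj_on_subset)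
    have "c ` (S - T) = S - T" using cT permutes_image[OF c(1)] by (simp add: image_set_diff[OF inj])
    then have b2: "bij_betw c (S - T) (S - T)" using inj by (auto simp: bij_betw_def intro: inj_on_subset)
    show "(case (restrict_id c T, restrict_id c (S - T)) of (c1, c2) \<Rightarrow> c1 \<circ> c2) = c"
    proof
      fix x
      have "c x \<in> S - T" if "x \<in> S - T" using b2 that by (auto simp: bij_betw_def)
      then show "(case (restrict_id c T, restrict_id c (S - T)) of (c1, c2) \<Rightarrow> c1 \<circ> c2) x = c x"
        using assms(2) c(1) by (auto simp: restrict_id_def permutes_not_in)
    qed
    show "(restrict_id c T, restrict_id c (S - T)) \<in> lifts T f g \<times> lifts (S - T) f g"
      using permutes_restrict_id[OF b1] permutes_restrict_id[OF b2] c(2) assms(2) by (auto simp: lifts_def)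
  qed
  finally show ?thesis by simp
qed

text \<open>Both the number of colourings and the full-cycle condition become sums of indicators;
  moving the sum over \<open>c\<close> to the inside produces a determinant times a permanent for
  each \<open>T\<close> and \<open>f\<close>.\<close>

lemma sum_full_cycles_signed:
  assumes "finite S" "a \<in> S"
  shows "(\<Sum>c | c permutes S \<and> cyclic_on c S. int (card (colourings S c \<iota> k))) =
    (\<Sum>T\<in>Pow (S - {a}). (-1) ^ card T *
       (\<Sum>f\<in>S \<rightarrow>\<^sub>E {..<k}. signed_lifts T f (f \<circ> \<iota>) * int (card (lifts (S - T) f (f \<circ> \<iota>)))))"
proof -
  let ?P = "{c. c permutes S}" and ?F = "S \<rightarrow>\<^sub>E {..<k}" and ?T = "Pow (S - {a})"
  have fin: "finite ?P" "finite ?F" "finite ?T"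
    using assms by (auto simp: finite_permutations intro: finite_PiE)
  have col: "int (card (colourings S c \<iota> k)) = (\<Sum>f\<in>?F. of_bool (c \<in> lifts S f (f \<circ> \<iota>)))" if "c \<in> ?P" for c
  proof -
    have "colourings S c \<iota> k = {f \<in> ?F. c \<in> lifts S f (f \<circ> \<iota>)}"
      using that by (auto simp: colourings_def lifts_def)
    moreover have "?F \<inter> {f. c \<in> lifts S f (f \<circ> \<iota>)} = {f \<in> ?F. c \<in> lifts S f (f \<circ> \<iota>)}" by auto
    ultimately show ?thesis using fin by (simp add: of_bool_def sum.If_cases)
  qed
  have ind: "(of_bool (cyclic_on c S) :: int) = (\<Sum>T\<in>?T. of_bool (c ` T = T) * ((-1) ^ card T * sign_on T c))"
    if "c \<in> ?P" for c
  proof -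
    have "(\<Sum>T\<in>?T. of_bool (c ` T = T) * ((-1) ^ card T * sign_on T c)) =
       (\<Sum>T | T \<in> ?T \<and> c ` T = T. (-1) ^ card T * sign_on T c)"
      using fin by (subst sum.inter_filter) (auto simp: of_bool_def intro: sum.cong)
    also have "{T. T \<in> ?T \<and> c ` T = T} = {T. T \<subseteq> S - {a} \<and> c ` T = T}" by auto
    also have "(\<Sum>T | T \<subseteq> S - {a} \<and> c ` T = T. (-1) ^ card T * sign_on T c) = of_bool (cyclic_on c S)"
      using sum_invariant_sign_cyclic[of S c a] assms that by (simp add: of_bool_def)
    finally show ?thesis by simp
  qed
  have "(\<Sum>c | c permutes S \<and> cyclic_on c S. int (card (colourings S c \<iota> k))) =
     (\<Sum>c\<in>?P. of_bool (cyclic_on c S) * int (card (colourings S c \<iota> k)))"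
  proof -
    have "{c. c permutes S \<and> cyclic_on c S} = {c \<in> ?P. cyclic_on c S}" by auto
    then show ?thesis using fin by (simp only: sum.inter_filter) (auto simp: of_bool_def intro: sum.cong)
  qed
  also have "\<dots> = (\<Sum>c\<in>?P. \<Sum>T\<in>?T. \<Sum>f\<in>?F.
      of_bool (c ` T = T) * ((-1) ^ card T * sign_on T c) * of_bool (c \<in> lifts S f (f \<circ> \<iota>)))"
    by (intro sum.cong refl) (simp only: col ind sum_product)
  also have "\<dots> = (\<Sum>T\<in>?T. \<Sum>f\<in>?F. \<Sum>c\<in>?P.
      of_bool (c ` T = T) * ((-1) ^ card T * sign_on T c) * of_bool (c \<in> lifts S f (f \<circ> \<iota>)))"
    by (subst sum.swap) (intro sum.cong refl sum.swap)
  also have "\<dots> = (\<Sum>T\<in>?T. \<Sum>f\<in>?F. (-1) ^ card T *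
      (signed_lifts T f (f \<circ> \<iota>) * int (card (lifts (S - T) f (f \<circ> \<iota>)))))"
  proof (intro sum.cong refl)
    fix T f assume T: "T \<in> ?T"
    have "(\<Sum>c\<in>?P. of_bool (c ` T = T) * ((-1) ^ card T * sign_on T c) * of_bool (c \<in> lifts S f (f \<circ> \<iota>)))
       = (\<Sum>c\<in>?P. if c \<in> lifts S f (f \<circ> \<iota>) \<and> c ` T = T then (-1) ^ card T * sign_on T c else 0)"
      by (intro sum.cong) auto
    also have "\<dots> = (\<Sum>c | c \<in> ?P \<and> c \<in> lifts S f (f \<circ> \<iota>) \<and> c ` T = T. (-1) ^ card T * sign_on T c)"
      using fin by (intro sum.inter_filter[symmetric])
    also have "{c. c \<in> ?P \<and> c \<in> lifts S f (f \<circ> \<iota>) \<and> c ` T = T} = {c. c \<in> lifts S f (f \<circ> \<iota>) \<and> c ` T = T}"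
      by (auto simp: lifts_def)
    also have "(\<Sum>c | c \<in> lifts S f (f \<circ> \<iota>) \<and> c ` T = T. (-1) ^ card T * sign_on T c)
       = (-1) ^ card T * (signed_lifts T f (f \<circ> \<iota>) * int (card (lifts (S - T) f (f \<circ> \<iota>))))"
      using sum_lifts_product[OF assms(1), of T f "f \<circ> \<iota>"] T by (simp add: sum_distrib_left[symmetric] subset_iff)
    finally show "(\<Sum>c\<in>?P. of_bool (c ` T = T) * ((-1) ^ card T * sign_on T c) * of_bool (c \<in> lifts S f (f \<circ> \<iota>))) = \<dots>" .
  qed
  finally show ?thesis by (simp only: sum_distrib_left)
qed

section \<open>Determinant rules for signed lifts\<close>

text \<open>Exchange of two columns of the determinant.\<close>

lemma signed_lifts_transpose:
  assumes "finite T" "i \<in> T" "j \<in> T" "i \<noteq> j"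
  shows "signed_lifts T f (g \<circ> transpose i j) = - signed_lifts T f g"
proof -
  have mem: "c \<circ> transpose i j \<in> lifts T f (h \<circ> transpose i j)" if "c \<in> lifts T f h" for c h
  proof -
    have "c \<circ> transpose i j permutes T"
      using that assms by (intro permutes_compose[OF permutes_swap_id]) (auto simp: lifts_def)
    moreover have "transpose i j x \<in> T" if "x \<in> T" for x using that assms by (auto simp: transpose_def)
    ultimately show ?thesis using that by (simp add: lifts_def)
  qed
  have "signed_lifts T f (g \<circ> transpose i j) = (\<Sum>c\<in>lifts T f g. - sign c)"
    unfolding signed_lifts_def
  proof (rule sum.reindex_bij_witness[of _ "\<lambda>c. c \<circ> transpose i j" "\<lambda>c. c \<circ> transpose i j"])
    fix c assume c: "c \<in> lifts T f (g \<circ> transpose i j)"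
    show "c \<circ> transpose i j \<in> lifts T f g" using mem[OF c] by (simp add: comp_assoc)
    have "permutation c" using c assms permutes_imp_permutation by (auto simp: lifts_def)
    then show "- sign (c \<circ> transpose i j) = sign c"
      using assms by (simp add: sign_compose permutation_swap_id sign_swap_id)
  qed (simp_all add: comp_assoc mem)
  then show ?thesis by (simp add: signed_lifts_def sum_negf)
qed

text \<open>A determinant with two equal rows: exchanging two points of the same colour after
  \<open>c\<close> keeps the lift and flips its sign.\<close>

lemma signed_lifts_not_inj:
  assumes "finite T" "\<not> inj_on f T"
  shows "signed_lifts T f g = 0"
proof -
  obtain i j where ij: "i \<in> T" "j \<in> T" "i \<noteq> j" "f i = f j" using assms(2) by (auto simp: inj_on_def)
  have f: "f (transpose i j x) = f x" for x using ij(4) by (auto simp: transpose_def)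
  show ?thesis unfolding signed_lifts_def
  proof (rule signed_sum_zero[of _ "\<lambda>c. transpose i j \<circ> c"])
    fix c assume c: "c \<in> lifts T f g"
    have "transpose i j \<circ> c permutes T"
      using c ij by (intro permutes_compose[OF _ permutes_swap_id]) (auto simp: lifts_def)
    then show "transpose i j \<circ> c \<in> lifts T f g" using c f by (simp add: lifts_def)
    have "permutation c" using c assms permutes_imp_permutation by (auto simp: lifts_def)
    then show "sign (transpose i j \<circ> c) = - sign c"
      using ij by (simp add: sign_compose permutation_swap_id sign_swap_id)
  qed (simp add: o_assoc)
qed

text \<open>With pairwise different colours on \<open>T\<close>, the colour of an image determines
  the image, so \<open>\<kappa>\<close> is the only lift.\<close>

lemma signed_lifts_inj:
  assumes "finite T" "inj_on f T" "\<kappa> permutes T" "\<And>x. x \<in> T \<Longrightarrow> g x = f (\<kappa> x)"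
  shows "signed_lifts T f g = sign \<kappa>"
proof -
  have "lifts T f g = {\<kappa>}"
  proof (intro equalityI subsetI)
    fix c assume c: "c \<in> lifts T f g"
    have "c x = \<kappa> x" for x
    proof (cases "x \<in> T")
      case True
      then have "f (c x) = f (\<kappa> x)" "c x \<in> T" "\<kappa> x \<in> T"
        using c assms(3,4) by (auto simp: lifts_def permutes_in_image)
      then show ?thesis using assms(2) by (auto dest: inj_onD)
    next
      case False
      then show ?thesis using c assms(3) by (auto simp: lifts_def permutes_not_in)
    qed
    then show "c \<in> {\<kappa>}" by auto
  qed (use assms in \<open>auto simp: lifts_def\<close>)
  then show ?thesis by (simp add: signed_lifts_def)
qed

section \<open>Colour-preserving permutations, summed over colourings\<close>

lemma card_lifts_permute:
  assumes "\<kappa> permutes W" "\<And>x. x \<in> W \<Longrightarrow> g x = f (\<kappa> x)"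
  shows "card (lifts W f g) = card (lifts W f f)"
proof (rule bij_betw_same_card)
  have inv_perm: "inv' \<kappa> permutes W" using assms(1) by (rule permutes_inv)
  show "bij_betw (\<lambda>c. c \<circ> inv' \<kappa>) (lifts W f g) (lifts W f f)"
  proof (rule bij_betwI[where g = "\<lambda>c. c \<circ> \<kappa>"])
    show "(\<lambda>c. c \<circ> inv' \<kappa>) \<in> lifts W f g \<rightarrow> lifts W f f"
    proof
      fix c assume c: "c \<in> lifts W f g"
      have "f ((c \<circ> inv' \<kappa>) x) = f x" if "x \<in> W" for x
      proof -
        have "inv' \<kappa> x \<in> W" using that permutes_in_image[OF inv_perm] by blast
        then show ?thesis using c assms permutes_inverses(1)[OF assms(1)] by (simp add: lifts_def)
      qed
      then show "c \<circ> inv' \<kappa> \<in> lifts W f f"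
        using c permutes_compose[OF inv_perm] by (simp add: lifts_def)
    qed
    show "(\<lambda>c. c \<circ> \<kappa>) \<in> lifts W f f \<rightarrow> lifts W f g"
      using assms permutes_compose[OF assms(1)] permutes_in_image[OF assms(1)] by (auto simp: lifts_def)
  qed (simp_all add: comp_assoc permutes_inv_o[OF assms(1)])
qed

lemma card_lifts_transpose:
  assumes "u \<in> W" "v \<in> W"
  shows "card (lifts W (f \<circ> transpose u v) g) = card (lifts W f g)"
proof (rule bij_betw_same_card)
  have t: "transpose u v permutes W" using assms by (rule permutes_swap_id)
  show "bij_betw (\<lambda>c. transpose u v \<circ> c) (lifts W (f \<circ> transpose u v) g) (lifts W f g)"
    by (rule bij_betwI[where g = "\<lambda>c. transpose u v \<circ> c"])
      (auto simp: lifts_def o_assoc intro: permutes_compose[OF _ t])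
qed

lemma card_lifts_empty: "card (lifts {} f g) = 1"
  by (simp add: lifts_def)

text \<open>The image \<open>b\<close> of \<open>w\<close> may be any point with the colour of
  \<open>w\<close>. Composing with the transposition of \<open>w\<close> and \<open>b\<close> makes
  \<open>w\<close> a fixed point and changes no colours.\<close>

lemma card_lifts_insert:
  assumes "finite W" "w \<notin> W"
  shows "card (lifts (insert w W) f f) = Suc (card {v \<in> W. f v = f w}) * card (lifts W f f)"
proof -
  let ?B = "{v \<in> insert w W. f v = f w}"
  have "card (lifts (insert w W) f f) = card (?B \<times> lifts W f f)"
  proof (rule bij_betw_same_card, rule bij_betwI[where g = "\<lambda>(b, c). transpose w b \<circ> c"])
    show "(\<lambda>c. (c w, transpose w (c w) \<circ> c)) \<in> lifts (insert w W) f f \<rightarrow> ?B \<times> lifts W f f"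
    proof
      fix c assume "c \<in> lifts (insert w W) f f"
      then have c: "c permutes insert w W" "\<And>x. x \<in> insert w W \<Longrightarrow> f (c x) = f x" by (auto simp: lifts_def)
      have cw: "c w \<in> insert w W" "f (c w) = f w" using c permutes_in_image[OF c(1), of w] by auto
      have "transpose w (c w) \<circ> c permutes insert w W"
        using cw by (intro permutes_compose[OF c(1) permutes_swap_id]) auto
      then have "transpose w (c w) \<circ> c permutes W"
        by (rule permutes_superset) (use assms in auto)
      moreover have "f (transpose w (c w) y) = f y" for y using cw by (auto simp: transpose_def)
      ultimately show "(c w, transpose w (c w) \<circ> c) \<in> ?B \<times> lifts W f f"
        using cw c by (auto simp: lifts_def)
    qed
    show "(\<lambda>(b, c). transpose w b \<circ> c) \<in> ?B \<times> lifts W f f \<rightarrow> lifts (insert w W) f f"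
    proof (clarify)
      fix b c assume b: "b \<in> insert w W" "f b = f w" and c: "c \<in> lifts W f f"
      have cw: "c w = w" "c permutes insert w W"
        using c assms by (auto simp: lifts_def permutes_not_in intro: permutes_subset)
      have "transpose w b \<circ> c permutes insert w W"
        using b by (intro permutes_compose[OF cw(2) permutes_swap_id]) auto
      moreover have "f (transpose w b y) = f y" for y using b by (auto simp: transpose_def)
      ultimately show "transpose w b \<circ> c \<in> lifts (insert w W) f f"
        using b c cw by (auto simp: lifts_def)
    qed
    fix p assume "p \<in> ?B \<times> lifts W f f"
    then obtain b c where p: "p = (b, c)" "c permutes W" by (auto simp: lifts_def)
    have "c w = w" using p assms by (simp add: permutes_not_in)
    then show "(case case p of (b, c) \<Rightarrow> transpose w b \<circ> c of c \<Rightarrow> (c w, transpose w (c w) \<circ> c)) = p"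
      using p by (simp add: o_assoc)
  qed (simp add: o_assoc)
  moreover have "?B = insert w {v \<in> W. f v = f w}" by auto
  then have "card ?B = Suc (card {v \<in> W. f v = f w})" using assms by simp
  ultimately show ?thesis by (simp add: card_cartesian_product)
qed

lemma sum_PiE_insert:
  assumes "w \<notin> S"
  shows "(\<Sum>f\<in>insert w S \<rightarrow>\<^sub>E K. h f) = (\<Sum>f\<in>S \<rightarrow>\<^sub>E K. \<Sum>y\<in>K. h (f(w := y)))"
proof -
  have "(\<Sum>f\<in>insert w S \<rightarrow>\<^sub>E K. h f) = (\<Sum>(y, f)\<in>K \<times> (S \<rightarrow>\<^sub>E K). h (f(w := y)))"
    unfolding PiE_insert_eq by (subst sum.reindex[OF inj_combinator[OF assms]]) (simp add: case_prod_unfold)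
  also have "\<dots> = (\<Sum>f\<in>S \<rightarrow>\<^sub>E K. \<Sum>y\<in>K. h (f(w := y)))"
    by (simp add: sum.cartesian_product[symmetric] sum.swap[of _ _ K])
  finally show ?thesis .
qed

text \<open>Summed over the colour \<open>y\<close> of the new point,
  \<open>1 + card {v \<in> W. f v = y}\<close> gives \<open>k + card W\<close> whatever the colours
  on \<open>W\<close> are. Iteration yields a rising factorial, provided that the weight
  \<open>h\<close> ignores the new colour.\<close>

lemma sum_colourings_insert:
  fixes h :: "('a \<Rightarrow> nat) \<Rightarrow> real"
  assumes S: "finite S" "W \<subseteq> S" "w \<notin> S" and h: "\<And>f y. h (f(w := y)) = h f"
  shows "(\<Sum>f\<in>insert w S \<rightarrow>\<^sub>E {..<k}. h f * real (card (lifts (insert w W) f f))) =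
    (real k + real (card W)) * (\<Sum>f\<in>S \<rightarrow>\<^sub>E {..<k}. h f * real (card (lifts W f f)))"
proof -
  have W: "finite W" "w \<notin> W" using S finite_subset by auto
  have "(\<Sum>y<k. h (f(w := y)) * real (card (lifts (insert w W) (f(w := y)) (f(w := y))))) =
     (real k + real (card W)) * (h f * real (card (lifts W f f)))" if f: "f \<in> S \<rightarrow>\<^sub>E {..<k}" for f
  proof -
    have "card (lifts (insert w W) (f(w := y)) (f(w := y))) = Suc (card {v \<in> W. f v = y}) * card (lifts W f f)" for y
    proof -
      have "{v \<in> W. (f(w := y)) v = (f(w := y)) w} = {v \<in> W. f v = y}" using W by auto
      moreover have "lifts W (f(w := y)) (f(w := y)) = lifts W f f" using W by (intro lifts_cong) auto
      ultimately show ?thesis by (simp only: card_lifts_insert[OF W])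
    qed
    then have "(\<Sum>y<k. h (f(w := y)) * real (card (lifts (insert w W) (f(w := y)) (f(w := y)))))
       = (\<Sum>y<k. (1 + real (card {v \<in> W. f v = y})) * (h f * real (card (lifts W f f))))"
      by (intro sum.cong refl) (simp only: h of_nat_mult of_nat_Suc mult_ac add_ac)
    also have "\<dots> = (real k + (\<Sum>y<k. real (card {v \<in> W. f v = y}))) * (h f * real (card (lifts W f f)))"
      by (simp add: sum_distrib_right[symmetric] sum.distrib)
    also have "(\<Sum>y<k. real (card {v \<in> W. f v = y})) = real (card W)"
    proof -
      have "(\<Sum>y<k. \<Sum>v | v \<in> W \<and> f v = y. 1) = (\<Sum>v\<in>W. 1 :: nat)"
        using W f S by (intro sum.group) auto
      then show ?thesis by (simp flip: of_nat_sum)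
    qed
    finally show ?thesis .
  qed
  then show ?thesis by (simp add: sum_PiE_insert[OF S(3)] sum_distrib_left)
qed

lemma sum_inj_colourings:
  assumes "finite T"
  shows "(\<Sum>f\<in>T \<rightarrow>\<^sub>E {..<k}. of_bool (inj_on f T)) = ffall (real k) (card T)"
  using assms
proof (induction T)
  case empty
  show ?case by (simp add: ffall_def)
next
  case (insert x T)
  have "(\<Sum>y<k. of_bool (inj_on (f(x := y)) (insert x T))) = of_bool (inj_on f T) * (real k - real (card T))"
    if f: "f \<in> T \<rightarrow>\<^sub>E {..<k}" for f
  proof (cases "inj_on f T")
    case True
    have "inj_on (f(x := y)) (insert x T) \<longleftrightarrow> y \<notin> f ` T" for y
      using True insert(2) by (auto simp: inj_on_def)
    then have "(\<Sum>y<k. of_bool (inj_on (f(x := y)) (insert x T)) :: real) = (\<Sum>y<k. of_bool (y \<notin> f ` T))"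
      by (simp only:)
    also have "\<dots> = real (card ({..<k} - f ` T))"
      by (simp add: of_bool_def sum.If_cases Diff_eq Compl_eq)
    also have "card ({..<k} - f ` T) = k - card T"
      using f insert(1) True by (subst card_Diff_subset) (auto simp: card_image)
    also have "real (k - card T) = real k - real (card T)"
    proof -
      have "f ` T \<subseteq> {..<k}" using f by auto
      then have "card T \<le> k" using card_mono[of "{..<k}" "f ` T"] card_image[OF True] by simp
      then show ?thesis by simp
    qed
    finally show ?thesis by (simp only: True of_bool_eq mult_1)
  next
    case False
    then have "\<not> inj_on (f(x := y)) (insert x T)" for y
      using insert(2) by (auto simp: inj_on_def split: if_splits)
    then show ?thesis by (simp only: False of_bool_eq mult_zero_left sum.neutral_const)
  qed
  then show ?case using insert
    by (simp add: sum_PiE_insert sum_distrib_right[symmetric] ffall_def del: of_bool_eq_iff)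
qed

lemma sum_inj_lifts:
  assumes "finite T" "finite W" "T \<inter> W = {}"
  shows "(\<Sum>f\<in>T \<union> W \<rightarrow>\<^sub>E {..<k}. of_bool (inj_on f T) * real (card (lifts W f f))) =
    ffall (real k) (card T) * pochhammer (real k) (card W)"
  using assms(2,3)
proof (induction W)
  case empty
  then show ?case using sum_inj_colourings[OF assms(1)] by (simp add: card_lifts_empty)
next
  case (insert w W)
  have h: "of_bool (inj_on (f(w := y)) T) = (of_bool (inj_on f T) :: real)" for f :: "'a \<Rightarrow> nat" and y
    using insert.prems by (intro arg_cong[of _ _ of_bool] inj_on_cong) auto
  have "(\<Sum>f\<in>insert w (T \<union> W) \<rightarrow>\<^sub>E {..<k}. of_bool (inj_on f T) * real (card (lifts (insert w W) f f)))
     = (real k + real (card W)) * (\<Sum>f\<in>T \<union> W \<rightarrow>\<^sub>E {..<k}. of_bool (inj_on f T) * real (card (lifts W f f)))"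
    by (rule sum_colourings_insert) (use insert assms(1) h in auto)
  then show ?case using insert by (simp add: pochhammer_Suc mult_ac)
qed

text \<open>The colour of \<open>u\<close> is forced by \<open>j\<close>, so \<open>u\<close>
  contributes a factor 1 instead of \<open>k\<close>. The further points contribute
  \<open>k + 1\<close>, \<open>k + 2\<close> and so on, whence the shifted rising factorial.\<close>

lemma sum_inj_lifts_fixed:
  assumes T: "finite T" "j \<in> T" and W: "finite W" "T \<inter> W = {}" "u \<notin> T" "u \<notin> W"
  shows "(\<Sum>f\<in>T \<union> insert u W \<rightarrow>\<^sub>E {..<k}. of_bool (inj_on f T \<and> f u = f j) * real (card (lifts (insert u W) f f))) =
    ffall (real k) (card T) * pochhammer (real k + 1) (card W)"
  using W(1,2,4)
proof (induction W)
  case empty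
  have "(\<Sum>y<k. of_bool (inj_on (f(u := y)) T \<and> (f(u := y)) u = (f(u := y)) j)) = (of_bool (inj_on f T) :: real)"
    if f: "f \<in> T \<rightarrow>\<^sub>E {..<k}" for f
  proof -
    have "inj_on (f(u := y)) T \<longleftrightarrow> inj_on f T" for y using W by (intro inj_on_cong) auto
    moreover have "(f(u := y)) u = (f(u := y)) j \<longleftrightarrow> y = f j" for y using T W by auto
    moreover have "f j < k" using f T by auto
    then have "(\<Sum>y<k. of_bool (inj_on f T \<and> y = f j)) = (of_bool (inj_on f T) :: real)"
      by (simp add: of_bool_def)
    ultimately show ?thesis by (simp only:)
  qed
  moreover have "card (lifts {u} f f) = 1" for f :: "'a \<Rightarrow> nat"
    by (subst card_lifts_insert) (simp_all add: card_lifts_empty)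
  ultimately show ?case
    using sum_inj_colourings[OF T(1), of k] by (simp add: sum_PiE_insert[OF W(3)])
next
  case (insert w W)
  have h: "of_bool (inj_on (f(w := y)) T \<and> (f(w := y)) u = (f(w := y)) j) = (of_bool (inj_on f T \<and> f u = f j) :: real)"
    for f :: "'a \<Rightarrow> nat" and y
  proof -
    have "inj_on (f(w := y)) T \<longleftrightarrow> inj_on f T" using insert.prems by (intro inj_on_cong) auto
    then show ?thesis using insert.prems T by auto
  qed
  have "(\<Sum>f\<in>insert w (T \<union> insert u W) \<rightarrow>\<^sub>E {..<k}.
        of_bool (inj_on f T \<and> f u = f j) * real (card (lifts (insert w (insert u W)) f f)))
     = (real k + real (card (insert u W))) *
       (\<Sum>f\<in>T \<union> insert u W \<rightarrow>\<^sub>E {..<k}. of_bool (inj_on f T \<and> f u = f j) * real (card (lifts (insert u W) f f)))"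
    by (rule sum_colourings_insert) (use insert assms h in auto)
  then show ?case using insert by (simp add: pochhammer_Suc insert_commute[of u w] mult_ac add_ac)
qed

section \<open>Contribution of a set according to its unpaired points\<close>

lemma restrict_fpf_involution:
  assumes "\<iota> \<in> fpf_involutions S" "T \<subseteq> S" "\<iota> ` T = T"
  shows "restrict_id \<iota> T \<in> fpf_involutions T"
proof -
  note D = fpf_involutionsD[OF assms(1)]
  have "bij_betw \<iota> T T" using assms(3) permutes_inj_on[OF D(1)] by (simp add: bij_betw_def)
  moreover have "\<iota> x \<in> T" if "x \<in> T" for x using assms(3) that by blast
  ultimately show ?thesis
    using permutes_restrict_id D(2,3) assms(2) by (auto simp: fpf_involutions_def)
qed

text \<open>Exchanging the colours of \<open>\<iota> i\<close> and \<open>\<iota> j\<close>, both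
  outside \<open>T\<close>, reverses the sign of the summand: on \<open>T\<close> it exchanges
  columns \<open>i\<close> and \<open>j\<close> of the determinant, on \<open>S - T\<close> it only
  permutes the rows of the permanent.\<close>

lemma sum_lifts_two_unpaired:
  assumes S: "finite S" "\<iota> \<in> fpf_involutions S" and T: "T \<subseteq> S"
    and ij: "i \<in> T" "j \<in> T" "i \<noteq> j" "\<iota> i \<notin> T" "\<iota> j \<notin> T"
  shows "(\<Sum>f\<in>S \<rightarrow>\<^sub>E {..<k}. signed_lifts T f (f \<circ> \<iota>) * int (card (lifts (S - T) f (f \<circ> \<iota>)))) = 0"
proof (rule signed_sum_zero[of _ "\<lambda>f. f \<circ> transpose (\<iota> i) (\<iota> j)"])
  note D = fpf_involutionsD[OF S(2)]
  let ?t = "transpose (\<iota> i) (\<iota> j)"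
  have fT: "finite T" using S T finite_subset by blast
  have uv: "\<iota> i \<in> S - T" "\<iota> j \<in> S - T" using ij T D(4) by auto
  fix f assume f: "f \<in> S \<rightarrow>\<^sub>E {..<k}"
  have tS: "?t x \<in> S \<longleftrightarrow> x \<in> S" for x using uv by (auto simp: transpose_def)
  show "f \<circ> ?t \<in> S \<rightarrow>\<^sub>E {..<k}"
    using f tS uv by (auto simp: PiE_iff extensional_def)
  show "f \<circ> ?t \<circ> ?t = f" by (simp add: comp_assoc)
  have t\<iota>: "?t (\<iota> x) = \<iota> (transpose i j x)" for x
  proof -
    have "\<iota> x = \<iota> i \<longleftrightarrow> x = i" "\<iota> x = \<iota> j \<longleftrightarrow> x = j" using D(2) by metis+
    then show ?thesis by (auto simp: transpose_def)
  qed
  have tT: "?t x = x" if "x \<in> T" for x using that ij by (auto simp: transpose_def)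
  \<comment> \<open>Columns of the permanent belong to points outside \<open>T\<close>; their
    partners differ from \<open>\<iota> i\<close> and \<open>\<iota> j\<close>, so the prescribed
    colours there do not change.\<close>
  have t\<iota>W: "?t (\<iota> x) = \<iota> x" if "x \<notin> T" for x
    using t\<iota> that ij by (auto simp: transpose_def)
  have "signed_lifts T (f \<circ> ?t) (f \<circ> ?t \<circ> \<iota>) = signed_lifts T f ((f \<circ> \<iota>) \<circ> transpose i j)"
    unfolding signed_lifts_def using tT t\<iota>
    by (intro sum.cong lifts_cong refl) auto
  also have "\<dots> = - signed_lifts T f (f \<circ> \<iota>)"
    by (rule signed_lifts_transpose) (use fT ij in auto)
  moreover have "lifts (S - T) (f \<circ> ?t) (f \<circ> ?t \<circ> \<iota>) = lifts (S - T) (f \<circ> ?t) (f \<circ> \<iota>)"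
    using t\<iota>W by (intro lifts_cong) auto
  moreover have "card (lifts (S - T) (f \<circ> ?t) (f \<circ> \<iota>)) = card (lifts (S - T) f (f \<circ> \<iota>))"
    using uv by (rule card_lifts_transpose)
  ultimately show "signed_lifts T (f \<circ> ?t) (f \<circ> ?t \<circ> \<iota>) * int (card (lifts (S - T) (f \<circ> ?t) (f \<circ> ?t \<circ> \<iota>))) =
     - (signed_lifts T f (f \<circ> \<iota>) * int (card (lifts (S - T) f (f \<circ> \<iota>))))"
    by (simp only:)
qed

text \<open>Only colourings injective on \<open>T\<close> survive, with \<open>\<iota>\<close>
  restricted to \<open>T\<close> as the only lift there; its sign is -1 to the number of pairs. On
  the complement \<open>\<iota>\<close> can be composed away, leaving colour-preserving
  permutations.\<close>

lemma sum_lifts_paired: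
  assumes S: "finite S" "\<iota> \<in> fpf_involutions S" and T: "T \<subseteq> S" "\<iota> ` T = T"
  shows "real_of_int (\<Sum>f\<in>S \<rightarrow>\<^sub>E {..<k}. signed_lifts T f (f \<circ> \<iota>) * int (card (lifts (S - T) f (f \<circ> \<iota>)))) =
    (-1) ^ (card T div 2) * (ffall (real k) (card T) * pochhammer (real k) (card (S - T)))"
proof -
  note D = fpf_involutionsD[OF S(2)]
  have fin: "finite T" "finite (S - T)" using S T finite_subset by auto
  have R: "restrict_id \<iota> T \<in> fpf_involutions T" using restrict_fpf_involution[OF S(2) T] .
  have "\<iota> ` (S - T) = S - T"
    using T(2) permutes_image[OF D(1)] by (simp add: image_set_diff[OF permutes_inj[OF D(1)]])
  then have R': "restrict_id \<iota> (S - T) permutes S - T"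
    by (intro permutes_restrict_id) (simp add: bij_betw_def permutes_inj_on[OF D(1)])
  have "signed_lifts T f (f \<circ> \<iota>) = of_bool (inj_on f T) * (-1) ^ (card T div 2)" for f :: "'a \<Rightarrow> nat"
  proof (cases "inj_on f T")
    case True
    have "signed_lifts T f (f \<circ> \<iota>) = sign (restrict_id \<iota> T)"
      by (rule signed_lifts_inj[OF fin(1) True fpf_involutionsD(1)[OF R]]) simp
    then show ?thesis using True sign_fpf_involution[OF fin(1) R] by simp
  qed (simp add: signed_lifts_not_inj fin)
  moreover have "card (lifts (S - T) f (f \<circ> \<iota>)) = card (lifts (S - T) f f)" for f :: "'a \<Rightarrow> nat"
    by (rule card_lifts_permute[OF R']) simp
  ultimately have "real_of_int (signed_lifts T f (f \<circ> \<iota>) * int (card (lifts (S - T) f (f \<circ> \<iota>)))) =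
      (-1) ^ (card T div 2) * (of_bool (inj_on f T) * real (card (lifts (S - T) f f)))" for f :: "'a \<Rightarrow> nat"
    by simp
  then have "real_of_int (\<Sum>f\<in>S \<rightarrow>\<^sub>E {..<k}. signed_lifts T f (f \<circ> \<iota>) * int (card (lifts (S - T) f (f \<circ> \<iota>)))) =
      (-1) ^ (card T div 2) * (\<Sum>f\<in>S \<rightarrow>\<^sub>E {..<k}. of_bool (inj_on f T) * real (card (lifts (S - T) f f)))"
    by (simp only: of_int_sum sum_distrib_left)
  moreover have "T \<union> (S - T) = S" using T by auto
  ultimately show ?thesis using sum_inj_lifts[OF fin, of k] by simp
qed

text \<open>For \<open>f\<close> injective on \<open>insert j T\<close>, a lift agrees with
  \<open>\<iota>\<close> on \<open>T\<close> and hence must fix \<open>j\<close>, which requires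
  \<open>f (\<iota> j) = f j\<close>. This coupling of one outside colour to \<open>j\<close> is
  what turns \<open>k\<close> into \<open>k + 1\<close> in the rising factorial.\<close>

lemma sum_lifts_one_unpaired:
  assumes S: "finite S" "\<iota> \<in> fpf_involutions S" and T: "T \<subseteq> S" "\<iota> ` T = T" and j: "j \<in> S - T"
  shows "real_of_int (\<Sum>f\<in>S \<rightarrow>\<^sub>E {..<k}.
      signed_lifts (insert j T) f (f \<circ> \<iota>) * int (card (lifts (S - insert j T) f (f \<circ> \<iota>)))) =
    (-1) ^ (card T div 2) * (ffall (real k) (Suc (card T)) * pochhammer (real k + 1) (card S - card T - 2))"
proof -
  note D = fpf_involutionsD[OF S(2)]
  let ?T = "insert j T" and ?W = "S - insert j T" and ?W' = "S - insert j T - {\<iota> j}"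
  have fin: "finite T" "finite ?T" "finite ?W" "finite ?W'" using S T finite_subset by auto
  have invT: "\<iota> x \<in> T \<longleftrightarrow> x \<in> T" for x using T(2) D(2) by (metis imageI)
  have \<iota>j: "\<iota> j \<in> ?W" "\<iota> j \<noteq> j" using j invT D(3,4) by auto
  have R: "restrict_id \<iota> T \<in> fpf_involutions T" using restrict_fpf_involution[OF S(2) T] .
  have RT: "restrict_id \<iota> T permutes ?T"
    using fpf_involutionsD(1)[OF R] by (rule permutes_subset) auto
  have "\<iota> ` ?W' = ?W'"
  proof -
    have "\<iota> x \<in> ?W'" if "x \<in> ?W'" for x
    proof -
      have "\<iota> x \<noteq> j" "\<iota> x \<noteq> \<iota> j" using that D(2) by (metis Diff_iff insertI1 singletonI)+
      then show ?thesis using that D(4) invT by auto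
    qed
    then show ?thesis using fin(4) permutes_inj_on[OF D(1)] by (intro endo_inj_surj) auto
  qed
  then have "restrict_id \<iota> ?W' permutes ?W'"
    by (intro permutes_restrict_id) (simp add: bij_betw_def permutes_inj_on[OF D(1)])
  then have R': "restrict_id \<iota> ?W' permutes ?W" by (rule permutes_subset) auto
  have summand: "signed_lifts ?T f (f \<circ> \<iota>) * int (card (lifts ?W f (f \<circ> \<iota>))) =
     (-1) ^ (card T div 2) * (of_bool (inj_on f ?T \<and> f (\<iota> j) = f j) * int (card (lifts ?W f f)))"
    for f :: "'a \<Rightarrow> nat"
  proof (cases "inj_on f ?T")
    case False
    then show ?thesis using signed_lifts_not_inj[OF fin(2) False] by simp
  next
    case inj: True
    show ?thesis
    proof (cases "f (\<iota> j) = f j")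
      case True
      have "signed_lifts ?T f (f \<circ> \<iota>) = sign (restrict_id \<iota> T)"
      proof (rule signed_lifts_inj[OF fin(2) inj RT])
        fix x assume "x \<in> ?T"
        then show "(f \<circ> \<iota>) x = f (restrict_id \<iota> T x)" using True by (cases "x \<in> T") auto
      qed
      moreover have "card (lifts ?W f (f \<circ> \<iota>)) = card (lifts ?W f f)"
      proof (rule card_lifts_permute[OF R'])
        \<comment> \<open>The partner \<open>j\<close> of \<open>\<iota> j\<close> lies outside
          \<open>?W\<close>. Since the two have the same colour, \<open>\<iota> j\<close> can be
          treated as a fixed point.\<close>
        fix x assume x: "x \<in> ?W"
        show "(f \<circ> \<iota>) x = f (restrict_id \<iota> ?W' x)"
        proof (cases "x = \<iota> j")
          case True
          then show ?thesis using \<open>f (\<iota> j) = f j\<close> D(2)[of j] by simp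
        next
          case False
          then have "x \<in> ?W'" using x by blast
          then show ?thesis by simp
        qed
      qed
      ultimately show ?thesis
        using inj True sign_fpf_involution[OF fin(1) R] by simp
    next
      case False
      have "lifts ?T f (f \<circ> \<iota>) = {}"
      proof (rule ccontr)
        assume "lifts ?T f (f \<circ> \<iota>) \<noteq> {}"
        then obtain c where c: "c permutes ?T" "\<And>x. x \<in> ?T \<Longrightarrow> f (c x) = f (\<iota> x)"
          by (auto simp: lifts_def)
        have "c x = \<iota> x" if "x \<in> T" for x
          using that c(2)[of x] invT[of x] permutes_in_image[OF c(1), of x]
          by (intro inj_onD[OF inj]) auto
        then have "c ` T = T" using T(2) by (metis image_cong)
        moreover have "c j \<notin> c ` T" using j inj_image_mem_iff[OF permutes_inj[OF c(1)]] by blast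
        moreover have "c j \<in> ?T" using permutes_in_image[OF c(1), of j] by blast
        ultimately have "c j = j" by blast
        then show False using c(2)[of j] False by simp
      qed
      then show ?thesis using False by (simp add: signed_lifts_def)
    qed
  qed
  have "card S = card ?W' + card T + 2"
  proof -
    have "S = insert (\<iota> j) (insert j (?W' \<union> T))" using T(1) j \<iota>j by auto
    moreover have "card (insert (\<iota> j) (insert j (?W' \<union> T))) = Suc (Suc (card (?W' \<union> T)))"
      using \<iota>j j fin by simp
    moreover have "card (?W' \<union> T) = card ?W' + card T" using fin by (intro card_Un_disjoint) auto
    ultimately show ?thesis by simp
  qed
  then have cW: "card ?W' = card S - card T - 2" by simp
  have "real_of_int (\<Sum>f\<in>S \<rightarrow>\<^sub>E {..<k}. signed_lifts ?T f (f \<circ> \<iota>) * int (card (lifts ?W f (f \<circ> \<iota>)))) =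
     (-1) ^ (card T div 2) * (\<Sum>f\<in>S \<rightarrow>\<^sub>E {..<k}. of_bool (inj_on f ?T \<and> f (\<iota> j) = f j) * real (card (lifts ?W f f)))"
    unfolding summand by (simp add: sum_distrib_left)
  also have "(\<Sum>f\<in>S \<rightarrow>\<^sub>E {..<k}. of_bool (inj_on f ?T \<and> f (\<iota> j) = f j) * real (card (lifts ?W f f))) =
     ffall (real k) (card ?T) * pochhammer (real k + 1) (card ?W')"
  proof -
    have "insert (\<iota> j) ?W' = ?W" "?T \<union> ?W = S" using \<iota>j T j by auto
    then show ?thesis
      using sum_inj_lifts_fixed[of ?T j ?W' "\<iota> j" k] fin \<iota>j by auto
  qed
  also have "card ?T = Suc (card T)" using fin j by simp
  finally show ?thesis unfolding cW .
qed

text \<open>Sets with two unpaired points drop out by \<open>zero\<close>. A set with exactly one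
  unpaired point arises uniquely by adding that point to an invariant set: the new point's partner
  cannot lie in the invariant set, so it remains the only unpaired one.\<close>

lemma sum_by_unpaired:
  fixes w :: "'a set \<Rightarrow> real"
  assumes S: "finite S" "\<iota> \<in> fpf_involutions S" "U \<subseteq> S"
    and zero: "\<And>T i j. T \<subseteq> U \<Longrightarrow> i \<in> T \<Longrightarrow> j \<in> T \<Longrightarrow> i \<noteq> j \<Longrightarrow> \<iota> i \<notin> T \<Longrightarrow> \<iota> j \<notin> T \<Longrightarrow> w T = 0"
  shows "(\<Sum>T\<in>Pow U. w T) = (\<Sum>T | T \<subseteq> U \<and> \<iota> ` T = T. w T + (\<Sum>j\<in>U - T. w (insert j T)))"
proof -
  note D = fpf_involutionsD[OF S(2)]
  define I where "I = {T. T \<subseteq> U \<and> \<iota> ` T = T}"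
  define H where "H = {T. T \<subseteq> U \<and> (\<exists>!j. j \<in> T \<and> \<iota> j \<notin> T)}"
  have fU: "finite U" using S(3,1) by (rule finite_subset)
  have fin: "finite I" "finite H"
    by (rule finite_subset[of _ "Pow U"]; simp add: I_def H_def fU Collect_mono_iff subset_iff)+
  have inv: "\<iota> ` T = T" if "\<And>x. x \<in> T \<Longrightarrow> \<iota> x \<in> T" for T
  proof (intro equalityI subsetI)
    fix x assume "x \<in> T"
    then have "\<iota> (\<iota> x) \<in> \<iota> ` T" using that by blast
    then show "x \<in> \<iota> ` T" by (simp only: D(2))
  qed (use that in blast)
  have "(\<Sum>T\<in>Pow U. w T) = (\<Sum>T\<in>I \<union> H. w T)"
  proof (rule sum.mono_neutral_right)
    show "\<forall>T\<in>Pow U - (I \<union> H). w T = 0"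
    proof
      fix T assume T: "T \<in> Pow U - (I \<union> H)"
      then have "\<iota> ` T \<noteq> T" by (simp add: I_def)
      then obtain i where i: "i \<in> T" "\<iota> i \<notin> T" using inv[of T] by blast
      have "\<not> (\<exists>!j. j \<in> T \<and> \<iota> j \<notin> T)" using T by (simp add: H_def)
      then obtain j where "j \<in> T" "\<iota> j \<notin> T" "j \<noteq> i" using i by blast
      then show "w T = 0" using zero[of T j i] i T by blast
    qed
  next
    show "I \<union> H \<subseteq> Pow U" by (simp add: I_def H_def subset_iff)
  qed (simp add: fU)
  also have "\<dots> = (\<Sum>T\<in>I. w T) + (\<Sum>T\<in>H. w T)"
  proof (rule sum.union_disjoint[OF fin])
    have "T \<notin> H" if "T \<in> I" for T
    proof -
      have "\<iota> j \<in> T" if "j \<in> T" for j using \<open>T \<in> I\<close> that unfolding I_def by blast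
      then show ?thesis by (simp add: H_def) blast
    qed
    then show "I \<inter> H = {}" by blast
  qed
  also have "(\<Sum>T\<in>H. w T) = (\<Sum>p\<in>Sigma I (\<lambda>T. U - T). w (insert (snd p) (fst p)))"
  proof (rule sum.reindex_bij_betw[symmetric], rule bij_betw_imageI)
    have invT: "\<iota> x \<in> T \<longleftrightarrow> x \<in> T" if "T \<in> I" for T x
      proof -
      have "\<iota> ` T = T" using that by (simp add: I_def)
      then show ?thesis using D(2)[of x] by (metis imageI)
    qed
    have ex1: "j \<in> insert i T \<and> \<iota> j \<notin> insert i T \<longleftrightarrow> j = i" if "T \<in> I" "i \<in> U - T" for T i j
    proof
      assume j: "j \<in> insert i T \<and> \<iota> j \<notin> insert i T"
      then show "j = i" using invT[OF that(1), of j] by blast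
    next
      assume "j = i"
      then show "j \<in> insert i T \<and> \<iota> j \<notin> insert i T"
        using invT[OF that(1), of i] that(2) D(3)[of i] S(3) by auto
    qed
    show "inj_on (\<lambda>p. insert (snd p) (fst p)) (Sigma I (\<lambda>T. U - T))"
    proof (rule inj_onI, clarsimp)
      fix T i T' i' assume A: "T \<in> I" "i \<in> U" "i \<notin> T" "T' \<in> I" "i' \<in> U" "i' \<notin> T'" "insert i T = insert i' T'"
      have "i = i'" using ex1[of T i i] ex1[of T' i' i] A by simp
      then show "T = T' \<and> i = i'" using A by auto
    qed
    show "(\<lambda>p. insert (snd p) (fst p)) ` Sigma I (\<lambda>T. U - T) = H"
    proof (intro equalityI subsetI)
      fix X assume "X \<in> (\<lambda>p. insert (snd p) (fst p)) ` Sigma I (\<lambda>T. U - T)"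
      then obtain T i where X: "X = insert i T" "T \<in> I" "i \<in> U - T" by auto
      have "\<exists>!j. j \<in> X \<and> \<iota> j \<notin> X" unfolding X(1) using ex1[OF X(2,3)] by simp
      then show "X \<in> H" using X by (auto simp: H_def I_def)
    next
      fix X assume "X \<in> H"
      then obtain j where j: "j \<in> X" "\<iota> j \<notin> X" "\<And>i. i \<in> X \<Longrightarrow> \<iota> i \<notin> X \<Longrightarrow> i = j" and XU: "X \<subseteq> U"
        unfolding H_def by blast
      have "\<iota> x \<in> X - {j}" if "x \<in> X - {j}" for x
        using that j D(2)[of x] by (metis Diff_iff insertI1 singletonD)
      then have "\<iota> ` (X - {j}) = X - {j}" by (rule inv)
      then have "X - {j} \<in> I" using XU unfolding I_def by blast
      then have "(X - {j}, j) \<in> Sigma I (\<lambda>T. U - T)" using j(1) XU by blast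
      then show "X \<in> (\<lambda>p. insert (snd p) (fst p)) ` Sigma I (\<lambda>T. U - T)"
        using j(1) by (intro image_eqI[of _ _ "(X - {j}, j)"]) auto
    qed
  qed
  also have "\<dots> = (\<Sum>T\<in>I. \<Sum>j\<in>U - T. w (insert j T))"
    using fin fU by (subst sum.Sigma) (auto simp: case_prod_unfold)
  finally show ?thesis unfolding I_def by (simp add: sum.distrib)
qed

text \<open>The value depends on \<open>\<iota>\<close> only through the number of edges, which
  makes the later double count possible.\<close>

lemma full_cycle_colourings:
  assumes S: "finite S" "\<iota> \<in> fpf_involutions S" "card S = 2 * Suc q"
  shows "(\<Sum>c | c permutes S \<and> cyclic_on c S. real (card (colourings S c \<iota> k))) = hz_sum q (real k)"
proof -
  note D = fpf_involutionsD[OF S(2)]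
  obtain a where a: "a \<in> S" using S(3) by fastforce
  let ?U = "S - {a}"
  define F where "F T = real_of_int (\<Sum>f\<in>S \<rightarrow>\<^sub>E {..<k}. signed_lifts T f (f \<circ> \<iota>) * int (card (lifts (S - T) f (f \<circ> \<iota>))))" for T
  \<comment> \<open>\<open>g m\<close> collects an invariant set of size \<open>m\<close> and its
    extensions by one unpaired point, of which there are \<open>2 * q + 1 - m\<close> inside
    \<open>S - {a}\<close>. The minus sign comes from the odd cardinality of the extended
    set.\<close>
  define g where "g m = (-1) ^ (m div 2) * (ffall (real k) m * pochhammer (real k) (2 * Suc q - m)
     - (real (2 * q + 1) - real m) * (ffall (real k) (Suc m) * pochhammer (real k + 1) (2 * q - m)))" for m
  have "(\<Sum>c | c permutes S \<and> cyclic_on c S. real (card (colourings S c \<iota> k)))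
      = real_of_int (\<Sum>c | c permutes S \<and> cyclic_on c S. int (card (colourings S c \<iota> k)))" by simp
  also have "\<dots> = (\<Sum>T\<in>Pow ?U. (-1) ^ card T * F T)"
    unfolding sum_full_cycles_signed[OF S(1) a] F_def by (simp only: of_int_sum of_int_mult of_int_power of_int_minus of_int_1)
  also have "\<dots> = (\<Sum>T | T \<subseteq> ?U \<and> \<iota> ` T = T. (-1) ^ card T * F T + (\<Sum>j\<in>?U - T. (-1) ^ card (insert j T) * F (insert j T)))"
  proof (rule sum_by_unpaired[OF S(1,2)])
    fix T i j assume "T \<subseteq> ?U" "i \<in> T" "j \<in> T" "i \<noteq> j" "\<iota> i \<notin> T" "\<iota> j \<notin> T"
    then show "(-1) ^ card T * F T = 0"
      unfolding F_def by (subst sum_lifts_two_unpaired[OF S(1,2), of T i j]) auto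
  qed auto
  also have "\<dots> = (\<Sum>T | T \<subseteq> ?U \<and> \<iota> ` T = T. g (card T))"
  proof (intro sum.cong refl)
    fix T assume "T \<in> {T. T \<subseteq> ?U \<and> \<iota> ` T = T}"
    then have T: "T \<subseteq> ?U" "\<iota> ` T = T" "T \<subseteq> S" by auto
    have fT: "finite T" using S T finite_subset by blast
    have ev: "even (card T)"
      using sign_fpf_involution[OF fT restrict_fpf_involution[OF S(2) T(3,2)]] by simp
    have le: "card T \<le> 2 * q + 1"
      using card_mono[OF _ T(1)] S a by simp
    have cU: "real (card (?U - T)) = real (2 * q + 1) - real (card T)"
      using card_Diff_subset[OF fT T(1)] le S a by (simp add: of_nat_diff)
    have cS: "card (S - T) = 2 * Suc q - card T" using card_Diff_subset[OF fT T(3)] S(3) by simp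
    have "(-1) ^ card (insert j T) * F (insert j T) =
        - ((-1) ^ (card T div 2) * (ffall (real k) (Suc (card T)) * pochhammer (real k + 1) (2 * q - card T)))"
      if j: "j \<in> ?U - T" for j
    proof -
      have "card (insert j T) = Suc (card T)" using j fT by simp
      moreover have "F (insert j T) = (-1) ^ (card T div 2) *
         (ffall (real k) (Suc (card T)) * pochhammer (real k + 1) (card S - card T - 2))"
        unfolding F_def by (rule sum_lifts_one_unpaired[OF S(1,2) T(3,2)]) (use j in auto)
      moreover have "card S - card T - 2 = 2 * q - card T" using S(3) by simp
      ultimately show ?thesis using ev by simp
    qed
    then have "(\<Sum>j\<in>?U - T. (-1) ^ card (insert j T) * F (insert j T)) = real (card (?U - T)) *
        - ((-1) ^ (card T div 2) * (ffall (real k) (Suc (card T)) * pochhammer (real k + 1) (2 * q - card T)))"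
      by simp
    moreover have "(-1) ^ card T * F T = (-1) ^ (card T div 2) * (ffall (real k) (card T) * pochhammer (real k) (2 * Suc q - card T))"
      unfolding F_def sum_lifts_paired[OF S(1,2) T(3,2)] cS using ev by simp
    ultimately show "(-1) ^ card T * F T + (\<Sum>j\<in>?U - T. (-1) ^ card (insert j T) * F (insert j T)) = g (card T)"
      unfolding g_def cU by (simp only: right_diff_distrib mult_minus_right mult_ac)
  qed
  \<comment> \<open>An invariant set without \<open>a\<close> cannot contain
    \<open>\<iota> a\<close> either, so \<open>q\<close> of the \<open>q + 1\<close> pairs remain to
    choose from.\<close>
  also have "\<dots> = (\<Sum>p\<le>q. real (q choose p) * g (2 * p))"
  proof -
    let ?b = "\<iota> a"
    let ?\<iota> = "transpose a ?b \<circ> \<iota>"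
    have b: "?b \<in> S" "a \<noteq> ?b" using a D(3)[OF a] D(4) by auto
    have \<iota>': "?\<iota> \<in> fpf_involutions (S - {a, ?b})"
    proof -
      obtain \<iota>' where "\<iota>' \<in> fpf_involutions (S - {a, ?b})" "\<iota> = transpose a ?b \<circ> \<iota>'"
        using bij_betw_fpf_involutions[OF a b] S(2) unfolding bij_betw_def by blast
      then show ?thesis by (metis o_assoc transpose_comp_involutory id_comp)
    qed
    have "{T. T \<subseteq> ?U \<and> \<iota> ` T = T} = {T. T \<subseteq> S - {a, ?b} \<and> ?\<iota> ` T = T}"
    proof (rule Collect_cong)
      fix T
      have img: "?\<iota> ` T = \<iota> ` T" if "T \<subseteq> S - {a, ?b}"
      proof (rule image_cong)
        fix x assume "x \<in> T"
        then have "x \<noteq> a" "x \<noteq> ?b" using that by auto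
        then have "\<iota> x \<noteq> a" "\<iota> x \<noteq> ?b" using D(2) by metis+
        then show "?\<iota> x = \<iota> x" by simp
      qed simp
      have "?b \<notin> T" if "T \<subseteq> ?U" "\<iota> ` T = T"
      proof
        assume "?b \<in> T"
        then have "\<iota> ?b \<in> T" using that by blast
        then show False using D(2)[of a] that by auto
      qed
      then show "T \<subseteq> ?U \<and> \<iota> ` T = T \<longleftrightarrow> T \<subseteq> S - {a, ?b} \<and> ?\<iota> ` T = T"
        using img by blast
    qed
    moreover have "card (S - {a, ?b}) div 2 = q"
      using S a b by (simp add: card_Diff_subset)
    ultimately show ?thesis using sum_invariant_subsets[OF _ \<iota>', of g] S(1) by simp
  qed
  also have "\<dots> = hz_sum q (real k)"
    unfolding hz_sum_def
  proof (intro sum.cong refl)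
    fix p assume "p \<in> {..q}"
    then have p: "p \<le> q" by simp
    have e: "2 * Suc q - 2 * p = Suc (Suc (2 * (q - p)))" "2 * q - 2 * p = 2 * (q - p)" using p by auto
    have e1: "pochhammer (real k) (Suc (Suc (2 * (q - p)))) =
        real k * (pochhammer (real k + 1) (2 * (q - p)) * (real k + 1 + 2 * (real q - real p)))"
      using p by (simp only: pochhammer_rec[of "real k"] pochhammer_Suc[of "real k + 1"])
        (simp add: of_nat_diff)
    have e2: "ffall (real k) (Suc (2 * p)) = ffall (real k) (2 * p) * (real k - 2 * real p)"
      by (simp add: ffall_def)
    \<comment> \<open>With \<open>j = q - p\<close> the last factor arises as \<open>k * (k + 1 + 2
      * j) - (2 * j + 1) * (k - 2 * p) = k^2 + 2 * p * (2 * j + 1)\<close>.\<close>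
    show "real (q choose p) * g (2 * p) = hz_term q (real k) p"
      unfolding g_def hz_term_def e e1 e2 by (simp add: algebra_simps power2_eq_square)
  qed
  finally show ?thesis .
qed

section \<open>One-face gluings\<close>

definition gluing_sum :: "'a set \<Rightarrow> ('a \<Rightarrow> 'a) \<Rightarrow> nat \<Rightarrow> real" where
  "gluing_sum S p k = (\<Sum>\<iota>\<in>fpf_involutions S. real (card (colourings S p \<iota> k)))"

text \<open>A colouring is constant on the cycles of \<open>p \<circ> \<iota>\<close>, so it is a
  free choice of a colour for each orbit.\<close>

lemma card_colourings:
  assumes S: "finite S" "p permutes S" "\<iota> \<in> fpf_involutions S"
  shows "card (colourings S p \<iota> k) = k ^ num_cycles S (p \<circ> \<iota>)"
proof -
  note D = fpf_involutionsD[OF S(3)]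
  define \<pi> where "\<pi> = p \<circ> \<iota>"
  have \<pi>: "\<pi> permutes S" unfolding \<pi>_def by (rule permutes_compose[OF D(1) S(2)])
  have perm: "permutation \<pi>" using \<pi> S(1) permutes_imp_permutation by blast
  have col: "colourings S p \<iota> k = {f \<in> S \<rightarrow>\<^sub>E {..<k}. \<forall>x\<in>S. f (\<pi> x) = f x}"
  proof -
    have "(\<forall>x\<in>S. f (p x) = f (\<iota> x)) \<longleftrightarrow> (\<forall>x\<in>S. f (\<pi> x) = f x)" for f :: "'a \<Rightarrow> nat"
      unfolding \<pi>_def comp_def using D(2,4) by metis
    then show ?thesis by (simp add: colourings_def)
  qed
  let ?O = "orbit \<pi> ` S"
  have "bij_betw (\<lambda>g. \<lambda>x\<in>S. g (orbit \<pi> x)) (?O \<rightarrow>\<^sub>E {..<k}) (colourings S p \<iota> k)"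
    unfolding col
  proof (rule bij_betw_imageI)
    show "inj_on (\<lambda>g. \<lambda>x\<in>S. g (orbit \<pi> x)) (?O \<rightarrow>\<^sub>E {..<k})"
    proof (rule inj_onI, rule PiE_ext, assumption, assumption)
      fix g g' X assume eq: "(\<lambda>x\<in>S. g (orbit \<pi> x)) = (\<lambda>x\<in>S. g' (orbit \<pi> x))" and X: "X \<in> ?O"
      then obtain x where x: "x \<in> S" "X = orbit \<pi> x" by blast
      show "g X = g' X" using fun_cong[OF eq, of x] x by simp
    qed
    show "(\<lambda>g. \<lambda>x\<in>S. g (orbit \<pi> x)) ` (?O \<rightarrow>\<^sub>E {..<k}) = {f \<in> S \<rightarrow>\<^sub>E {..<k}. \<forall>x\<in>S. f (\<pi> x) = f x}"
    proof (intro equalityI subsetI)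
      fix f assume "f \<in> (\<lambda>g. \<lambda>x\<in>S. g (orbit \<pi> x)) ` (?O \<rightarrow>\<^sub>E {..<k})"
      then obtain g where g: "g \<in> ?O \<rightarrow>\<^sub>E {..<k}" "f = (\<lambda>x\<in>S. g (orbit \<pi> x))" by blast
      have "f x \<in> {..<k}" if "x \<in> S" for x
        unfolding g(2) using that PiE_mem[OF g(1), of "orbit \<pi> x"] by simp
      moreover have "f (\<pi> x) = f x" if "x \<in> S" for x
        unfolding g(2) using that permutes_in_image[OF \<pi>, of x] permutation_orbit_step[OF perm, of x] by simp
      moreover have "f x = undefined" if "x \<notin> S" for x using g(2) that by simp
      ultimately show "f \<in> {f \<in> S \<rightarrow>\<^sub>E {..<k}. \<forall>x\<in>S. f (\<pi> x) = f x}"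
        by (simp add: PiE_iff extensional_def)
    next
      fix f assume "f \<in> {f \<in> S \<rightarrow>\<^sub>E {..<k}. \<forall>x\<in>S. f (\<pi> x) = f x}"
      then have f: "f \<in> S \<rightarrow>\<^sub>E {..<k}" and const: "\<And>x. x \<in> S \<Longrightarrow> f (\<pi> x) = f x" by auto
      have orb: "f y = f x" if "x \<in> S" "y \<in> orbit \<pi> x" for x y
        using that(2)
      proof (induction rule: orbit.induct)
        case (step y)
        have "y \<in> S" using step.hyps permutes_orbit_subset[OF \<pi> that(1)] by blast
        then show ?case using const step.IH by simp
      qed (use const that in simp)
      define g where "g = (\<lambda>X\<in>?O. f (SOME x. x \<in> S \<and> orbit \<pi> x = X))"
      have g: "g (orbit \<pi> x) = f x" if x: "x \<in> S" for x
      proof -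
        define y where "y = (SOME y. y \<in> S \<and> orbit \<pi> y = orbit \<pi> x)"
        have y: "y \<in> S \<and> orbit \<pi> y = orbit \<pi> x" unfolding y_def using x by (intro someI) auto
        then have "y \<in> orbit \<pi> x" using permutation_self_in_orbit[OF perm, of y] by simp
        then have "f y = f x" using orb x by blast
        then show ?thesis unfolding g_def using x by (simp flip: y_def)
      qed
      have "g \<in> ?O \<rightarrow>\<^sub>E {..<k}"
      proof (rule PiE_I)
        fix X assume "X \<in> ?O"
        then obtain x where "x \<in> S" "X = orbit \<pi> x" by blast
        then show "g X \<in> {..<k}" using g[of x] PiE_mem[OF f, of x] by simp
      qed (simp add: g_def)
      moreover have "f = (\<lambda>x\<in>S. g (orbit \<pi> x))"
        using g f by (auto simp: fun_eq_iff PiE_iff extensional_def restrict_def)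
      ultimately show "f \<in> (\<lambda>g. \<lambda>x\<in>S. g (orbit \<pi> x)) ` (?O \<rightarrow>\<^sub>E {..<k})" by blast
    qed
  qed
  then have "card (colourings S p \<iota> k) = card (?O \<rightarrow>\<^sub>E {..<k})" by (simp add: bij_betw_same_card)
  also have "\<dots> = k ^ card ?O" using S(1) by (simp add: card_funcsetE)
  finally show ?thesis by (simp add: num_cycles_def \<pi>_def)
qed

section \<open>Invariance under relabelling\<close>

lemma bij_betw_fpf_involutions_conj:
  fixes g :: "'a \<Rightarrow> 'a"
  assumes g: "bij g"
  shows "bij_betw (\<lambda>\<iota>. g \<circ> \<iota> \<circ> inv' g) (fpf_involutions S) (fpf_involutions (g ` S))"
proof -
  have *: "h \<circ> \<iota> \<circ> inv' h \<in> fpf_involutions (h ` T)" if "\<iota> \<in> fpf_involutions T" "bij h" for h :: "'a \<Rightarrow> 'a" and \<iota> T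
  proof -
    note D = fpf_involutionsD[OF that(1)]
    have hh: "inv' h (h x) = x" "h (inv' h x) = x" for x
      using that(2) by (simp_all add: bij_is_inj bij_is_surj surj_f_inv_f)
    have "bij \<iota>" using D(1) by (rule permutes_bij)
    then have "bij (h \<circ> \<iota> \<circ> inv' h)" using that(2) by (intro bij_comp bij_imp_bij_inv)
    moreover have "(h \<circ> \<iota> \<circ> inv' h) y = y" if y: "y \<notin> h ` T" for y
    proof -
      have "inv' h y \<notin> T" using y hh(2)[of y] by (metis imageI)
      then show ?thesis using D(1) hh by (simp add: permutes_not_in)
    qed
    ultimately have "h \<circ> \<iota> \<circ> inv' h permutes h ` T" by (auto simp: permutes_def bij_iff)
    then show ?thesis using D(2,3) hh by (auto simp: fpf_involutions_def) (metis hh(1))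
  qed
  have gg: "inv' g \<circ> g = id" "g \<circ> inv' g = id" using g by (auto simp: bij_def surj_iff)
  have gS: "inv' g ` g ` S = S" using g by (simp add: image_comp gg(1))
  have conj_inv: "inv' g \<circ> \<iota> \<circ> g \<in> fpf_involutions S" if "\<iota> \<in> fpf_involutions (g ` S)" for \<iota>
    using *[OF that bij_imp_bij_inv[OF g]] gS inv_inv_eq[OF g] by simp
  show ?thesis
  proof (rule bij_betwI[where g = "\<lambda>\<iota>. inv' g \<circ> \<iota> \<circ> g"])
    show "(inv' g \<circ> (g \<circ> \<iota> \<circ> inv' g) \<circ> g) = \<iota>" for \<iota>
      by (simp add: o_assoc gg) (simp add: comp_assoc gg)
    show "(g \<circ> (inv' g \<circ> \<iota> \<circ> g) \<circ> inv' g) = \<iota>" for \<iota>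
      by (simp add: o_assoc gg) (simp add: comp_assoc gg)
  qed (use * g conj_inv in auto)
qed

lemma card_colourings_conj:
  fixes g :: "'a \<Rightarrow> 'a"
  assumes g: "bij g"
  shows "card (colourings (g ` S) (g \<circ> p \<circ> inv' g) (g \<circ> \<iota> \<circ> inv' g) k) = card (colourings S p \<iota> k)"
proof (rule bij_betw_same_card[symmetric], rule bij_betwI[where g = "\<lambda>f. f \<circ> g"])
  have gg: "inv' g (g x) = x" "g (inv' g x) = x" for x
    using g by (simp_all add: bij_is_inj bij_is_surj surj_f_inv_f)
  have mem: "inv' g y \<in> S \<longleftrightarrow> y \<in> g ` S" "g x \<in> g ` S \<longleftrightarrow> x \<in> S" for x y
    using gg by (metis imageE imageI)+
  show "(\<lambda>f. f \<circ> inv' g) \<in> colourings S p \<iota> k \<rightarrow> colourings (g ` S) (g \<circ> p \<circ> inv' g) (g \<circ> \<iota> \<circ> inv' g) k"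
    using gg mem by (auto simp: colourings_def PiE_iff extensional_def)
  show "(\<lambda>f. f \<circ> g) \<in> colourings (g ` S) (g \<circ> p \<circ> inv' g) (g \<circ> \<iota> \<circ> inv' g) k \<rightarrow> colourings S p \<iota> k"
    using gg mem by (auto simp: colourings_def PiE_iff extensional_def)
qed (use g in \<open>simp_all add: comp_def bij_is_inj bij_is_surj surj_f_inv_f\<close>)

lemma gluing_sum_conj:
  fixes g :: "'a \<Rightarrow> 'a"
  assumes "bij g"
  shows "gluing_sum (g ` S) (g \<circ> p \<circ> inv' g) k = gluing_sum S p k"
  unfolding gluing_sum_def
  using sum.reindex_bij_betw[OF bij_betw_fpf_involutions_conj[OF assms],
      of "\<lambda>\<iota>. real (card (colourings (g ` S) (g \<circ> p \<circ> inv' g) \<iota> k))" S]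
  by (simp add: card_colourings_conj[OF assms])

text \<open>The map between the lists is extended to a bijection of the whole type, one
  transposition per entry, so that permutations as total functions can be conjugated by it.\<close>

lemma ex_bij_map_list:
  fixes xs ys :: "'a list"
  assumes "distinct xs" "distinct ys" "length xs = length ys"
  shows "\<exists>g. bij g \<and> map g xs = ys"
  using assms(3,1,2)
proof (induction xs ys rule: list_induct2)
  case Nil
  show ?case by (intro exI[of _ id] conjI bij_id) simp
next
  case (Cons x xs y ys)
  have "distinct xs" "distinct ys" using Cons.prems by simp_all
  from Cons.IH[OF this] obtain g where g: "bij g" "map g xs = ys" by (elim exE conjE)
  let ?g = "transpose (g x) y \<circ> g"
  have eq: "?g z = g z" if "z \<in> set xs" for z
  proof -
    have "z \<noteq> x" using that Cons.prems(1) by auto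
    then have "g z \<noteq> g x" using inj_eq[OF bij_is_inj[OF g(1)]] by simp
    moreover have "g z \<in> set ys" unfolding g(2)[symmetric] using that by simp
    then have "g z \<noteq> y" using Cons.prems(2) by auto
    ultimately show ?thesis by simp
  qed
  have "map ?g xs = map g xs" by (rule map_cong[OF refl]) (rule eq)
  then have "map ?g xs = ys" unfolding g(2) .
  moreover have "?g x = y" by simp
  ultimately have "map ?g (x # xs) = y # ys" by (simp only: list.map)
  moreover have "bij ?g"
    by (rule bij_comp[OF g(1) permutes_bij[OF permutes_swap_id[OF UNIV_I UNIV_I]]])
  ultimately show ?case by (intro exI[of _ ?g] conjI)
qed

text \<open>Conjugation carries cycles to cycles, so only the face lengths matter. The case of empty
  second lists covers one face.\<close>

lemma gluing_sum_cycles_cong: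
  fixes xs ys xs' ys' :: "'a list"
  assumes "distinct (xs @ ys)" "distinct (xs' @ ys')" "length xs = length xs'" "length ys = length ys'"
  shows "gluing_sum (set xs \<union> set ys) (cycle_of_list xs \<circ> cycle_of_list ys) k =
    gluing_sum (set xs' \<union> set ys') (cycle_of_list xs' \<circ> cycle_of_list ys') k"
proof -
  obtain g where g: "bij g" "map g (xs @ ys) = xs' @ ys'"
    using ex_bij_map_list[of "xs @ ys" "xs' @ ys'"] assms by auto
  then have m: "map g xs = xs'" "map g ys = ys'" using assms(3) by (auto simp: append_eq_append_conv)
  have gg: "inv' g \<circ> g = id" using g by (auto simp: bij_def)
  have "g \<circ> (cycle_of_list xs \<circ> cycle_of_list ys) \<circ> inv' g
      = (g \<circ> cycle_of_list xs \<circ> inv' g) \<circ> (g \<circ> cycle_of_list ys \<circ> inv' g)"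
    using gg by (simp add: fun_eq_iff)
  also have "\<dots> = cycle_of_list xs' \<circ> cycle_of_list ys'"
    using conjugation_of_cycle[OF _ g(1), of xs] conjugation_of_cycle[OF _ g(1), of ys] assms(1) m by simp
  finally have "g \<circ> (cycle_of_list xs \<circ> cycle_of_list ys) \<circ> inv' g = cycle_of_list xs' \<circ> cycle_of_list ys'" .
  moreover have "g ` (set xs \<union> set ys) = set xs' \<union> set ys'" using m by auto
  ultimately show ?thesis using gluing_sum_conj[OF g(1), of "set xs \<union> set ys" _ k] by metis
qed

lemma cyclic_on_imp_cycle_of_list:
  assumes "finite S" "c permutes S" "cyclic_on c S"
  obtains cs where "distinct cs" "set cs = S" "c = cycle_of_list cs"
proof -
  obtain a where a: "a \<in> S" "S = orbit c a" using assms(3) by (auto simp: cyclic_on_def)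
  have perm: "permutation c" using assms permutes_imp_permutation by blast
  let ?cs = "support c a"
  have set: "set ?cs = S"
    using support_set[OF perm, of a] orbit_altdef_permutation[OF perm, of a] a(2) by auto
  have "c = cycle_of_list ?cs"
  proof
    fix y show "c y = cycle_of_list ?cs y"
    proof (cases "y \<in> S")
      case True
      then show ?thesis using cycle_restrict[OF perm, of y a] set by simp
    next
      case False
      then show ?thesis using assms(2) set by (simp add: permutes_not_in id_outside_supp)
    qed
  qed
  with cycle_of_permutation[OF perm, of a] set show ?thesis by (rule that)
qed

lemma card_fpf_involutions:
  assumes "finite S" "card S = 2 * n"
  shows "card (fpf_involutions S) = (\<Prod>i<n. 2 * i + 1)"
  using assms
proof (induction n arbitrary: S)
  case 0
  then show ?case by (simp add: fpf_involutions_empty)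
next
  case (Suc n)
  then obtain a where a: "a \<in> S" by fastforce
  have "card (fpf_involutions S) = (\<Sum>b\<in>S - {a}. card (fpf_involutions (S - {a, b})))"
    using sum_fpf_involutions[OF Suc(2) a, of "\<lambda>_. 1 :: nat"] by simp
  also have "\<dots> = (\<Sum>b\<in>S - {a}. \<Prod>i<n. 2 * i + 1)"
  proof (intro sum.cong refl Suc.IH)
    fix b assume b: "b \<in> S - {a}"
    then have "card {a, b} = 2" by (auto simp: card_2_iff)
    then show "card (S - {a, b}) = 2 * n" using Suc.prems a b by (simp add: card_Diff_subset)
  qed (use Suc.prems in simp)
  also have "\<dots> = (2 * n + 1) * (\<Prod>i<n. 2 * i + 1)" using Suc.prems a by simp
  finally show ?case by (simp add: mult.commute)
qed

section \<open>One-face sums by double counting\<close>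

text \<open>\<open>m\<close> counts sides, so \<open>n\<close> edges correspond to
  \<open>one_face_sum (2 * n)\<close>.\<close>

definition one_face_sum :: "nat \<Rightarrow> nat \<Rightarrow> real" where
  "one_face_sum m k = gluing_sum {1..m} (cycle_of_list [1..<m + 1]) k"

lemma one_face_sum_eq:
  fixes cs :: "nat list"
  assumes "distinct cs"
  shows "gluing_sum (set cs) (cycle_of_list cs) k = one_face_sum (length cs) k"
proof -
  have "set [1..<length cs + 1] = {1..length cs}"
    by (simp add: atLeastLessThanSuc_atLeastAtMost del: upt_Suc)
  then show ?thesis
    using gluing_sum_cycles_cong[of cs "[]" "[1..<length cs + 1]" "[]" k] assms
    by (simp add: one_face_sum_def del: upt_Suc)
qed

lemma one_face_sum_odd: "odd m \<Longrightarrow> one_face_sum m k = 0"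
  using sign_fpf_involution[of "{1..m}"] by (force simp: one_face_sum_def gluing_sum_def intro: sum.neutral)

text \<open>At \<open>k = 1\<close> every falling factorial with \<open>p > 0\<close> contains the
  factor 0. Since each permutation has one colouring with a single colour, the value is the number
  of full cycles.\<close>

lemma hz_sum_at_1: "hz_sum q 1 = fact (2 * q + 1)"
proof -
  have "hz_term q 1 p = 0" if "p \<noteq> 0" for p
  proof -
    have "ffall 1 (2 * p) = 0"
      unfolding ffall_def using that by (intro prod_zero) (auto intro!: bexI[of _ 1])
    then show ?thesis by (simp add: hz_term_def)
  qed
  then have "hz_sum q 1 = (\<Sum>p\<in>{0}. hz_term q 1 p)"
    unfolding hz_sum_def by (intro sum.mono_neutral_right) auto
  also have "\<dots> = pochhammer 2 (2 * q)" by (simp add: hz_term_def ffall_def)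
  also have "\<dots> = fact (2 * q + 1)"
    using pochhammer_rec[of "1 :: real" "2 * q"] pochhammer_fact[of "2 * q + 1", where 'a = real] by simp
  finally show ?thesis .
qed

text \<open>Double count over pairs of a full cycle and an involution: all row sums equal
  \<open>hz_sum\<close>, and by relabelling all column sums equal the one-face sum.\<close>

lemma one_face_sum_hz:
  "fact (2 * q + 1) * one_face_sum (2 * Suc q) k = (\<Prod>i<Suc q. 2 * real i + 1) * hz_sum q (real k)"
proof -
  define S where "S = {1..2 * Suc q}"
  define C where "C = {c. c permutes S \<and> cyclic_on c S}"
  have S: "finite S" "card S = 2 * Suc q" by (auto simp: S_def)
  have fin: "finite C" unfolding C_def by (rule finite_subset[OF _ finite_permutations[OF S(1)]]) auto
  have cardI: "real (card (fpf_involutions S)) = (\<Prod>i<Suc q. 2 * real i + 1)"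
    unfolding card_fpf_involutions[OF S]
    by (simp only: of_nat_prod of_nat_add of_nat_mult of_nat_numeral of_nat_1)
  have row: "(\<Sum>c\<in>C. real (card (colourings S c \<iota> j))) = hz_sum q (real j)" if "\<iota> \<in> fpf_involutions S" for \<iota> j
    unfolding C_def by (rule full_cycle_colourings[OF S(1) that S(2)])
  have col: "gluing_sum S c j = one_face_sum (2 * Suc q) j" if c: "c \<in> C" for c j
  proof -
    obtain cs where cs: "distinct cs" "set cs = S" "c = cycle_of_list cs"
      by (rule cyclic_on_imp_cycle_of_list[OF S(1), of c]) (use c in \<open>simp_all add: C_def\<close>)
    have "length cs = 2 * Suc q" using distinct_card[OF cs(1)] unfolding cs(2) S(2) by simp
    then show ?thesis using one_face_sum_eq[OF cs(1), of j] unfolding cs(2) cs(3) by metis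
  qed
  have double: "real (card C) * one_face_sum (2 * Suc q) j = real (card (fpf_involutions S)) * hz_sum q (real j)" for j
  proof -
    have "real (card C) * one_face_sum (2 * Suc q) j = (\<Sum>c\<in>C. gluing_sum S c j)" using col by simp
    also have "\<dots> = (\<Sum>\<iota>\<in>fpf_involutions S. \<Sum>c\<in>C. real (card (colourings S c \<iota> j)))"
      unfolding gluing_sum_def by (rule sum.swap)
    also have "\<dots> = real (card (fpf_involutions S)) * hz_sum q (real j)" using row by simp
    finally show ?thesis .
  qed
  \<comment> \<open>The number of full cycles is not counted directly: the same double count at
    \<open>k = 1\<close>, where every gluing has weight 1, yields it.\<close>
  have "one_face_sum (2 * Suc q) 1 = real (card (fpf_involutions S))"
  proof -
    let ?c = "cycle_of_list [1..<2 * Suc q + 1]"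
    have "set [1..<2 * Suc q + 1] = S" by (simp add: S_def atLeastLessThanSuc_atLeastAtMost del: upt_Suc)
    then have "?c permutes S" using cycle_permutes[of "[1..<2 * Suc q + 1]"] by metis
    then have "card (colourings S ?c \<iota> 1) = 1" if "\<iota> \<in> fpf_involutions S" for \<iota>
      using card_colourings[OF S(1) _ that, of ?c 1] by simp
    then show ?thesis unfolding one_face_sum_def gluing_sum_def S_def[symmetric] by (simp del: upt_Suc)
  qed
  moreover have "real (card (fpf_involutions S)) \<noteq> 0"
  proof -
    have "(\<Prod>i<Suc q. 2 * real i + 1) > 0" by (intro prod_pos) auto
    then show ?thesis unfolding cardI by linarith
  qed
  ultimately have "real (card C) = fact (2 * q + 1)"
    using double[of 1] by (simp add: hz_sum_at_1)
  then show ?thesis using double[of k] unfolding cardI by metis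
qed

section \<open>Root edge deletion and disconnected gluings\<close>

text \<open>The conditions at \<open>a\<close> and \<open>b\<close> read
  \<open>f (c a) = f b\<close> and \<open>f (c b) = f a\<close>. They determine the colours of
  \<open>a\<close> and \<open>b\<close> from the rest, unless \<open>c a = b\<close> or
  \<open>c b = a\<close>: then one condition is void, and a vertex of its own disappears with the
  edge, which gives the factor \<open>k\<close>.\<close>

lemma card_colourings_remove_pair:
  assumes S: "finite S" "c permutes S" "a \<in> S" "b \<in> S" "a \<noteq> b" and \<iota>: "\<iota> \<in> fpf_involutions (S - {a, b})"
    and c: "c a \<noteq> a" "c b \<noteq> b" "\<not> (c a = b \<and> c b = a)"
    and \<tau>: "\<And>x. x \<in> S - {a, b} \<Longrightarrow> \<tau> x = (if c x = a then c b else if c x = b then c a else c x)"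
  shows "card (colourings S c (transpose a b \<circ> \<iota>) k) =
    (if c a = b \<or> c b = a then k else 1) * card (colourings (S - {a, b}) \<tau> \<iota> k)"
proof -
  note D = fpf_involutionsD[OF \<iota>]
  let ?S = "S - {a, b}" and ?K = "{..<k}"
  have fin: "finite (S \<rightarrow>\<^sub>E ?K)" "finite (?S \<rightarrow>\<^sub>E ?K)" using S by (auto intro: finite_PiE)
  have Seq: "S = insert a (insert b ?S)" using S by auto
  have inj: "c x = c y \<longleftrightarrow> x = y" for x y using permutes_inj[OF S(2)] by (auto dest: injD)
  have cS: "c x \<in> S \<longleftrightarrow> x \<in> S" for x using permutes_in_image[OF S(2)] .
  have \<iota>ab: "\<iota> a = a" "\<iota> b = b" using D(1) by (auto intro: permutes_not_in)
  define P where "P f \<longleftrightarrow> (\<forall>x\<in>S. f (c x) = f ((transpose a b \<circ> \<iota>) x))" for f :: "'a \<Rightarrow> nat"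
  define P' where "P' g \<longleftrightarrow> (\<forall>x\<in>?S. g (\<tau> x) = g (\<iota> x))" for g :: "'a \<Rightarrow> nat"
  have card: "card {f \<in> F. R f} = (\<Sum>f\<in>F. of_bool (R f))" if "finite F" for F and R :: "('a \<Rightarrow> nat) \<Rightarrow> bool"
  proof -
    have "F \<inter> {f. R f} = {f \<in> F. R f}" by auto
    then show ?thesis using that by (simp add: of_bool_def sum.If_cases)
  qed
  have split: "P (g(b := v, a := u)) \<longleftrightarrow> (c a = b \<or> v = g (c a)) \<and> (c b = a \<or> u = g (c b)) \<and> P' g" for g u v
  proof -
    let ?f = "g(b := v, a := u)"
    have f: "?f a = u" "?f b = v" "\<And>x. x \<in> ?S \<Longrightarrow> ?f x = g x" using S(5) by auto
    have fa: "?f (c a) = v \<longleftrightarrow> c a = b \<or> v = g (c a)" using c(1) S(5) by auto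
    have fb: "?f (c b) = u \<longleftrightarrow> c b = a \<or> u = g (c b)" using c(2) S(5) by auto
    \<comment> \<open>An arrow into \<open>a\<close> carries the colour of \<open>c b\<close>, an
      arrow into \<open>b\<close> that of \<open>c a\<close>; this is the bypass
      \<open>\<tau>\<close>.\<close>
    have fx: "?f (c x) = g (\<tau> x)" if x: "x \<in> ?S" and va: "?f (c a) = v" and ub: "?f (c b) = u" for x
    proof -
      consider "c x = a" | "c x = b" | "c x \<noteq> a" "c x \<noteq> b" by blast
      then show ?thesis
      proof cases
        case 1
        then have "c b \<noteq> a" using x inj[of x b] by auto
        then show ?thesis using 1 ub fb \<tau>[OF x] S(5) by auto
      next
        case 2
        then have "c a \<noteq> b" using x inj[of x a] by auto
        then show ?thesis using 2 va fa \<tau>[OF x] S(5) by auto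
      next
        case 3
        then show ?thesis using \<tau>[OF x] by simp
      qed
    qed
    have "(\<forall>x\<in>?S. ?f (c x) = ?f ((transpose a b \<circ> \<iota>) x)) \<longleftrightarrow> (\<forall>x\<in>?S. ?f (c x) = g (\<iota> x))"
    proof (rule ball_cong[OF refl])
      fix x assume "x \<in> ?S"
      then have "\<iota> x \<in> ?S" using D(4) by blast
      then have "(transpose a b \<circ> \<iota>) x = \<iota> x" "?f (\<iota> x) = g (\<iota> x)" by auto
      then show "?f (c x) = ?f ((transpose a b \<circ> \<iota>) x) \<longleftrightarrow> ?f (c x) = g (\<iota> x)" by simp
    qed
    moreover have "(transpose a b \<circ> \<iota>) a = b" "(transpose a b \<circ> \<iota>) b = a" using \<iota>ab by auto
    ultimately have "P ?f \<longleftrightarrow> ?f (c a) = v \<and> ?f (c b) = u \<and> (\<forall>x\<in>?S. ?f (c x) = g (\<iota> x))"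
      unfolding P_def by (subst Seq) (simp only: ball_simps f)
    also have "\<dots> \<longleftrightarrow> ?f (c a) = v \<and> ?f (c b) = u \<and> P' g"
      unfolding P'_def using fx by metis
    finally show ?thesis unfolding fa fb .
  qed
  have "card (colourings S c (transpose a b \<circ> \<iota>) k) = (\<Sum>f\<in>S \<rightarrow>\<^sub>E ?K. of_bool (P f))"
    unfolding colourings_def P_def by (rule card[OF fin(1)])
  also have "\<dots> = (\<Sum>f\<in>insert a (insert b ?S) \<rightarrow>\<^sub>E ?K. of_bool (P f))" using Seq by simp
  also have "\<dots> = (\<Sum>g\<in>?S \<rightarrow>\<^sub>E ?K. \<Sum>v\<in>?K. \<Sum>u\<in>?K. of_bool (P (g(b := v, a := u))))"
    using S(5) by (simp add: sum_PiE_insert)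
  also have "\<dots> = (\<Sum>g\<in>?S \<rightarrow>\<^sub>E ?K. (if c a = b \<or> c b = a then k else 1) * of_bool (P' g))"
  proof (intro sum.cong refl)
    fix g assume g: "g \<in> ?S \<rightarrow>\<^sub>E ?K"
    have one: "(\<Sum>v\<in>?K. of_bool (B \<or> v = g y)) = (if B then k else (1 :: nat))" if "\<not> B \<Longrightarrow> y \<in> ?S" for y B
    proof (cases B)
      case False
      then have "g y < k" using that g by auto
      then show ?thesis using False by (simp add: of_bool_def)
    qed simp
    have "(\<Sum>v\<in>?K. \<Sum>u\<in>?K. of_bool (P (g(b := v, a := u)))) =
       (\<Sum>v\<in>?K. of_bool (c a = b \<or> v = g (c a))) * (\<Sum>u\<in>?K. of_bool (c b = a \<or> u = g (c b))) * (of_bool (P' g) :: nat)"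
      unfolding split by (simp only: of_bool_conj sum_distrib_left[symmetric] sum_distrib_right[symmetric] mult.assoc)
    also have "\<dots> = (if c a = b then k else 1) * (if c b = a then k else 1) * of_bool (P' g)"
      using S(3,4) c cS by (subst one, force, subst one, force) simp
    also have "\<dots> = (if c a = b \<or> c b = a then k else 1) * of_bool (P' g)" using c(3) by auto
    finally show "(\<Sum>v\<in>?K. \<Sum>u\<in>?K. of_bool (P (g(b := v, a := u)))) = \<dots>" .
  qed
  also have "\<dots> = (if c a = b \<or> c b = a then k else 1) * card (colourings ?S \<tau> \<iota> k)"
    unfolding colourings_def P'_def card[OF fin(2)] by (simp only: sum_distrib_left)
  finally show ?thesis .
qed

lemma map_cycle_of_list:
  assumes "distinct xs"
  shows "map (cycle_of_list xs) xs = rotate1 xs"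
  using cyclic_rotation[OF assms, of 1] by simp

text \<open>Deleting two corners and joining the loose ends crosswise splits a cycle into the two
  arcs between them. \<open>hd (xs @ [b])\<close> also covers an empty arc.\<close>

lemma cycle_of_list_remove_pair:
  fixes xs ys :: "'a list"
  assumes d: "distinct (a # xs @ b # ys)"
  defines "c \<equiv> cycle_of_list (a # xs @ b # ys)"
  shows "c a = hd (xs @ [b])" "c b = hd (ys @ [a])"
    "x \<in> set xs \<union> set ys \<Longrightarrow>
      (cycle_of_list xs \<circ> cycle_of_list ys) x = (if c x = a then c b else if c x = b then c a else c x)"
proof -
  have "map c ((a # xs) @ (b # ys)) = rotate1 (a # xs @ b # ys)"
    unfolding c_def using map_cycle_of_list[OF d] by simp
  also have "\<dots> = (xs @ [b]) @ (ys @ [a])" by simp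
  finally have "map c (a # xs) @ map c (b # ys) = (xs @ [b]) @ (ys @ [a])" unfolding map_append .
  moreover have "length (map c (a # xs)) = length (xs @ [b])" by simp
  ultimately have m: "map c (a # xs) = xs @ [b]" "map c (b # ys) = ys @ [a]"
    using append_eq_append_conv by blast+
  show ca: "c a = hd (xs @ [b])" by (simp flip: m(1))
  show cb: "c b = hd (ys @ [a])" by (simp flip: m(2))
  \<comment> \<open>\<open>h\<close> forwards an arrow that arrives at a deleted point: from
    \<open>a\<close> to the start of the arc after \<open>b\<close>, from \<open>b\<close> to the
    start of the arc after \<open>a\<close>.\<close>
  define h where "h y = (if y = a then c b else if y = b then c a else y)" for y
  have h: "map h zs = zs" if "a \<notin> set zs" "b \<notin> set zs" for zs
    using that by (intro map_idI) (auto simp: h_def)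
  have X: "map (h \<circ> c) xs = map (cycle_of_list xs) xs"
  proof (cases xs)
    case Nil
    then show ?thesis by simp
  next
    case (Cons z zs)
    have "map c xs = zs @ [b]" using m(1) Cons by simp
    then have "map h (map c xs) = map h zs @ [c a]" using d by (simp add: h_def)
    also have "map h zs = zs" using d Cons by (intro h) auto
    also have "zs @ [c a] = rotate1 xs" using ca Cons by simp
    finally show ?thesis using map_cycle_of_list[of xs] d by simp
  qed
  have Y: "map (h \<circ> c) ys = map (cycle_of_list ys) ys"
  proof (cases ys)
    case Nil
    then show ?thesis by simp
  next
    case (Cons z zs)
    have "map c ys = zs @ [a]" using m(2) Cons by simp
    then have "map h (map c ys) = map h zs @ [c b]" by (simp add: h_def)
    also have "map h zs = zs" using d Cons by (intro h) auto
    also have "zs @ [c b] = rotate1 ys" using cb Cons by simp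
    finally show ?thesis using map_cycle_of_list[of ys] d by simp
  qed
  assume "x \<in> set xs \<union> set ys"
  then have "(cycle_of_list xs \<circ> cycle_of_list ys) x = h (c x)"
  proof
    assume x: "x \<in> set xs"
    then have "cycle_of_list ys x = x" using d by (intro id_outside_supp) auto
    moreover have "h (c x) = cycle_of_list xs x" using X x by simp
    ultimately show ?thesis by simp
  next
    assume x: "x \<in> set ys"
    have "cycle_of_list ys x \<in> set ys" using x permutes_in_image[OF cycle_permutes] by metis
    then have "cycle_of_list xs (cycle_of_list ys x) = cycle_of_list ys x" using d by (intro id_outside_supp) auto
    moreover have "h (c x) = cycle_of_list ys x" using Y x by simp
    ultimately show ?thesis by simp
  qed
  then show "(cycle_of_list xs \<circ> cycle_of_list ys) x = (if c x = a then c b else if c x = b then c a else c x)"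
    by (simp add: h_def)
qed

definition two_face_sum :: "nat \<Rightarrow> nat \<Rightarrow> nat \<Rightarrow> real" where
  "two_face_sum m1 m2 k = gluing_sum {1..m1 + m2} (face_perm m1 m2) k"

lemma two_face_sum_eq:
  fixes xs ys :: "nat list"
  assumes "distinct (xs @ ys)"
  shows "gluing_sum (set xs \<union> set ys) (cycle_of_list xs \<circ> cycle_of_list ys) k = two_face_sum (length xs) (length ys) k"
proof -
  let ?xs = "[1..<length xs + 1]" and ?ys = "[length xs + 1..<length xs + length ys + 1]"
  have "gluing_sum (set xs \<union> set ys) (cycle_of_list xs \<circ> cycle_of_list ys) k =
    gluing_sum (set ?xs \<union> set ?ys) (cycle_of_list ?xs \<circ> cycle_of_list ?ys) k"
    by (rule gluing_sum_cycles_cong[OF assms]) (auto simp del: upt_Suc)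
  moreover have "set ?xs \<union> set ?ys = {1..length xs + length ys}" by (auto simp del: upt_Suc)
  ultimately show ?thesis by (simp only: two_face_sum_def face_perm_def)
qed

lemma two_face_sum_0: "two_face_sum 0 m k = one_face_sum m k" "two_face_sum m 0 k = one_face_sum m k"
  by (simp_all add: two_face_sum_def one_face_sum_def face_perm_def del: upt_Suc)

text \<open>The gluings are sorted by the partner \<open>b\<close> of side 1. Deleting both sides
  leaves arcs of lengths \<open>b - 2\<close> and \<open>2 * N + 2 - b\<close>; for neighbouring
  sides one arc is empty and a vertex splits off, which accounts for the two terms with factor
  \<open>k\<close>.\<close>

lemma one_face_sum_loop:
  assumes "N \<ge> 1"
  shows "one_face_sum (2 * Suc N) k = 2 * real k * one_face_sum (2 * N) k + (\<Sum>m = 1..<2 * N. two_face_sum m (2 * N - m) k)"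
proof -
  let ?S = "{1..2 * N + 2}"
  let ?c = "cycle_of_list [1..<2 * N + 3]"
  have upt_b: "[1..<2 * N + 3] = 1 # [2..<b] @ b # [b + 1..<2 * N + 3]" if "b \<in> {2..2 * N + 2}" for b
  proof -
    have "1 < 2 * N + 3" by simp
    from upt_conv_Cons[OF this] have "[1..<2 * N + 3] = 1 # [2..<2 * N + 3]" by (simp only: Suc_1)
    also have "[2..<2 * N + 3] = [2..<b] @ [b..<2 * N + 3]"
      using upt_add_eq_append[of 2 b "2 * N + 3 - b"] that by simp
    also have "[b..<2 * N + 3] = b # [b + 1..<2 * N + 3]"
      using that by (subst upt_conv_Cons) auto
    finally show ?thesis .
  qed
  have S: "set [1..<2 * N + 3] = ?S" by auto
  have perm: "?c permutes ?S" using cycle_permutes[of "[1..<2 * N + 3]"] S by metis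
  have "one_face_sum (2 * Suc N) k = gluing_sum ?S ?c k"
    by (simp add: one_face_sum_def eval_nat_numeral del: upt_Suc)
  also have "\<dots> = (\<Sum>b\<in>?S - {1}. \<Sum>\<iota>\<in>fpf_involutions (?S - {1, b}). real (card (colourings ?S ?c (transpose 1 b \<circ> \<iota>) k)))"
    unfolding gluing_sum_def by (rule sum_fpf_involutions) auto
  also have "\<dots> = (\<Sum>b\<in>{2..2 * N + 2}. (if b = 2 \<or> b = 2 * N + 2 then real k else 1) * two_face_sum (b - 2) (2 * N + 2 - b) k)"
  proof (intro sum.cong)
    fix b assume b: "b \<in> {2..2 * N + 2}"
    let ?X = "[2..<b]" and ?Y = "[b + 1..<2 * N + 3]"
    note split = upt_b[OF b]
    have d: "distinct (1 # ?X @ b # ?Y)" unfolding split[symmetric] by (rule distinct_upt)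
    note R = cycle_of_list_remove_pair[OF d, folded split]
    have setXY: "set ?X \<union> set ?Y = ?S - {1, b}" using b by auto
    have ca: "?c 1 = (if b = 2 then b else 2)"
      using R(1) b by (auto simp: upt_conv_Cons simp del: upt_Suc)
    have cb: "?c b = (if b = 2 * N + 2 then 1 else b + 1)"
      using R(2) b by (auto simp: upt_conv_Cons simp del: upt_Suc)
    have "card (colourings ?S ?c (transpose 1 b \<circ> \<iota>) k) =
      (if ?c 1 = b \<or> ?c b = 1 then k else 1) * card (colourings (?S - {1, b}) (cycle_of_list ?X \<circ> cycle_of_list ?Y) \<iota> k)"
      if "\<iota> \<in> fpf_involutions (?S - {1, b})" for \<iota>
    proof (rule card_colourings_remove_pair[OF _ perm _ _ _ that])
      show "(cycle_of_list ?X \<circ> cycle_of_list ?Y) x = (if ?c x = 1 then ?c b else if ?c x = b then ?c 1 else ?c x)"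
        if "x \<in> ?S - {1, b}" for x
        by (rule R(3)) (use that setXY in simp)
      show "\<not> (?c 1 = b \<and> ?c b = 1)" unfolding ca cb using assms by auto
      show "?c 1 \<noteq> 1" "?c b \<noteq> b" unfolding ca cb using b by auto
    qed (use b in auto)
    moreover have "?c 1 = b \<or> ?c b = 1 \<longleftrightarrow> b = 2 \<or> b = 2 * N + 2" unfolding ca cb using b by auto
    ultimately have "(\<Sum>\<iota>\<in>fpf_involutions (?S - {1, b}). real (card (colourings ?S ?c (transpose 1 b \<circ> \<iota>) k))) =
       (if b = 2 \<or> b = 2 * N + 2 then real k else 1) * gluing_sum (?S - {1, b}) (cycle_of_list ?X \<circ> cycle_of_list ?Y) k"
      unfolding gluing_sum_def sum_distrib_left by (intro sum.cong refl) simp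
    also have "gluing_sum (?S - {1, b}) (cycle_of_list ?X \<circ> cycle_of_list ?Y) k = two_face_sum (length ?X) (length ?Y) k"
      unfolding setXY[symmetric] by (rule two_face_sum_eq) (use d in auto)
    also have "length ?X = b - 2" by (rule length_upt)
    also have "length ?Y = 2 * N + 2 - b" by (simp del: upt_Suc)
    finally show "(\<Sum>\<iota>\<in>fpf_involutions (?S - {1, b}). real (card (colourings ?S ?c (transpose 1 b \<circ> \<iota>) k))) =
       (if b = 2 \<or> b = 2 * N + 2 then real k else 1) * two_face_sum (b - 2) (2 * N + 2 - b) k" .
  qed auto
  also have "\<dots> = (\<Sum>m\<in>{0..2 * N}. (if m = 0 \<or> m = 2 * N then real k else 1) * two_face_sum m (2 * N - m) k)"
    by (rule sum.reindex_bij_witness[of _ "\<lambda>m. m + 2" "\<lambda>b. b - 2"]) (auto split: if_splits)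
  also have "{0..2 * N} = insert 0 (insert (2 * N) {1..<2 * N})" using assms by auto
  also have "(\<Sum>m\<in>\<dots>. (if m = 0 \<or> m = 2 * N then real k else 1) * two_face_sum m (2 * N - m) k) =
     2 * real k * one_face_sum (2 * N) k + (\<Sum>m = 1..<2 * N. two_face_sum m (2 * N - m) k)"
    using assms by (simp add: two_face_sum_0)
  finally show ?thesis .
qed

text \<open>An involution that preserves \<open>A\<close> preserves \<open>B\<close> too, so every
  cycle of the combined vertex permutation stays within one of them. Numbers of cycles add and the
  weights multiply.\<close>

lemma gluing_sum_disjoint_union:
  assumes fin: "finite A" "finite B" and AB: "A \<inter> B = {}" and p: "p permutes A" and q: "q permutes B"
  shows "(\<Sum>\<iota> | \<iota> \<in> fpf_involutions (A \<union> B) \<and> \<iota> ` A = A. real (card (colourings (A \<union> B) (p \<circ> q) \<iota> k)))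
    = gluing_sum A p k * gluing_sum B q k"
proof -
  have "gluing_sum A p k * gluing_sum B q k =
      (\<Sum>(\<iota>1, \<iota>2)\<in>fpf_involutions A \<times> fpf_involutions B. real (card (colourings A p \<iota>1 k)) * real (card (colourings B q \<iota>2 k)))"
    unfolding gluing_sum_def by (simp add: sum_product sum.cartesian_product)
  also have "\<dots> = (\<Sum>\<iota> | \<iota> \<in> fpf_involutions (A \<union> B) \<and> \<iota> ` A = A. real (card (colourings (A \<union> B) (p \<circ> q) \<iota> k)))"
  proof (rule sum.reindex_bij_witness[of _ "\<lambda>\<iota>. (restrict_id \<iota> A, restrict_id \<iota> B)" "\<lambda>(\<iota>1, \<iota>2). \<iota>1 \<circ> \<iota>2"])
    fix P assume "P \<in> fpf_involutions A \<times> fpf_involutions B"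
    then obtain i j where P: "P = (i, j)" and i: "i \<in> fpf_involutions A" and j: "j \<in> fpf_involutions B" by auto
    note Di = fpf_involutionsD[OF i] and Dj = fpf_involutionsD[OF j]
    have onA: "(i \<circ> j) x = i x" if "x \<in> A" for x
    proof -
      have "j x = x" using that AB by (intro permutes_not_in[OF Dj(1)]) auto
      then show ?thesis by simp
    qed
    have onB: "(i \<circ> j) x = j x" if "x \<in> B" for x
    proof -
      have "j x \<in> B" using that Dj(4) by blast
      then show ?thesis using AB by (simp, intro permutes_not_in[OF Di(1)]) auto
    qed
    have rA: "restrict_id (i \<circ> j) A = i" using onA Di(1) by (auto simp: restrict_id_def fun_eq_iff permutes_not_in)
    have rB: "restrict_id (i \<circ> j) B = j" using onB Dj(1) by (auto simp: restrict_id_def fun_eq_iff permutes_not_in)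
    show "(case case P of (i, j) \<Rightarrow> i \<circ> j of \<iota> \<Rightarrow> (restrict_id \<iota> A, restrict_id \<iota> B)) = P"
      using rA rB P by simp
    have "i permutes A \<union> B" "j permutes A \<union> B"
      by (rule permutes_subset[OF Di(1)], simp, rule permutes_subset[OF Dj(1)], simp)
    then have perm: "i \<circ> j permutes A \<union> B" by (intro permutes_compose)
    have "(i \<circ> j) ((i \<circ> j) x) = x \<and> (i \<circ> j) x \<noteq> x" if "x \<in> A \<union> B" for x
      using that
    proof
      assume x: "x \<in> A"
      then have "i x \<in> A" using Di(4) by blast
      then show ?thesis using onA[OF x] onA[of "i x"] Di(2,3) x by simp
    next
      assume x: "x \<in> B"
      then have "j x \<in> B" using Dj(4) by blast
      then show ?thesis using onB[OF x] onB[of "j x"] Dj(2,3) x by simp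
    qed
    then have inv: "i \<circ> j \<in> fpf_involutions (A \<union> B)" using perm unfolding fpf_involutions_def by blast
    moreover have "(i \<circ> j) ` A = i ` A" by (intro image_cong refl onA)
    then have "(i \<circ> j) ` A = A" unfolding permutes_image[OF Di(1)] .
    ultimately show "(case P of (i, j) \<Rightarrow> i \<circ> j) \<in> {\<iota> \<in> fpf_involutions (A \<union> B). \<iota> ` A = A}" using P by simp
    have "p permutes A \<union> B" "q permutes A \<union> B"
      by (rule permutes_subset[OF p], simp, rule permutes_subset[OF q], simp)
    then have pq: "p \<circ> q permutes A \<union> B" by (intro permutes_compose)
    let ?\<pi> = "(p \<circ> q) \<circ> (i \<circ> j)"
    have "?\<pi> x = (p \<circ> i) x" if "x \<in> A" for x
    proof -
      have "i x \<in> A" using that Di(4) by blast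
      then have "q (i x) = i x" using AB by (intro permutes_not_in[OF q]) auto
      then show ?thesis using onA[OF that] by simp
    qed
    then have oA: "orbit ?\<pi> x = orbit (p \<circ> i) x" if "x \<in> A" for x
      using that Di(4) permutes_in_image[OF p] by (intro orbit_cong0[of x A]) auto
    have "?\<pi> x = (q \<circ> j) x" if "x \<in> B" for x
    proof -
      have "q (j x) \<in> B" using that Dj(4) permutes_in_image[OF q] by blast
      then have "p (q (j x)) = q (j x)" using AB by (intro permutes_not_in[OF p]) auto
      then show ?thesis using onB[OF that] by simp
    qed
    then have oB: "orbit ?\<pi> x = orbit (q \<circ> j) x" if "x \<in> B" for x
      using that Dj(4) permutes_in_image[OF q] by (intro orbit_cong0[of x B]) auto
    have sub: "orbit (p \<circ> i) x \<subseteq> A" if "x \<in> A" for x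
      using that by (rule permutes_orbit_subset[OF permutes_compose[OF Di(1) p]])
    have sub': "orbit (q \<circ> j) x \<subseteq> B" if "x \<in> B" for x
      using that by (rule permutes_orbit_subset[OF permutes_compose[OF Dj(1) q]])
    have "orbit (p \<circ> i) ` A \<inter> orbit (q \<circ> j) ` B = {}"
    proof (rule ccontr)
      assume "orbit (p \<circ> i) ` A \<inter> orbit (q \<circ> j) ` B \<noteq> {}"
      then obtain x y where "x \<in> A" "y \<in> B" "orbit (p \<circ> i) x = orbit (q \<circ> j) y" by auto
      then have "orbit (p \<circ> i) x = {}" using sub[of x] sub'[of y] AB by blast
      then show False using orbit_nonempty by metis
    qed
    moreover have "orbit ?\<pi> ` (A \<union> B) = orbit (p \<circ> i) ` A \<union> orbit (q \<circ> j) ` B"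
        unfolding image_Un by (intro arg_cong2[where f = "(\<union>)"] image_cong refl oA oB)
    ultimately have "num_cycles (A \<union> B) ?\<pi> = num_cycles A (p \<circ> i) + num_cycles B (q \<circ> j)"
      unfolding num_cycles_def using fin by (simp add: card_Un_disjoint)
    then show "real (card (colourings (A \<union> B) (p \<circ> q) (case P of (i, j) \<Rightarrow> i \<circ> j) k)) =
       (case P of (\<iota>1, \<iota>2) \<Rightarrow> real (card (colourings A p \<iota>1 k)) * real (card (colourings B q \<iota>2 k)))"
      using card_colourings[OF fin(1) p i, of k] card_colourings[OF fin(2) q j, of k]
        card_colourings[OF _ pq inv, of k] fin P by (simp add: power_add)
  next
    fix \<iota> assume "\<iota> \<in> {\<iota> \<in> fpf_involutions (A \<union> B). \<iota> ` A = A}"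
    then have \<iota>: "\<iota> \<in> fpf_involutions (A \<union> B)" and A: "\<iota> ` A = A" by auto
    note D = fpf_involutionsD[OF \<iota>]
    have "\<iota> ` (A \<union> B - A) = A \<union> B - A"
      using A permutes_image[OF D(1)] by (simp only: image_set_diff[OF permutes_inj[OF D(1)]])
    moreover have "A \<union> B - A = B" using AB by auto
    ultimately have B: "\<iota> ` B = B" by simp
    show "(restrict_id \<iota> A, restrict_id \<iota> B) \<in> fpf_involutions A \<times> fpf_involutions B"
      using restrict_fpf_involution[OF \<iota> _ A] restrict_fpf_involution[OF \<iota> _ B] by simp
    show "(case (restrict_id \<iota> A, restrict_id \<iota> B) of (i, j) \<Rightarrow> i \<circ> j) = \<iota>"
    proof
      fix x
      have "\<iota> x \<in> B" if "x \<in> B" using B that by blast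
      then have "restrict_id \<iota> A (restrict_id \<iota> B x) = \<iota> x"
        using AB D(1) by (cases "x \<in> A"; cases "x \<in> B") (auto simp: permutes_not_in restrict_id_def)
      then show "(case (restrict_id \<iota> A, restrict_id \<iota> B) of (i, j) \<Rightarrow> i \<circ> j) x = \<iota> x" by simp
    qed
  qed
  finally show ?thesis by simp
qed

section \<open>The Harer-Zagier recurrence\<close>

lemma one_face_sum_2: "one_face_sum 2 k = (real k)\<^sup>2"
  using one_face_sum_hz[of 0 k] by (simp add: hz_sum_0 numeral_2_eq_2)

lemma one_face_sum_4: "one_face_sum 4 k = 2 * real k ^ 3 + real k"
  using one_face_sum_hz[of 1 k] by (simp add: hz_sum_1[simplified] eval_nat_numeral)

text \<open>\<open>hz_sum_recurrence\<close> after removal of the factorials and double factorials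
  of \<open>one_face_sum_hz\<close>. Its condition on the index translates to
  \<open>n \<ge> 3\<close>, and the excluded values of \<open>k\<close> leave
  \<open>k \<ge> 2\<close>.\<close>

lemma harer_zagier_recurrence:
  assumes n: "n \<ge> 3" and k: "k \<ge> 2"
  shows "(real n + 1) * one_face_sum (2 * n) k =
    2 * (2 * real n - 1) * real k * one_face_sum (2 * (n - 1)) k
    + (real n - 1) * (2 * real n - 1) * (2 * real n - 3) * one_face_sum (2 * (n - 2)) k"
proof -
  define q where "q = n - 3"
  have nq: "n = Suc (Suc (Suc q))" using n by (simp add: q_def)
  define d where "d = (\<Prod>i<Suc q. 2 * real i + 1)"
  define f where "f = (fact (2 * q + 1) :: real)"
  define x where "x = real q"
  have dpos: "d > 0" unfolding d_def by (intro prod_pos) auto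
  have f1: "fact (2 * Suc q + 1) = (2 * x + 3) * (2 * x + 2) * f"
    and f2: "fact (2 * Suc (Suc q) + 1) = (2 * x + 5) * (2 * x + 4) * (2 * x + 3) * (2 * x + 2) * f"
    by (simp_all add: f_def x_def algebra_simps)
  have d1: "(\<Prod>i<Suc (Suc q). 2 * real i + 1) = d * (2 * x + 3)"
    and d2: "(\<Prod>i<Suc (Suc (Suc q)). 2 * real i + 1) = d * (2 * x + 3) * (2 * x + 5)"
    by (simp_all add: d_def x_def algebra_simps)
  define A B C where "A = one_face_sum (2 * n) k" and "B = one_face_sum (2 * (n - 1)) k"
    and "C = one_face_sum (2 * (n - 2)) k"
  define a b c where "a = hz_sum (q + 2) (real k)" and "b = hz_sum (q + 1) (real k)" and "c = hz_sum q (real k)"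
  have xpos: "x \<ge> 0" by (simp add: x_def)
  have eA: "(2 * x + 4) * (2 * x + 2) * f * A = d * a"
  proof -
    have "(2 * x + 5) * (2 * x + 4) * (2 * x + 3) * (2 * x + 2) * f * A = d * (2 * x + 3) * (2 * x + 5) * a"
      using one_face_sum_hz[of "Suc (Suc q)" k] unfolding f2 d2 A_def nq a_def by simp
    then have "((2 * x + 5) * (2 * x + 3)) * ((2 * x + 4) * (2 * x + 2) * f * A) = ((2 * x + 5) * (2 * x + 3)) * (d * a)"
      by (simp only: mult_ac)
    moreover have "(2 * x + 5) * (2 * x + 3) \<noteq> 0" using xpos by simp
    ultimately show ?thesis by (metis mult_left_cancel)
  qed
  have eB: "(2 * x + 2) * f * B = d * b"
  proof -
    have "(2 * x + 3) * (2 * x + 2) * f * B = d * (2 * x + 3) * b"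
      using one_face_sum_hz[of "Suc q" k] unfolding f1 d1 B_def nq b_def by simp
    then have "(2 * x + 3) * ((2 * x + 2) * f * B) = (2 * x + 3) * (d * b)"
      by (simp only: mult_ac)
    moreover have "2 * x + 3 \<noteq> 0" using xpos by simp
    ultimately show ?thesis by (metis mult_left_cancel)
  qed
  have eC: "f * C = d * c"
    using one_face_sum_hz[of q k] unfolding C_def nq c_def f_def d_def by simp
  have rec: "(x + 4) * a = 2 * real k * (2 * x + 5) * (2 * x + 4) * b
     + (x + 2) * (2 * x + 5) * (2 * x + 4) * (2 * x + 3) * (2 * x + 2) * c"
    using hz_sum_recurrence[of "q + 1" "real k"] k
    by (simp add: a_def b_def c_def x_def algebra_simps)
  have "(2 * x + 4) * (2 * x + 2) * f * ((x + 4) * A) = (x + 4) * ((2 * x + 4) * (2 * x + 2) * f * A)"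
    by (simp only: mult_ac)
  also have "\<dots> = d * ((x + 4) * a)" unfolding eA by (simp only: mult_ac)
  also have "\<dots> = 2 * real k * (2 * x + 5) * (2 * x + 4) * (d * b)
     + (x + 2) * (2 * x + 5) * (2 * x + 4) * (2 * x + 3) * (2 * x + 2) * (d * c)"
    unfolding rec by (simp only: distrib_left mult_ac)
  also have "\<dots> = (2 * x + 4) * (2 * x + 2) * f *
      (2 * (2 * x + 5) * real k * B + (x + 2) * (2 * x + 5) * (2 * x + 3) * C)"
    unfolding eB[symmetric] eC[symmetric] by (simp only: distrib_left mult_ac)
  finally have "(2 * x + 4) * (2 * x + 2) * f * ((x + 4) * A) = \<dots>" .
  moreover have "(2 * x + 4) * (2 * x + 2) * f \<noteq> 0" using xpos by (simp add: f_def)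
  ultimately have "(x + 4) * A = 2 * (2 * x + 5) * real k * B + (x + 2) * (2 * x + 5) * (2 * x + 3) * C"
    by (metis mult_left_cancel)
  moreover have "real n = x + 3" by (simp add: nq x_def)
  ultimately show ?thesis unfolding A_def[symmetric] B_def[symmetric] C_def[symmetric]
    by (simp add: algebra_simps)
qed

section \<open>Connectedness\<close>

lemma cycle_of_list_funpow_reaches:
  assumes "distinct cs" "x \<in> set cs" "y \<in> set cs"
  shows "\<exists>n. (cycle_of_list cs ^^ n) x = y"
proof -
  let ?c = "cycle_of_list cs" and ?l = "length cs"
  obtain i j where i: "i < ?l" "x = cs ! i" and j: "j < ?l" "y = cs ! j"
    using assms(2,3) by (auto simp: in_set_conv_nth)
  have l: "?l > 0" using i(1) by linarith
  have nth: "(?c ^^ n) (cs ! i) = cs ! ((n + i) mod ?l)" for n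
    using arg_cong[OF cyclic_rotation[OF assms(1), of n], of "\<lambda>zs. zs ! i"] i(1)
    by (simp add: nth_rotate)
  have "(?l - i + j + i) mod ?l = j" using i j by simp
  then show ?thesis using nth[of "?l - i + j"] i j by auto
qed

lemma face_perm_permutes: "face_perm m1 m2 permutes {1..m1 + m2}"
proof -
  have "cycle_of_list [1..<m1 + 1] permutes {1..m1 + m2}"
    by (rule permutes_subset[OF cycle_permutes]) (auto simp del: upt_Suc)
  moreover have "cycle_of_list [m1 + 1..<m1 + m2 + 1] permutes {1..m1 + m2}"
    by (rule permutes_subset[OF cycle_permutes]) (auto simp del: upt_Suc)
  ultimately show ?thesis unfolding face_perm_def by (intro permutes_compose)
qed

lemma face_perm_apply:
  shows "x \<in> {1..m1} \<Longrightarrow> face_perm m1 m2 x = cycle_of_list [1..<m1 + 1] x \<and> face_perm m1 m2 x \<in> {1..m1}"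
    and "x \<in> {m1 + 1..m1 + m2} \<Longrightarrow>
      face_perm m1 m2 x = cycle_of_list [m1 + 1..<m1 + m2 + 1] x \<and> face_perm m1 m2 x \<in> {m1 + 1..m1 + m2}"
proof -
  let ?xs = "[1..<m1 + 1]" and ?ys = "[m1 + 1..<m1 + m2 + 1]"
  have sets: "set ?xs = {1..m1}" "set ?ys = {m1 + 1..m1 + m2}" by (auto simp del: upt_Suc)
  have in1: "cycle_of_list ?xs x \<in> {1..m1} \<longleftrightarrow> x \<in> {1..m1}" for x
    using permutes_in_image[OF cycle_permutes[of ?xs], of x] unfolding sets .
  have in2: "cycle_of_list ?ys x \<in> {m1 + 1..m1 + m2} \<longleftrightarrow> x \<in> {m1 + 1..m1 + m2}" for x
    using permutes_in_image[OF cycle_permutes[of ?ys], of x] unfolding sets .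
  {
    assume x: "x \<in> {1..m1}"
    then have "cycle_of_list ?ys x = x" by (intro id_outside_supp) (simp add: sets del: upt_Suc)
    then show "face_perm m1 m2 x = cycle_of_list ?xs x \<and> face_perm m1 m2 x \<in> {1..m1}"
      using in1[of x] x by (simp add: face_perm_def del: upt_Suc)
  next
    assume x: "x \<in> {m1 + 1..m1 + m2}"
    then have y: "cycle_of_list ?ys x \<in> {m1 + 1..m1 + m2}" using in2 by blast
    then have "cycle_of_list ?xs (cycle_of_list ?ys x) = cycle_of_list ?ys x"
      by (intro id_outside_supp) (simp add: sets del: upt_Suc)
    then show "face_perm m1 m2 x = cycle_of_list ?ys x \<and> face_perm m1 m2 x \<in> {m1 + 1..m1 + m2}"
      using y by (simp add: face_perm_def del: upt_Suc)
  }
qed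

lemma funpow_cong_on:
  assumes "x \<in> A" "\<And>y. y \<in> A \<Longrightarrow> f y = g y \<and> f y \<in> A"
  shows "(f ^^ n) x = (g ^^ n) x \<and> (f ^^ n) x \<in> A"
proof (induction n)
  case 0
  then show ?case using assms(1) by simp
next
  case (Suc n)
  then show ?case using assms(2)[of "(f ^^ n) x"] by auto
qed

lemma face_perm_reaches:
  assumes "x \<in> {1..m1} \<and> y \<in> {1..m1} \<or> x \<in> {m1 + 1..m1 + m2} \<and> y \<in> {m1 + 1..m1 + m2}"
  shows "\<exists>n. (face_perm m1 m2 ^^ n) x = y"
  using assms
proof
  let ?xs = "[1..<m1 + 1]"
  assume xy: "x \<in> {1..m1} \<and> y \<in> {1..m1}"
  then have "x \<in> set ?xs" "y \<in> set ?xs" by (auto simp del: upt_Suc)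
  then obtain n where "(cycle_of_list ?xs ^^ n) x = y"
    using cycle_of_list_funpow_reaches[of ?xs x y] distinct_upt by blast
  moreover have "(face_perm m1 m2 ^^ n) x = (cycle_of_list ?xs ^^ n) x"
    using funpow_cong_on[of x "{1..m1}" "face_perm m1 m2" "cycle_of_list ?xs" n] xy face_perm_apply(1) by blast
  ultimately show ?thesis by metis
next
  let ?ys = "[m1 + 1..<m1 + m2 + 1]"
  assume xy: "x \<in> {m1 + 1..m1 + m2} \<and> y \<in> {m1 + 1..m1 + m2}"
  then have "x \<in> set ?ys" "y \<in> set ?ys" by (auto simp del: upt_Suc)
  then obtain n where "(cycle_of_list ?ys ^^ n) x = y"
    using cycle_of_list_funpow_reaches[of ?ys x y] distinct_upt by blast
  moreover have "(face_perm m1 m2 ^^ n) x = (cycle_of_list ?ys ^^ n) x"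
    using funpow_cong_on[of x "{m1 + 1..m1 + m2}" "face_perm m1 m2" "cycle_of_list ?ys" n] xy face_perm_apply(2) by blast
  ultimately show ?thesis by metis
qed

text \<open>Powers of the face permutation act transitively on each of the two faces, so a single
  edge between the faces connects everything. Without one, every element of the generated group
  preserves the first face.\<close>

lemma gluing_connected_iff:
  assumes m: "1 \<le> m1" "1 \<le> m2" and \<iota>: "\<iota> \<in> fpf_involutions {1..m1 + m2}"
  shows "gluing_connected (m1, m2, \<iota>) \<longleftrightarrow> \<iota> ` {1..m1} \<noteq> {1..m1}"
proof -
  let ?G = "sym_group (m1 + m2)" and ?\<tau> = "face_perm m1 m2"
  let ?H = "generate ?G {\<iota>, ?\<tau>}"
  let ?A = "{1..m1}" and ?B = "{m1 + 1..m1 + m2}" and ?S = "{1..m1 + m2}"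
  note D = fpf_involutionsD[OF \<iota>]
  have carr: "\<iota> \<in> carrier ?G" "?\<tau> \<in> carrier ?G"
    using D(1) face_perm_permutes by (simp_all add: sym_group_carrier)
  show ?thesis
  proof
    assume con: "gluing_connected (m1, m2, \<iota>)"
    show "\<iota> ` ?A \<noteq> ?A"
    proof
      assume A: "\<iota> ` ?A = ?A"
      have \<tau>A: "?\<tau> ` ?A = ?A"
      proof (rule endo_inj_surj)
        show "?\<tau> ` ?A \<subseteq> ?A" using face_perm_apply(1) by blast
      qed (simp_all add: permutes_inj_on[OF face_perm_permutes])
      have "g ` ?A = ?A" if "g \<in> ?H" for g
        using that
      proof (induction rule: generate.induct)
        case one
        then show ?case by (simp add: sym_group_one)
      next
        case (incl h)
        then show ?case using A \<tau>A by auto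
      next
        case (inv h)
        then have h: "h \<in> carrier ?G" "h ` ?A = ?A" using carr A \<tau>A by auto
        have "inv' h ` (h ` ?A) = ?A"
          using h(1) permutes_inj unfolding sym_group_carrier by (metis image_inv_f_f)
        then show ?case using h by (simp add: sym_group_inv_equality[OF h(1)])
      next
        case (eng h1 h2)
        then show ?case by (simp only: sym_group_mult image_comp[symmetric])
      qed
      moreover have "\<exists>g\<in>?H. g 1 = m1 + 1"
      proof -
        have "\<forall>x\<in>?S. \<forall>y\<in>?S. \<exists>g\<in>?H. g x = y" using con by (simp add: gluing_connected_def)
        moreover have "1 \<in> ?S" "m1 + 1 \<in> ?S" using m by auto
        ultimately show ?thesis by blast
      qed
      moreover have "1 \<in> ?A" using m by simp
      ultimately have "m1 + 1 \<in> ?A" by (metis imageI)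
      then show False by simp
    qed
  next
    assume "\<iota> ` ?A \<noteq> ?A"
    moreover have "\<iota> ` ?A = ?A" if "\<iota> ` ?A \<subseteq> ?A"
      using that permutes_inj_on[OF D(1)] by (intro endo_inj_surj) auto
    ultimately obtain a where a: "a \<in> ?A" "\<iota> a \<notin> ?A" by blast
    have b: "\<iota> a \<in> ?B" using a D(4)[of a] by auto
    \<comment> \<open>Reachability under the group. Paths run inside one face, along the edge from
      \<open>a\<close> to \<open>\<iota> a\<close>, then inside the other face.\<close>
    define R where "R x y \<longleftrightarrow> (\<exists>g\<in>?H. g x = y)" for x y
    have trans: "R x z" if "R x y" "R y z" for x y z
    proof -
      obtain g h where "g \<in> ?H" "g x = y" "h \<in> ?H" "h y = z" using \<open>R x y\<close> \<open>R y z\<close> by (auto simp: R_def)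
      then have "h \<circ> g \<in> ?H" "(h \<circ> g) x = z"
        using generate.eng[of h ?G "{\<iota>, ?\<tau>}" g] by (auto simp: sym_group_mult)
      then show ?thesis unfolding R_def by blast
    qed
    have R\<iota>: "R x (\<iota> x)" for x unfolding R_def by (intro bexI[of _ \<iota>] generate.incl) auto
    have pow: "(?\<tau> ^^ n) \<in> ?H" for n
    proof (induction n)
      case 0
      then show ?case using generate.one[of ?G "{\<iota>, ?\<tau>}"] by (simp add: sym_group_one id_def)
    next
      case (Suc n)
      have "?\<tau> \<in> ?H" by (intro generate.incl) auto
      from generate.eng[OF this Suc] show ?case by (simp only: sym_group_mult funpow.simps)
    qed
    have same: "R x y" if "x \<in> ?A \<and> y \<in> ?A \<or> x \<in> ?B \<and> y \<in> ?B" for x y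
      using face_perm_reaches[OF that] pow unfolding R_def by blast
    have "R x y" if "x \<in> ?S" "y \<in> ?S" for x y
    proof -
      have AB: "x \<in> ?A \<or> x \<in> ?B" "y \<in> ?A \<or> y \<in> ?B" using that by auto
      have "R x y" if "x \<in> ?A" "y \<in> ?B"
        using trans[OF same[of x a] trans[OF R\<iota>[of a] same[of "\<iota> a" y]]] that a b by blast
      moreover have "R x y" if "x \<in> ?B" "y \<in> ?A"
        using trans[OF same[of x "\<iota> a"] trans[OF R\<iota>[of "\<iota> a"] same[of "\<iota> (\<iota> a)" y]]] that a b D(2)[of a]
        by simp
      ultimately show ?thesis using AB same[of x y] by blast
    qed
    then show "gluing_connected (m1, m2, \<iota>)"
      unfolding gluing_connected_def R_def by simp
  qed
qed

section \<open>Genus expansion\<close>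

definition cbin :: "nat \<Rightarrow> real" where
  "cbin n = real (2 * n choose n)"

text \<open>The Catalan numbers. This and the next two formulas are the numbers of one-face gluings
  with \<open>n\<close> edges of genus 0, 1 and 2, each a central binomial coefficient times a
  rational function; they are confirmed by the recurrence in \<open>coeff_hz_poly\<close>.\<close>

definition genus0 :: "nat \<Rightarrow> real" where
  "genus0 n = cbin n / (real n + 1)"

definition genus1 :: "nat \<Rightarrow> real" where
  "genus1 n = cbin n * (real n * (real n - 1)) / 12"

definition genus2 :: "nat \<Rightarrow> real" where
  "genus2 n = cbin n * (real n * (real n - 1) * (real n - 2) * (real n - 3) * (5 * real n - 2)) / 1440"

lemma cbin_0: "cbin 0 = 1"
  by (simp add: cbin_def)

lemma cbin_Suc: "(real n + 1) * cbin (Suc n) = 2 * (2 * real n + 1) * cbin n"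
proof -
  have "Suc n * (2 * Suc n choose Suc n) = 2 * (Suc n * (Suc (2 * n) choose n))"
    using Suc_times_binomial_eq[of "Suc (2 * n)" n] by (simp add: mult_ac)
  also have "Suc n * (Suc (2 * n) choose n) = Suc (2 * n) * (2 * n choose n)"
    using Suc_times_binomial_eq[of "2 * n" n] binomial_symmetric[of n "Suc (2 * n)"]
    by (simp add: Suc_diff_le mult_ac)
  finally have "real (Suc n * (2 * Suc n choose Suc n)) = real (2 * (Suc (2 * n) * (2 * n choose n)))"
    by (simp only:)
  then show ?thesis
    unfolding cbin_def by (simp only: of_nat_mult of_nat_Suc of_nat_numeral mult.assoc add.commute)
qed

lemma cbin_Suc': "cbin (Suc n) = 2 * (2 * real n + 1) * cbin n / (real n + 1)"
  using cbin_Suc[of n] by (simp add: field_simps)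

text \<open>
  \<open>hz_poly 0\<close> is \<open>k\<close> (the sphere with one vertex and no edge), although \<open>one_face_sum 0 k = 1\<close>.
\<close>

fun hz_poly :: "nat \<Rightarrow> real poly" where
  "hz_poly 0 = monom 1 1"
| "hz_poly (Suc 0) = monom 1 2"
| "hz_poly (Suc (Suc n)) =
    smult (2 * (2 * real n + 3) / (real n + 3)) (pCons 0 (hz_poly (Suc n)))
    + smult ((real n + 1) * (2 * real n + 3) * (2 * real n + 1) / (real n + 3)) (hz_poly n)"

lemma genus0_rec: "genus0 (Suc n) = 2 * (2 * real n + 1) / (real n + 2) * genus0 n"
proof -
  have "real n + 1 \<noteq> 0" "real n + 2 \<noteq> 0" by linarith+
  then show ?thesis unfolding genus0_def cbin_Suc' by (simp add: field_simps)
qed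

text \<open>The coefficient form of the recurrence: the term with the factor \<open>k\<close> keeps
  the genus, the one two edges lower raises it by one. The same pattern gives
  \<open>genus2_rec\<close>.\<close>

lemma genus1_rec:
  "genus1 (Suc (Suc n)) = 2 * (2 * real n + 3) / (real n + 3) * genus1 (Suc n)
    + (real n + 1) * (2 * real n + 3) * (2 * real n + 1) / (real n + 3) * genus0 n"
proof -
  define x c where "x = real n" and "c = cbin n"
  have x: "x + 1 \<noteq> 0" "x + 2 \<noteq> 0" "x + 3 \<noteq> 0" by (simp_all add: x_def)
  have c1: "cbin (Suc n) = 2 * (2 * x + 1) * c / (x + 1)"
    and c2: "cbin (Suc (Suc n)) = 2 * (2 * x + 3) * (2 * (2 * x + 1) * c / (x + 1)) / (x + 2)"
    using cbin_Suc'[of n] cbin_Suc'[of "Suc n"] by (simp_all add: x_def c_def add_ac)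
  have r: "real (Suc n) = x + 1" "real (Suc (Suc n)) = x + 2" by (simp_all add: x_def)
  show ?thesis
    unfolding genus0_def genus1_def c1 c2 r x_def[symmetric] c_def[symmetric]
    using x by (simp add: divide_simps) (simp add: algebra_simps)
qed

lemma genus2_rec:
  "genus2 (Suc (Suc n)) = 2 * (2 * real n + 3) / (real n + 3) * genus2 (Suc n)
    + (real n + 1) * (2 * real n + 3) * (2 * real n + 1) / (real n + 3) * genus1 n"
proof -
  define x c where "x = real n" and "c = cbin n"
  have x: "x + 1 \<noteq> 0" "x + 2 \<noteq> 0" "x + 3 \<noteq> 0" by (simp_all add: x_def)
  have c1: "cbin (Suc n) = 2 * (2 * x + 1) * c / (x + 1)"
    and c2: "cbin (Suc (Suc n)) = 2 * (2 * x + 3) * (2 * (2 * x + 1) * c / (x + 1)) / (x + 2)"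
    using cbin_Suc'[of n] cbin_Suc'[of "Suc n"] by (simp_all add: x_def c_def add_ac)
  have r: "real (Suc n) = x + 1" "real (Suc (Suc n)) = x + 2" by (simp_all add: x_def)
  show ?thesis
    unfolding genus1_def genus2_def c1 c2 r x_def[symmetric] c_def[symmetric]
    using x by (simp add: divide_simps) algebra
qed

text \<open>By Euler's formula a one-face gluing of genus \<open>g\<close> with \<open>n\<close>
  edges has \<open>n + 1 - 2 * g\<close> vertices. The exponents are given by equations such as
  \<open>m + 4 = n + 1\<close>, which hold for no \<open>m\<close> where subtraction would
  truncate.\<close>

lemma coeff_hz_poly:
  "(\<forall>m. n + 1 < m \<or> even (n + m) \<longrightarrow> coeff (hz_poly n) m = 0) \<and>
   coeff (hz_poly n) (n + 1) = genus0 n \<and>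
   (\<forall>m. m + 2 = n + 1 \<longrightarrow> coeff (hz_poly n) m = genus1 n) \<and>
   (\<forall>m. m + 4 = n + 1 \<longrightarrow> coeff (hz_poly n) m = genus2 n)"
proof (induction n rule: hz_poly.induct)
  case 1
  then show ?case by (simp add: genus0_def cbin_0)
next
  case 2
  have "genus0 1 = 1" "genus1 1 = 0" using cbin_Suc'[of 0] by (simp_all add: genus0_def genus1_def cbin_0)
  then show ?case by auto
next
  case (3 n)
  let ?p = "2 * (2 * real n + 3) / (real n + 3)" and ?q = "(real n + 1) * (2 * real n + 3) * (2 * real n + 1) / (real n + 3)"
  have co: "coeff (hz_poly (Suc (Suc n))) m =
      ?p * (case m of 0 \<Rightarrow> 0 | Suc m' \<Rightarrow> coeff (hz_poly (Suc n)) m') + ?q * coeff (hz_poly n) m" for m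
    by (simp add: coeff_pCons split: nat.split)
  show ?case
  proof (intro conjI allI impI)
    fix m assume m: "Suc (Suc n) + 1 < m \<or> even (Suc (Suc n) + m)"
    have "(case m of 0 \<Rightarrow> 0 | Suc m' \<Rightarrow> coeff (hz_poly (Suc n)) m') = 0"
      using 3(1) m by (auto split: nat.split)
    moreover have "coeff (hz_poly n) m = 0" using 3(2) m by auto
    ultimately show "coeff (hz_poly (Suc (Suc n))) m = 0" unfolding co by simp
  next
    have "coeff (hz_poly n) (n + 3) = 0" using 3(2) by simp
    moreover have "coeff (hz_poly (Suc n)) (n + 2) = genus0 (Suc n)" using 3(1) by simp
    ultimately have "coeff (hz_poly (Suc (Suc n))) (n + 3) = ?p * genus0 (Suc n)"
      unfolding co by (simp add: numeral_3_eq_3)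
    then show "coeff (hz_poly (Suc (Suc n))) (Suc (Suc n) + 1) = genus0 (Suc (Suc n))"
      using genus0_rec[of "Suc n"] by (simp add: numeral_3_eq_3 add_ac)
  next
    fix m assume "m + 2 = Suc (Suc n) + 1"
    then have m: "m = Suc n" by simp
    have "coeff (hz_poly (Suc n)) n = genus1 (Suc n)" "coeff (hz_poly n) (Suc n) = genus0 n" using 3 by simp_all
    then show "coeff (hz_poly (Suc (Suc n))) m = genus1 (Suc (Suc n))" unfolding co m genus1_rec by simp
  next
    fix m assume m: "m + 4 = Suc (Suc n) + 1"
    then have "coeff (hz_poly n) m = genus1 n" using 3(2) by simp
    moreover have "(case m of 0 \<Rightarrow> 0 | Suc m' \<Rightarrow> coeff (hz_poly (Suc n)) m') = genus2 (Suc n)"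
    proof (cases m)
      \<comment> \<open>The shifted polynomial has no constant term; this agrees with
        \<open>genus2 2 = 0\<close>.\<close>
      case 0
      then have "n = 1" using m by simp
      then show ?thesis using 0 by (simp add: genus2_def)
    next
      case (Suc m')
      then show ?thesis using 3(1) m by simp
    qed
    ultimately show "coeff (hz_poly (Suc (Suc n))) m = genus2 (Suc (Suc n))" unfolding co genus2_rec by simp
  qed
qed

text \<open>The product has degree \<open>i + j + 2 = N + 4\<close>, so the coefficient at
  \<open>N\<close> lies four below the top and collects the pairs of genera with sum 2.\<close>

lemma coeff_hz_poly_mult:
  assumes "i + j = N + 2"
  shows "coeff (hz_poly i * hz_poly j) N = genus0 i * genus2 j + genus1 i * genus1 j + genus2 i * genus0 j"
proof -
  \<comment> \<open>\<open>d\<close> counts down from the top degree, so even \<open>d\<close>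
    belongs to genus \<open>d div 2\<close>. The guard replaces negative exponents, which truncated
    subtraction would send to the constant term.\<close>
  define A where "A i d = (if d \<le> i + 1 then coeff (hz_poly i) (i + 1 - d) else 0)" for i d :: nat
  have "coeff (hz_poly i * hz_poly j) N = (\<Sum>d\<le>4. A i d * A j (4 - d))"
  proof -
    have "coeff (hz_poly i * hz_poly j) N = (\<Sum>m\<le>N. coeff (hz_poly i) m * coeff (hz_poly j) (N - m))"
      by (rule coeff_mult)
    also have "\<dots> = (\<Sum>m\<in>{m\<in>{..N}. m \<le> i + 1 \<and> i \<le> m + 3}. coeff (hz_poly i) m * coeff (hz_poly j) (N - m))"
    proof (rule sum.mono_neutral_right; (intro ballI)?)
      fix m assume "m \<in> {..N} - {m\<in>{..N}. m \<le> i + 1 \<and> i \<le> m + 3}"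
      then have "m \<le> N" "m > i + 1 \<or> i > m + 3" by auto
      then have "i + 1 < m \<or> j + 1 < N - m" using assms by auto
      then show "coeff (hz_poly i) m * coeff (hz_poly j) (N - m) = 0"
        using coeff_hz_poly[of i] coeff_hz_poly[of j] by auto
    qed auto
    also have "\<dots> = (\<Sum>d\<in>{d\<in>{..4}. d \<le> i + 1 \<and> 4 - d \<le> j + 1}. A i d * A j (4 - d))"
    proof (rule sum.reindex_bij_witness[of _ "\<lambda>d. i + 1 - d" "\<lambda>m. i + 1 - m"])
      fix m assume m: "m \<in> {m\<in>{..N}. m \<le> i + 1 \<and> i \<le> m + 3}"
      then have m': "m \<le> i + j - 2" "m \<le> i + 1" "i \<le> m + 3" using assms by auto
      have "i + 1 - (i + 1 - m) = m" "j + 1 - (4 - (i + 1 - m)) = N - m" "4 - (i + 1 - m) \<le> j + 1"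
        using m' assms by auto
      then show "A i (i + 1 - m) * A j (4 - (i + 1 - m)) = coeff (hz_poly i) m * coeff (hz_poly j) (N - m)"
        by (simp add: A_def)
    qed (use assms in auto)
    also have "\<dots> = (\<Sum>d\<le>4. A i d * A j (4 - d))"
      by (rule sum.mono_neutral_left) (auto simp: A_def)
    finally show ?thesis .
  qed
  moreover have "A i 0 = genus0 i" "A i 1 = 0" "A i 2 = genus1 i" "A i 3 = 0" "A i 4 = genus2 i" for i
  proof -
    note c = coeff_hz_poly[of i]
    show "A i 0 = genus0 i" using c by (simp add: A_def)
    show "A i 1 = 0" using c by (simp add: A_def)
    show "A i 3 = 0" using c by (simp add: A_def)
    show "A i 2 = genus1 i" using c by (cases "i = 0") (auto simp: A_def genus1_def)
    show "A i 4 = genus2 i"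
    proof (cases "i \<ge> 3")
      case False
      then have "i = 0 \<or> i = 1 \<or> i = 2" by auto
      then show ?thesis by (auto simp: A_def genus2_def)
    qed (use c in \<open>simp add: A_def\<close>)
  qed
  ultimately show ?thesis by (simp add: eval_nat_numeral)
qed

section \<open>Generating functions of the genus numbers\<close>

text \<open>\<open>K\<close> is the inverse square root of \<open>u = 1 - 4 X\<close>, characterised
  without taking roots: the recurrence of \<open>cbin\<close> gives \<open>u K' = 2 K\<close>, and
  then \<open>u K^2\<close> has derivative 0.\<close>

lemma fps_cbin:
  defines "K \<equiv> Abs_fps cbin" and "u \<equiv> 1 - fps_const 4 * fps_X"
  shows "u * K\<^sup>2 = 1" "fps_deriv K = 2 * K ^ 3"
proof -
  have uK': "u * fps_deriv K = 2 * K"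
  proof (rule fps_ext)
    fix n
    have "fps_nth (u * fps_deriv K) n = (real n + 1) * cbin (Suc n) - 4 * (if n = 0 then 0 else real n * cbin n)"
      by (cases n) (simp_all add: u_def K_def left_diff_distrib mult.assoc)
    also have "\<dots> = 2 * cbin n" unfolding cbin_Suc by (simp add: algebra_simps)
    also have "\<dots> = fps_nth (2 * K) n" by (simp add: K_def fps_numeral_fps_const)
    finally show "fps_nth (u * fps_deriv K) n = fps_nth (2 * K) n" .
  qed
  have c4: "fps_const (4 :: real) = 4" by (simp add: fps_numeral_fps_const)
  have du: "fps_deriv u = - 4" unfolding u_def c4[symmetric] by simp
  have "fps_deriv (u * K\<^sup>2) = fps_deriv u * K\<^sup>2 + 2 * K * (u * fps_deriv K)"
    by (simp add: power2_eq_square algebra_simps)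
  also have "\<dots> = 0" unfolding uK' du by algebra
  finally have "u * K\<^sup>2 = fps_const (fps_nth (u * K\<^sup>2) 0)" by (simp only: fps_deriv_eq_0_iff)
  also have "fps_nth (u * K\<^sup>2) 0 = 1" by (simp add: u_def K_def cbin_0 power2_eq_square)
  finally show uK: "u * K\<^sup>2 = 1" by simp
  have "fps_deriv K = (u * K\<^sup>2) * fps_deriv K" by (simp add: uK)
  also have "\<dots> = K\<^sup>2 * (u * fps_deriv K)" by (simp only: mult_ac)
  also have "\<dots> = 2 * K ^ 3" unfolding uK' by (simp add: power2_eq_square power3_eq_cube)
  finally show "fps_deriv K = 2 * K ^ 3" .
qed

text \<open>Since \<open>K' = 2 K^3\<close>, differentiation sends powers of \<open>K\<close> to
  multiples of powers. The constant is a parameter so that numerals can be matched.\<close>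

lemma fps_deriv_power_cube:
  fixes f :: "real fps"
  assumes "fps_deriv f = 2 * f ^ 3" and "n > 0" "m = n + 2" "c = fps_const (2 * real n)"
  shows "fps_deriv (f ^ n) = c * f ^ m"
proof -
  have m: "f ^ m = f ^ 3 * f ^ (n - 1)" using assms(2,3) by (simp flip: power_add)
  have c: "c = fps_const (real n) * 2" by (simp add: assms(4) fps_numeral_fps_const mult.commute)
  show ?thesis unfolding m c fps_deriv_power assms(1) by (simp only: mult_ac)
qed

text \<open>\<open>E1\<close>, \<open>E2\<close> and \<open>1 - 2 X E0\<close> are polynomials in
  \<open>X\<close> and \<open>K\<close>, and with \<open>u K^2 = 1\<close> the whole expression
  collapses to \<open>K^10 (21 X^4 + 20 X^5)\<close>. The denominator is
  \<open>768 = 3 * 4^4\<close>.\<close>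

lemma genus_convolution:
  "genus2 (N + 1) - (\<Sum>i\<le>N. genus0 i * genus2 (N - i) + genus1 i * genus1 (N - i) + genus2 i * genus0 (N - i))
    = 4 ^ N * real N * (real N - 1) * (real N - 2) * (13 * real N + 3) / 768"
proof -
  define K u where "K = Abs_fps cbin" and "u = (1 - fps_const 4 * fps_X :: real fps)"
  define E0 E1 E2 where "E0 = Abs_fps genus0" and "E1 = Abs_fps genus1" and "E2 = Abs_fps genus2"
  let ?X = "fps_X :: real fps"
  have uK: "u * K\<^sup>2 = 1" and K': "fps_deriv K = 2 * K ^ 3"
    using fps_cbin unfolding K_def u_def by blast+
  have dK: "fps_deriv (K\<^sup>2) = 4 * K ^ 4" "fps_deriv (K ^ 3) = 6 * K ^ 5" "fps_deriv (K ^ 4) = 8 * K ^ 6"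
    "fps_deriv (K ^ 5) = 10 * K ^ 7" "fps_deriv (K ^ 6) = 12 * K ^ 8" "fps_deriv (K ^ 7) = 14 * K ^ 9"
    "fps_deriv (K ^ 8) = 16 * K ^ 10" "fps_deriv (K ^ 9) = 18 * K ^ 11"
    by (rule fps_deriv_power_cube[OF K']; simp add: fps_numeral_fps_const)+
  have num: "fps_deriv (numeral n * f) = numeral n * fps_deriv f" for n and f :: "real fps"
    by (simp add: fps_numeral_fps_const)
  have K2: "fps_deriv (fps_deriv K) = 12 * K ^ 5"
    unfolding K' num dK by simp
  have K4: "fps_deriv (fps_deriv (fps_deriv (fps_deriv K))) = 1680 * K ^ 9"
    unfolding K2 num dK by simp
  have K5: "fps_deriv (fps_deriv (fps_deriv (fps_deriv (fps_deriv K)))) = 30240 * K ^ 11"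
    unfolding K4 num dK by simp
  \<comment> \<open>Multiplying the coefficients by \<open>n (n - 1)\<close> is the operator
    \<open>X^2 d^2/dX^2\<close>, and \<open>K'' = 12 K^5\<close>.\<close>
  have E1: "E1 = ?X\<^sup>2 * K ^ 5"
  proof (rule fps_ext)
    fix n
    have "12 * fps_nth (?X\<^sup>2 * K ^ 5) n = fps_nth (?X\<^sup>2 * fps_deriv (fps_deriv K)) n"
    proof -
      have "?X\<^sup>2 * (12 * K ^ 5) = fps_const 12 * (?X\<^sup>2 * K ^ 5)"
        by (simp only: fps_numeral_fps_const mult.left_commute)
      then show ?thesis unfolding K2 by (simp only: fps_mult_left_const_nth)
    qed
    also have "\<dots> = real n * (real n - 1) * cbin n"
    proof -
      have "n = 0 \<or> n = 1 \<or> (\<exists>j. n = j + 2)" by presburger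
      then show ?thesis by (auto simp: fps_X_power_mult_nth K_def)
    qed
    finally have y: "fps_nth (?X\<^sup>2 * K ^ 5) n = real n * (real n - 1) * cbin n / 12" by simp
    show "fps_nth E1 n = fps_nth (?X\<^sup>2 * K ^ 5) n" unfolding y by (simp add: E1_def genus1_def)
  qed
  \<comment> \<open>The decomposition \<open>5 n - 2 = 5 (n - 4) + 18\<close> turns the polynomial
    factor into falling factorials of lengths 5 and 4, that is, into the fifth and fourth
    derivatives of \<open>K\<close>.\<close>
  have E2: "1440 * E2 = 5 * (?X ^ 5 * (30240 * K ^ 11)) + 18 * (?X ^ 4 * (1680 * K ^ 9))"
  proof (rule fps_ext)
    fix n
    let ?x = "real n"
    have "fps_nth (?X ^ 5 * (30240 * K ^ 11)) n = ?x * (?x - 1) * (?x - 2) * (?x - 3) * (?x - 4) * cbin n"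
    proof (cases "n < 5")
      case True
      then have "n = 0 \<or> n = 1 \<or> n = 2 \<or> n = 3 \<or> n = 4" by auto
      then show ?thesis by (auto simp: fps_X_power_mult_nth)
    next
      case False
      then obtain j where "n = j + 5" using le_Suc_ex[of 5 n] by (auto simp: add.commute)
      then show ?thesis unfolding K5[symmetric]
        by (simp add: fps_X_power_mult_nth K_def numeral_eq_Suc) (simp add: algebra_simps)
    qed
    moreover have "fps_nth (?X ^ 4 * (1680 * K ^ 9)) n = ?x * (?x - 1) * (?x - 2) * (?x - 3) * cbin n"
    proof (cases "n < 4")
      case True
      then have "n = 0 \<or> n = 1 \<or> n = 2 \<or> n = 3" by auto
      then show ?thesis by (auto simp: fps_X_power_mult_nth)
    next
      case False
      then obtain j where "n = j + 4" using le_Suc_ex[of 4 n] by (auto simp: add.commute)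
      then show ?thesis unfolding K4[symmetric]
        by (simp add: fps_X_power_mult_nth K_def numeral_eq_Suc) (simp add: algebra_simps)
    qed
    ultimately show "fps_nth (1440 * E2) n = fps_nth (5 * (?X ^ 5 * (30240 * K ^ 11)) + 18 * (?X ^ 4 * (1680 * K ^ 9))) n"
      by (simp add: fps_numeral_fps_const E2_def genus2_def) (simp add: algebra_simps)
  qed
  \<comment> \<open>The Catalan series \<open>(1 - sqrt (1 - 4 X)) / (2 X)\<close>, with
    \<open>u * K\<close> as the square root.\<close>
  have E0: "1 - 2 * ?X * E0 = u * K"
  proof (rule fps_ext)
    fix n show "fps_nth (1 - 2 * ?X * E0) n = fps_nth (u * K) n"
    proof (cases n)
      case 0
      then show ?thesis by (simp add: u_def K_def cbin_0)
    next
      case (Suc m)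
      have "fps_nth (1 - 2 * ?X * E0) n = - (2 * genus0 m)"
        by (simp add: Suc fps_numeral_fps_const E0_def mult.assoc)
      also have "\<dots> = cbin (Suc m) - 4 * cbin m"
        unfolding genus0_def cbin_Suc' by (simp add: field_simps)
      also have "\<dots> = fps_nth (u * K) n"
        by (simp add: Suc u_def K_def left_diff_distrib mult.assoc)
      finally show ?thesis .
    qed
  qed
  have u: "u = 1 - 4 * ?X" by (simp add: u_def fps_numeral_fps_const)
  have main: "E2 - ?X * (E0 * E2 + E1 * E1 + E2 * E0) = K ^ 10 * (21 * ?X ^ 4 + 20 * ?X ^ 5)"
  proof -
    have eq: "1440 * E2 = 1440 * (21 * ?X ^ 4 * (1 + ?X) * K ^ 11)"
    proof -
      \<comment> \<open>Raising \<open>K^9\<close> to \<open>u K^11\<close> brings both parts of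
        \<open>E2\<close> to one power of \<open>K\<close>; they then add up to
        \<open>30240 X^4 (1 + X) K^11\<close>, and \<open>30240 = 1440 * 21\<close>.\<close>
      have "K ^ 9 = (u * K\<^sup>2) * K ^ 9" by (simp add: uK)
      then have "K ^ 9 = u * K ^ 11" by (simp add: power2_eq_square eval_nat_numeral mult_ac)
      then show ?thesis unfolding E2 u by algebra
    qed
    have "(1440 :: real fps) \<noteq> 0" by (simp add: fps_numeral_fps_const)
    from iffD1[OF mult_left_cancel[OF this] eq] have E2': "E2 = 21 * ?X ^ 4 * (1 + ?X) * K ^ 11" .
    have "E2 - ?X * (E0 * E2 + E1 * E1 + E2 * E0) = E2 * (1 - 2 * ?X * E0) - ?X * E1\<^sup>2"
      by (simp add: algebra_simps power2_eq_square)
    also have "\<dots> = 21 * ?X ^ 4 * (1 + ?X) * K ^ 10 * (u * K\<^sup>2) - ?X * (?X\<^sup>2 * K ^ 5)\<^sup>2"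
      unfolding E0 E2' E1 by algebra
    also have "\<dots> = K ^ 10 * (21 * ?X ^ 4 + 20 * ?X ^ 5)" unfolding uK by algebra
    finally show ?thesis .
  qed
  \<comment> \<open>\<open>K^10\<close> is the inverse fifth power of \<open>1 - 4 X\<close>; the
    coefficients come from four derivatives of the geometric series \<open>K^2\<close>, with
    \<open>4 * 8 * 12 * 16 = 6144\<close>.\<close>
  have W: "fps_nth (K ^ 10) n = 4 ^ n * ((real n + 1) * (real n + 2) * (real n + 3) * (real n + 4)) / 24" for n
  proof -
    define P where "P = Abs_fps (\<lambda>n. 4 ^ n :: real)"
    have "u * P = 1"
    proof (rule fps_ext)
      fix n show "fps_nth (u * P) n = fps_nth 1 n"
        by (cases n) (simp_all add: u_def P_def left_diff_distrib mult.assoc)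
    qed
    then have "K\<^sup>2 = P" using uK by (metis mult.assoc mult.commute mult_1)
    moreover have "fps_deriv (fps_deriv (fps_deriv (fps_deriv (K\<^sup>2)))) = 6144 * K ^ 10"
      unfolding dK num by simp
    ultimately have "6144 * fps_nth (K ^ 10) n = fps_nth (fps_deriv (fps_deriv (fps_deriv (fps_deriv P)))) n"
      by (simp add: fps_numeral_fps_const)
    also have "\<dots> = (real n + 1) * (real n + 2) * (real n + 3) * (real n + 4) * 4 ^ (n + 4)"
      by (simp add: P_def numeral_eq_Suc algebra_simps)
    finally show ?thesis by (simp add: power_add field_simps)
  qed
  have "genus2 (N + 1) - (\<Sum>i\<le>N. genus0 i * genus2 (N - i) + genus1 i * genus1 (N - i) + genus2 i * genus0 (N - i))
      = fps_nth (E2 - ?X * (E0 * E2 + E1 * E1 + E2 * E0)) (N + 1)"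
  proof -
    have shift: "fps_nth (E2 - ?X * F) (N + 1) = genus2 (N + 1) - fps_nth F N" for F
      by (simp add: E2_def)
    show ?thesis unfolding shift
      by (simp only: E0_def E1_def E2_def fps_add_nth fps_mult_nth fps_nth_Abs_fps sum.distrib atLeast0AtMost)
  qed
  also have "\<dots> = fps_nth (21 * (?X ^ 4 * K ^ 10) + 20 * (?X ^ 5 * K ^ 10)) (N + 1)"
    unfolding main by (simp add: algebra_simps)
  also have "\<dots> = 21 * (if N + 1 < 4 then 0 else fps_nth (K ^ 10) (N - 3)) + 20 * (if N + 1 < 5 then 0 else fps_nth (K ^ 10) (N - 4))"
    by (simp add: fps_numeral_fps_const fps_X_power_mult_nth)
  also have "\<dots> = 4 ^ N * real N * (real N - 1) * (real N - 2) * (13 * real N + 3) / 768"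
  proof -
    \<comment> \<open>Below 3 no term is present and the right side vanishes, at 3 only the first
      term is; from 4 on both are and combine through
      \<open>84 (N + 1) + 20 (N - 3) = 8 (13 N + 3)\<close>.\<close>
    have "N = 0 \<or> N = 1 \<or> N = 2 \<or> N = 3 \<or> (\<exists>j. N = j + 4)" by presburger
    then consider "N = 0 \<or> N = 1 \<or> N = 2" | "N = 3" | j where "N = j + 4" by blast
    then show ?thesis
    proof cases
      case 3
      then show ?thesis by (simp add: W power_add Suc_diff_le field_simps)
    qed (auto simp: W)
  qed
  finally show ?thesis .
qed

section \<open>Counting tori\<close>

lemma one_face_sum_poly:
  assumes "n \<ge> 1" "k \<ge> 2"
  shows "one_face_sum (2 * n) k = poly (hz_poly n) (real k)"
  using assms
proof (induction n rule: hz_poly.induct)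
  case 2
  then show ?case by (simp add: one_face_sum_2[simplified] poly_monom)
next
  case (3 n)
  show ?case
  proof (cases n)
    \<comment> \<open>Two edges are checked directly: the recurrence for \<open>hz_poly 2\<close>
      uses \<open>hz_poly 0\<close>, which is not the value of
      \<open>one_face_sum 0\<close>.\<close>
    case 0
    then show ?thesis
      using one_face_sum_4[of k] by (simp add: poly_monom power3_eq_cube power2_eq_square)
  next
    case (Suc j)
    have "real n + 3 \<noteq> 0" by linarith
    moreover have "(real n + 3) * one_face_sum (2 * Suc (Suc n)) k =
       2 * (2 * real n + 3) * real k * one_face_sum (2 * Suc n) k
       + (real n + 1) * (2 * real n + 3) * (2 * real n + 1) * one_face_sum (2 * n) k"
      using harer_zagier_recurrence[of "Suc (Suc n)" k] Suc 3(4) by (simp add: algebra_simps)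
    moreover have "one_face_sum (2 * Suc n) k = poly (hz_poly (Suc n)) (real k)"
      "one_face_sum (2 * n) k = poly (hz_poly n) (real k)"
      using 3 Suc by auto
    ultimately have "one_face_sum (2 * Suc (Suc n)) k =
       (2 * (2 * real n + 3) * real k * poly (hz_poly (Suc n)) (real k)
       + (real n + 1) * (2 * real n + 3) * (2 * real n + 1) * poly (hz_poly n) (real k)) / (real n + 3)"
      by (simp only: eq_divide_eq mult.commute) simp
    then show ?thesis
      by (simp only: hz_poly.simps poly_add poly_smult poly_pCons add_divide_distrib times_divide_eq_left add_0 mult.assoc)
  qed
qed simp

definition num_vertices :: "nat \<times> nat \<times> (nat \<Rightarrow> nat) \<Rightarrow> nat" where
  "num_vertices = (\<lambda>(m1, m2, \<iota>). num_cycles {1..m1 + m2} (face_perm m1 m2 \<circ> \<iota>))"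

lemma connected_gluing_data_eq:
  "{d \<in> two_face_gluing_data N. gluing_connected d} =
    (\<lambda>(m, \<iota>). (m, 2 * N - m, \<iota>)) `
      (SIGMA m:{1..<2 * N}. {\<iota> \<in> fpf_involutions {1..2 * N}. \<iota> ` {1..m} \<noteq> {1..m}})"
proof (intro equalityI subsetI)
  fix d assume "d \<in> {d \<in> two_face_gluing_data N. gluing_connected d}"
  then obtain m1 m2 \<iota> where d: "d = (m1, m2, \<iota>)" "1 \<le> m1" "1 \<le> m2" "m1 + m2 = 2 * N"
    "\<iota> \<in> fpf_involutions {1..2 * N}" and con: "gluing_connected (m1, m2, \<iota>)"
    by (auto simp: two_face_gluing_data_def fpf_involutions_def)
  then have "\<iota> ` {1..m1} \<noteq> {1..m1}" using gluing_connected_iff[of m1 m2 \<iota>] by simp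
  moreover have "d = (\<lambda>(m, \<iota>). (m, 2 * N - m, \<iota>)) (m1, \<iota>)" using d(1,4) by auto
  moreover have "m1 \<in> {1..<2 * N}" using d(2-4) by auto
  ultimately show "d \<in> (\<lambda>(m, \<iota>). (m, 2 * N - m, \<iota>)) `
      (SIGMA m:{1..<2 * N}. {\<iota> \<in> fpf_involutions {1..2 * N}. \<iota> ` {1..m} \<noteq> {1..m}})"
    using d(5) by blast
next
  fix d assume "d \<in> (\<lambda>(m, \<iota>). (m, 2 * N - m, \<iota>)) `
      (SIGMA m:{1..<2 * N}. {\<iota> \<in> fpf_involutions {1..2 * N}. \<iota> ` {1..m} \<noteq> {1..m}})"
  then obtain p where p: "p \<in> (SIGMA m:{1..<2 * N}. {\<iota> \<in> fpf_involutions {1..2 * N}. \<iota> ` {1..m} \<noteq> {1..m}})"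
    "d = (\<lambda>(m, \<iota>). (m, 2 * N - m, \<iota>)) p" by (rule imageE)
  obtain m \<iota> where m\<iota>: "p = (m, \<iota>)" by (cases p)
  have d: "d = (m, 2 * N - m, \<iota>)" "m \<in> {1..<2 * N}"
    "\<iota> \<in> fpf_involutions {1..2 * N}" "\<iota> ` {1..m} \<noteq> {1..m}" using p unfolding m\<iota> by simp_all
  have "m + (2 * N - m) = 2 * N" "1 \<le> m" "1 \<le> 2 * N - m" using d(2) by auto
  then have "gluing_connected (m, 2 * N - m, \<iota>)"
    using gluing_connected_iff[of m "2 * N - m" \<iota>] d(3,4) by simp
  then show "d \<in> {d \<in> two_face_gluing_data N. gluing_connected d}"
    using d by (auto simp: two_face_gluing_data_def fpf_involutions_def)
qed

lemma finite_connected_gluing_data: "finite {d \<in> two_face_gluing_data N. gluing_connected d}"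
  unfolding connected_gluing_data_eq
  by (intro finite_imageI finite_SigmaI) (auto intro: finite_subset[OF _ finite_fpf_involutions])

text \<open>For each first face length the disconnected gluings are those that preserve the first
  face, and their sum is a product of two one-face sums. The total over all lengths is supplied by
  root edge deletion.\<close>

lemma sum_connected_gluings:
  assumes "N \<ge> 1"
  shows "(\<Sum>d | d \<in> two_face_gluing_data N \<and> gluing_connected d. real k ^ num_vertices d) =
    one_face_sum (2 * Suc N) k - 2 * real k * one_face_sum (2 * N) k
    - (\<Sum>i = 1..<N. one_face_sum (2 * i) k * one_face_sum (2 * (N - i)) k)"
proof -
  let ?I = "fpf_involutions {1..2 * N}"
  define h where "h m \<iota> = real (card (colourings {1..2 * N} (face_perm m (2 * N - m)) \<iota> k))" for m \<iota>
  have fin: "finite ?I" by (rule finite_fpf_involutions) simp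
  have h: "real k ^ num_vertices (m, 2 * N - m, \<iota>) = h m \<iota>" if "m \<in> {1..<2 * N}" "\<iota> \<in> ?I" for m \<iota>
  proof -
    have m: "m + (2 * N - m) = 2 * N" using that(1) by auto
    then have "face_perm m (2 * N - m) permutes {1..2 * N}" using face_perm_permutes[of m "2 * N - m"] by simp
    from card_colourings[OF _ this that(2), of k] show ?thesis by (simp add: h_def num_vertices_def m)
  qed
  have "(\<Sum>d | d \<in> two_face_gluing_data N \<and> gluing_connected d. real k ^ num_vertices d) =
     (\<Sum>(m, \<iota>)\<in>(SIGMA m:{1..<2 * N}. {\<iota> \<in> ?I. \<iota> ` {1..m} \<noteq> {1..m}}). real k ^ num_vertices (m, 2 * N - m, \<iota>))"
    unfolding connected_gluing_data_eq[of N]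
    by (subst sum.reindex) (auto simp: inj_on_def case_prod_unfold)
  also have "\<dots> = (\<Sum>m = 1..<2 * N. \<Sum>\<iota> | \<iota> \<in> ?I \<and> \<iota> ` {1..m} \<noteq> {1..m}. real k ^ num_vertices (m, 2 * N - m, \<iota>))"
    using fin by (intro sum.Sigma[symmetric]) auto
  also have "\<dots> = (\<Sum>m = 1..<2 * N. \<Sum>\<iota> | \<iota> \<in> ?I \<and> \<iota> ` {1..m} \<noteq> {1..m}. h m \<iota>)"
    using h by (intro sum.cong refl) auto
  also have "\<dots> = (\<Sum>m = 1..<2 * N. two_face_sum m (2 * N - m) k - one_face_sum m k * one_face_sum (2 * N - m) k)"
  proof (intro sum.cong refl)
    fix m assume m: "m \<in> {1..<2 * N}"
    let ?xs = "[1..<m + 1]" and ?ys = "[m + 1..<2 * N + 1]"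
    have sets: "set ?xs = {1..m}" "set ?ys = {m + 1..2 * N}" by (auto simp del: upt_Suc)
    have m': "m + (2 * N - m) = 2 * N" using m by auto
    have un: "{1..m} \<union> {m + 1..2 * N} = {1..2 * N}" using m by auto
    have fp: "face_perm m (2 * N - m) = cycle_of_list ?xs \<circ> cycle_of_list ?ys"
      by (simp only: face_perm_def m')
    have "(\<Sum>\<iota> | \<iota> \<in> ?I \<and> \<iota> ` {1..m} = {1..m}. h m \<iota>) =
       gluing_sum {1..m} (cycle_of_list ?xs) k * gluing_sum {m + 1..2 * N} (cycle_of_list ?ys) k"
      using gluing_sum_disjoint_union[of "{1..m}" "{m + 1..2 * N}" "cycle_of_list ?xs" "cycle_of_list ?ys" k]
        cycle_permutes[of ?xs] cycle_permutes[of ?ys] unfolding sets un h_def fp by auto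
    also have "gluing_sum {1..m} (cycle_of_list ?xs) k = one_face_sum m k" by (simp add: one_face_sum_def)
    also have "gluing_sum {m + 1..2 * N} (cycle_of_list ?ys) k = one_face_sum (2 * N - m) k"
      using one_face_sum_eq[of ?ys k] distinct_upt unfolding sets by (simp del: upt_Suc)
    finally have dis: "(\<Sum>\<iota> | \<iota> \<in> ?I \<and> \<iota> ` {1..m} = {1..m}. h m \<iota>) = one_face_sum m k * one_face_sum (2 * N - m) k" .
    have "two_face_sum m (2 * N - m) k = (\<Sum>\<iota>\<in>?I. h m \<iota>)"
      by (simp only: two_face_sum_def gluing_sum_def h_def m')
    also have "\<dots> = (\<Sum>\<iota> | \<iota> \<in> ?I \<and> \<iota> ` {1..m} = {1..m}. h m \<iota>) + (\<Sum>\<iota> | \<iota> \<in> ?I \<and> \<iota> ` {1..m} \<noteq> {1..m}. h m \<iota>)"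
      using fin by (subst sum.union_disjoint[symmetric]) (auto intro: sum.cong)
    finally show "(\<Sum>\<iota> | \<iota> \<in> ?I \<and> \<iota> ` {1..m} \<noteq> {1..m}. h m \<iota>) =
        two_face_sum m (2 * N - m) k - one_face_sum m k * one_face_sum (2 * N - m) k"
      unfolding dis by simp
  qed
  also have "\<dots> = (\<Sum>m = 1..<2 * N. two_face_sum m (2 * N - m) k)
     - (\<Sum>m = 1..<2 * N. one_face_sum m k * one_face_sum (2 * N - m) k)"
    by (rule sum_subtractf)
  \<comment> \<open>A face with an odd number of sides cannot be glued to itself.\<close>
  also have "(\<Sum>m = 1..<2 * N. one_face_sum m k * one_face_sum (2 * N - m) k) =
     (\<Sum>m\<in>{m\<in>{1..<2 * N}. even m}. one_face_sum m k * one_face_sum (2 * N - m) k)"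
    by (rule sum.mono_neutral_right) (auto simp: one_face_sum_odd)
  also have "\<dots> = (\<Sum>i = 1..<N. one_face_sum (2 * i) k * one_face_sum (2 * (N - i)) k)"
    by (rule sum.reindex_bij_witness[of _ "\<lambda>i. 2 * i" "\<lambda>m. m div 2"]) (auto simp: diff_mult_distrib2)
  finally show ?thesis using one_face_sum_loop[OF assms, of k] by simp
qed

text \<open>A nonzero difference would have infinitely many roots.\<close>

lemma poly_eqI_nat:
  fixes p q :: "real poly"
  assumes "\<And>k. k \<ge> n0 \<Longrightarrow> poly p (real k) = poly q (real k)"
  shows "p = q"
proof (rule ccontr)
  assume "p \<noteq> q"
  then have "finite {x. poly (p - q) x = 0}" by (intro poly_roots_finite) simp
  moreover have "real ` {n0..} \<subseteq> {x. poly (p - q) x = 0}" using assms by auto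
  ultimately have "finite (real ` {n0..})" by (rule finite_subset[rotated])
  then show False by (simp add: finite_image_iff infinite_Ici)
qed

theorem theorem8:
  fixes N :: nat
  assumes "N \<ge> 1"
  shows "real (eps1_two N) =
    4 powi (int N - 4) *
      ((real N * (real N - 1) * (real N - 2) * (13 * real N + 3)) / 3)"
proof (cases "N = 1")
  \<comment> \<open>A torus would need -1 vertices, and the formula has the factor
    \<open>N - 1\<close>.\<close>
  case True
  then have empty: "{d \<in> two_face_gluing_data N. gluing_connected d \<and> gluing_genus_one d N} = {}"
    by (auto simp: gluing_genus_one_def)
  show ?thesis unfolding eps1_two_def empty using True by simp
next
  case False
  then obtain M where N: "N = M + 2" using assms by (metis One_nat_def Suc_leI add.commute le_Suc_ex le_neq_implies_less numeral_2_eq_2)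
  define D where "D = {d \<in> two_face_gluing_data N. gluing_connected d}"
  \<comment> \<open>Counts connected gluings by their number of vertices \<open>V\<close>. On a
    torus \<open>V - N + 2 = 0\<close>, so the coefficient at \<open>M = N - 2\<close> is
    wanted.\<close>
  define P where "P = (\<Sum>d\<in>D. monom (1 :: real) (num_vertices d))"
  have fin: "finite D" unfolding D_def by (rule finite_connected_gluing_data)
  have "{d \<in> two_face_gluing_data N. gluing_connected d \<and> gluing_genus_one d N} = {d \<in> D. num_vertices d = M}"
    unfolding D_def
    by (auto simp: two_face_gluing_data_def gluing_genus_one_def num_vertices_def N)
  then have "real (eps1_two N) = coeff P M"
    using fin by (simp add: eps1_two_def P_def coeff_sum sum.If_cases Int_def)
  also have "P = hz_poly (N + 1) - (\<Sum>i\<le>N. hz_poly i * hz_poly (N - i))"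
  proof (rule poly_eqI_nat[of 2])
    fix k :: nat assume k: "k \<ge> 2"
    have "poly P (real k) = (\<Sum>d\<in>D. real k ^ num_vertices d)" by (simp add: P_def poly_sum poly_monom)
    also have "\<dots> = one_face_sum (2 * Suc N) k - 2 * real k * one_face_sum (2 * N) k
      - (\<Sum>i = 1..<N. one_face_sum (2 * i) k * one_face_sum (2 * (N - i)) k)"
      unfolding D_def by (rule sum_connected_gluings[OF assms])
    also have "(\<Sum>i = 1..<N. one_face_sum (2 * i) k * one_face_sum (2 * (N - i)) k) =
       (\<Sum>i = 1..<N. poly (hz_poly i) (real k) * poly (hz_poly (N - i)) (real k))"
      using k by (intro sum.cong refl arg_cong2[where f = "(*)"] one_face_sum_poly) auto
    also have "one_face_sum (2 * Suc N) k = poly (hz_poly (Suc N)) (real k)"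
      by (rule one_face_sum_poly) (use k in auto)
    also have "one_face_sum (2 * N) k = poly (hz_poly N) (real k)"
      by (rule one_face_sum_poly) (use k assms in auto)
    finally have "poly P (real k) = poly (hz_poly (Suc N)) (real k) - 2 * real k * poly (hz_poly N) (real k)
      - (\<Sum>i = 1..<N. poly (hz_poly i) (real k) * poly (hz_poly (N - i)) (real k))" .
    \<comment> \<open>At the two ends of the convolution \<open>hz_poly 0\<close> contributes the
      factor \<open>k\<close>; these terms match the two with an empty face in root edge
      deletion.\<close>
    moreover have "{..N} = insert 0 (insert N {1..<N})" using assms by auto
    then have "(\<Sum>i\<le>N. poly (hz_poly i) (real k) * poly (hz_poly (N - i)) (real k)) =
      2 * real k * poly (hz_poly N) (real k)
      + (\<Sum>i = 1..<N. poly (hz_poly i) (real k) * poly (hz_poly (N - i)) (real k))"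
      using assms by (simp add: poly_monom)
    ultimately show "poly P (real k) = poly (hz_poly (N + 1) - (\<Sum>i\<le>N. hz_poly i * hz_poly (N - i))) (real k)"
      by (simp add: poly_sum)
  qed
  also have "coeff \<dots> M = genus2 (N + 1)
      - (\<Sum>i\<le>N. genus0 i * genus2 (N - i) + genus1 i * genus1 (N - i) + genus2 i * genus0 (N - i))"
  proof -
    have "coeff (hz_poly (N + 1)) M = genus2 (N + 1)" using coeff_hz_poly[of "N + 1"] N by simp
    moreover have "coeff (hz_poly i * hz_poly (N - i)) M
        = genus0 i * genus2 (N - i) + genus1 i * genus1 (N - i) + genus2 i * genus0 (N - i)" if "i \<le> N" for i
      by (rule coeff_hz_poly_mult) (use N that in simp)
    ultimately show ?thesis by (simp add: coeff_sum)
  qed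
  also have "\<dots> = 4 ^ N * real N * (real N - 1) * (real N - 2) * (13 * real N + 3) / 768"
    by (rule genus_convolution)
  \<comment> \<open>\<open>768 = 3 * 256\<close>; \<open>powi\<close> keeps the identity valid for
    \<open>N < 4\<close>.\<close>
  also have "4 ^ N = 256 * (4 :: real) powi (int N - 4)"
    by (simp add: power_int_diff)
  finally show ?thesis by simp
qed

end
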